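(* Let $\Delta'$ be a finite (possibly non-crystallographic) root system of rank $n'$, let $Q'$ be a weighted acyclic quiver of type $\Delta'$, and let $Q$ (of simply-laced type $\Delta$, rank $n$) be its weighted unfolding, with block map $P$ and weights $w_j$. Let $\mathbb{A}_Q\subset\mathbb{R}^n$ be the realization of the generalized associahedron of $Q$ obtained by the mesh-relation construction, with positive parameters $c_{kj}$ satisfying $w_ic_{kj}=w_jc_{ki}$ whenever $i,j$ lie in the same block. Let $\Pi$ be the intersection of all hyperplanes $w_jt_{ki}=w_it_{kj}$, where $i,j$ range over pairs in the same block and $k$ over all admissible values. Then the section $\Pi\cap\mathbb{A}_Q$ is (a realization of) the generalized associahedron $\mathbb{A}_{Q'}$ of $Q'$, and the normal fan of $\Pi\cap\mathbb{A}_Q$ is precisely the $\mathbf{g}$-vector fan of $Q'$.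
   Context: Mesh-relation construction: let $Q$ be an orientation of a simply-laced Dynkin diagram of rank $n$, with root system $\Delta$ and Coxeter number $h$. The almost positive roots $\Delta_{\ge -1}$ (positive roots and negative simple roots) correspond to the indecomposable objects of the category $\mathcal{C}_Q$ consisting of indecomposable representations of $Q$ together with shifted projectives in $D^b(\mathrm{rep}\,Q)$, arranged in the Auslander–Reiten quiver. These objects (equivalently the cluster variables $x_{ki}$ of the cluster algebra of $Q$) are indexed as $x_{ki}$, where $i\in\{1,\dots,n\}$ is the row (vertex of $Q$) and $k$ is the number of applications of $\tau^{-1}$ (inverse Auslander–Reiten translation) to the initial (shifted projective) object in row $i$; $k$ runs from $1$ to $(h+2)/2$ if $h$ is even and to $(h+3)/2$ if $h$ is odd. Introduce a real variable $t_{ki}$ for each such object (a vector space of dimension $N=n(h+2)/2$) and a positive constant $c_M$ for each indecomposable representation $M$ (indexed $c_{ki}$ likewise). For every Auslander–Reiten sequence $0\to\tau M\to E\to M\to 0$ impose the mesh relation $t_{\tau M}+t_M=\sum_{E'} t_{E'}+c_M$, the sum over indecomposable summands $E'$ of $E$ lying in $\mathcal{C}_Q$. The intersection of the affine subspace so defined with the positive orthant $\{t\ge 0\}$ is an $n$-dimensional polytope $\mathbb{A}_Q$ realizing the generalized associahedron of $Q$ (with Coxeter element determined by $Q$); its facets are $\{t_{ki}=0\}$. The affine subspace is identified with $\mathbb{R}^n$ via the initial coordinates $(t_{11},\dots,t_{1n})$, with the standard inner product; the normal fan of $\mathbb{A}_Q$ is the $\mathbf{g}$-vector fan of $Q$ (g-vectors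 written in the basis of initial g-vectors). Weighted unfolding: every finite root system $\Delta'$ of rank $n'$ (including $H_3,H_4,I_2(m)$) arises by folding from a simply-laced $\Delta$ via a standard weighted unfolding (Lusztig, Stembridge, Duffield–Tumarkin): an acyclic quiver $Q$ of type $\Delta$, a surjection $P$ from the vertices of $Q$ onto the vertices of $Q'$ (the fibres of $P$ are called blocks), and positive weights $w_j$ attached to vertices $j$ of $Q$ (all $w_j=1$ when $\Delta'$ is crystallographic); all variables $t_{kj}$ in row $j$ are said to have weight $w_j$. For non-crystallographic $Q'$, $\mathbf{g}$-vectors and the $\mathbf{g}$-vector fan are those defined by Duffield–Tumarkin via Nakanishi–Zelevinsky tropical duality. *)

theory Defs
  imports "HOL-Analysis.Analysis"
begin

section \<open>Finite root systems, not necessarily crystallographic\<close>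

definition reflection :: "'a::real_inner \<Rightarrow> 'a \<Rightarrow> 'a" where
  "reflection a v = v - (2 * (v \<bullet> a) / (a \<bullet> a)) *\<^sub>R a"

text \<open>Reduced, of rank \<^term>\<open>CARD('n)\<close>; irreducibility is not required.\<close>

definition root_system :: "(real^'n) set \<Rightarrow> bool" where
  "root_system \<Phi> \<longleftrightarrow> finite \<Phi> \<and> 0 \<notin> \<Phi> \<and> span \<Phi> = UNIV \<and>
     (\<forall>a\<in>\<Phi>. reflection a ` \<Phi> = \<Phi>) \<and>
     (\<forall>a\<in>\<Phi>. \<forall>r. r *\<^sub>R a \<in> \<Phi> \<longrightarrow> r = 1 \<or> r = - 1)"

definition simple_system :: "(real^'n) set \<Rightarrow> ('n \<Rightarrow> real^'n) \<Rightarrow> bool" where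
  "simple_system \<Phi> \<alpha> \<longleftrightarrow> inj \<alpha> \<and> range \<alpha> \<subseteq> \<Phi> \<and> independent (range \<alpha>) \<and>
     (\<forall>\<beta>\<in>\<Phi>. \<exists>x. \<beta> = (\<Sum>i\<in>UNIV. x i *\<^sub>R \<alpha> i) \<and> ((\<forall>i. 0 \<le> x i) \<or> (\<forall>i. x i \<le> 0)))"

definition cartan :: "('n \<Rightarrow> real^'n) \<Rightarrow> 'n \<Rightarrow> 'n \<Rightarrow> real" where
  "cartan \<alpha> i j = 2 * (\<alpha> i \<bullet> \<alpha> j) / (\<alpha> i \<bullet> \<alpha> i)"

definition crystallographic :: "('n \<Rightarrow> real^'n) \<Rightarrow> bool" where
  "crystallographic \<alpha> \<longleftrightarrow> (\<forall>i j. cartan \<alpha> i j \<in> \<int>)"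

definition simply_laced :: "('n \<Rightarrow> real^'n) \<Rightarrow> bool" where
  "simply_laced \<alpha> \<longleftrightarrow> (\<forall>i j. i \<noteq> j \<longrightarrow> cartan \<alpha> i j \<in> {0, - 1})"


section \<open>The cluster complex and generalized associahedra\<close>

text \<open>
  The cluster complex of Fomin and Zelevinsky (\<open>Y\<close>-systems and generalized associahedra), in the
  generality of Fomin and Reading, where the root system may be non-crystallographic.
\<close>

definition almost_positive_roots :: "(real^'n) set \<Rightarrow> ('n \<Rightarrow> real^'n) \<Rightarrow> (real^'n) set" where
  "almost_positive_roots \<Phi> \<alpha> =
     {\<beta>\<in>\<Phi>. \<exists>x. \<beta> = (\<Sum>i\<in>UNIV. x i *\<^sub>R \<alpha> i) \<and> (\<forall>i. 0 \<le> x i)} \<union> range (\<lambda>i. - \<alpha> i)"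

text \<open>\<open>J\<close> is one of the two colour classes of a 2-colouring of the Coxeter diagram.\<close>

definition colour_class :: "('n \<Rightarrow> real^'n) \<Rightarrow> 'n set \<Rightarrow> bool" where
  "colour_class \<alpha> J \<longleftrightarrow> (\<forall>i j. i \<noteq> j \<and> (i \<in> J \<longleftrightarrow> j \<in> J) \<longrightarrow> \<alpha> i \<bullet> \<alpha> j = 0)"

text \<open>
  The maps \<open>\<tau>\<^sub>+\<close> and \<open>\<tau>\<^sub>-\<close>. The simple roots in a colour class are pairwise orthogonal, so the product of
  their commuting reflections is given by the sum below.
\<close>

definition rotation :: "('n::finite \<Rightarrow> real^'n) \<Rightarrow> 'n set \<Rightarrow> real^'n \<Rightarrow> real^'n" where
  "rotation \<alpha> J \<beta> =
     (if \<exists>i. i \<notin> J \<and> \<beta> = - \<alpha> i then \<beta>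
      else \<beta> - (\<Sum>i\<in>J. (2 * (\<beta> \<bullet> \<alpha> i) / (\<alpha> i \<bullet> \<alpha> i)) *\<^sub>R \<alpha> i))"

text \<open>
  Compatibility of distinct almost positive roots: it is invariant under both rotations, and
  \<open>- \<alpha> i\<close> is compatible with \<open>\<beta>\<close> iff \<open>\<alpha> i\<close> does not occur in \<open>\<beta>\<close>. As every almost positive root can be
  rotated into a negative simple root, the least relation closed under the two rules is the intended one.
\<close>

inductive compatible :: "(real^'n) set \<Rightarrow> ('n \<Rightarrow> real^'n) \<Rightarrow> real^'n \<Rightarrow> real^'n \<Rightarrow> bool"
  for \<Phi> :: "(real^'n) set" and \<alpha> :: "'n::finite \<Rightarrow> real^'n" where
  negative_simple: "\<beta> \<in> almost_positive_roots \<Phi> \<alpha> \<Longrightarrow> \<beta> \<in> span (\<alpha> ` (- {i}))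
     \<Longrightarrow> compatible \<Phi> \<alpha> (- \<alpha> i) \<beta>"
| rotate: "\<beta> \<in> almost_positive_roots \<Phi> \<alpha> \<Longrightarrow> \<gamma> \<in> almost_positive_roots \<Phi> \<alpha> \<Longrightarrow> colour_class \<alpha> J
     \<Longrightarrow> compatible \<Phi> \<alpha> (rotation \<alpha> J \<beta>) (rotation \<alpha> J \<gamma>) \<Longrightarrow> compatible \<Phi> \<alpha> \<beta> \<gamma>"

definition cluster_complex :: "(real^'n) set \<Rightarrow> ('n::finite \<Rightarrow> real^'n) \<Rightarrow> (real^'n) set set" where
  "cluster_complex \<Phi> \<alpha> =
     {X. X \<subseteq> almost_positive_roots \<Phi> \<alpha> \<and> (\<forall>\<beta>\<in>X. \<forall>\<gamma>\<in>X. \<beta> \<noteq> \<gamma> \<longrightarrow> compatible \<Phi> \<alpha> \<beta> \<gamma>)}"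

text \<open>
  A realization is a polytope whose nonempty faces, ordered by reverse inclusion, form the face poset
  of the cluster complex (the empty simplex corresponding to the whole polytope).
\<close>

definition realizes_generalized_associahedron ::
    "(real^'m) set \<Rightarrow> ('m::finite \<Rightarrow> real^'m) \<Rightarrow> 'a::euclidean_space set \<Rightarrow> bool" where
  "realizes_generalized_associahedron \<Phi> \<alpha> S \<longleftrightarrow> polytope S \<and>
     (\<exists>f. bij_betw f (cluster_complex \<Phi> \<alpha>) {F. F face_of S \<and> F \<noteq> {}} \<and>
        (\<forall>X\<in>cluster_complex \<Phi> \<alpha>. \<forall>Y\<in>cluster_complex \<Phi> \<alpha>. X \<subseteq> Y \<longleftrightarrow> f Y \<subseteq> f X))"


section \<open>Weighted quivers, mutation and g-vectors\<close>

text \<open>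
  A weighted quiver is given by its exchange matrix, with the convention of Derksen, Weyman and
  Zelevinsky: \<^term>\<open>B $ j $ i > 0\<close> iff there is an arrow \<open>i \<rightarrow> j\<close>.
\<close>

definition arrows :: "real^'n^'n \<Rightarrow> ('n \<times> 'n) set" where
  "arrows B = {(i, j). B $ j $ i > 0}"

text \<open>
  An acyclic quiver whose type is the given root system: its Cartan counterpart is the Cartan matrix, so it
  is an orientation of the Dynkin (or Coxeter) diagram.
\<close>

definition acyclic_quiver_of_type :: "('n \<Rightarrow> real^'n) \<Rightarrow> real^'n^'n \<Rightarrow> bool" where
  "acyclic_quiver_of_type \<alpha> B \<longleftrightarrow>
     (\<forall>i. B $ i $ i = 0) \<and>
     (\<forall>i j. i \<noteq> j \<longrightarrow> \<bar>B $ i $ j\<bar> = - cartan \<alpha> i j) \<and>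
     (\<forall>i j. B $ i $ j > 0 \<longleftrightarrow> B $ j $ i < 0) \<and>
     acyclic (arrows B)"

abbreviation pos_part :: "real \<Rightarrow> real" where
  "pos_part x \<equiv> max x 0"

definition mutate :: "'n \<Rightarrow> real^'n^'n \<Rightarrow> real^'n^'n" where
  "mutate k B = (\<chi> i j. if i = k \<or> j = k then - B $ i $ j
     else B $ i $ j + pos_part (B $ i $ k) * pos_part (B $ k $ j)
                    - pos_part (- B $ i $ k) * pos_part (- B $ k $ j))"

text \<open>Mutation of the coefficient part \<open>C\<close> of the extended exchange matrix with top part \<open>B\<close>.\<close>

definition mutate_coeff :: "'n \<Rightarrow> real^'n^'n \<Rightarrow> real^'n^'n \<Rightarrow> real^'n^'n" where
  "mutate_coeff k B C = (\<chi> i j. if j = k then - C $ i $ j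
     else C $ i $ j + pos_part (C $ i $ k) * pos_part (B $ k $ j)
                    - pos_part (- C $ i $ k) * pos_part (- B $ k $ j))"

text \<open>Exchange matrix and C-matrix of the seeds mutation equivalent to the principal framing of \<open>B\<close>.\<close>

inductive_set seeds :: "real^'n^'n \<Rightarrow> ((real^'n^'n) \<times> (real^'n^'n)) set"
  for B :: "real^'n^'n" where
  initial: "(B, mat 1) \<in> seeds B"
| mutation: "(X, C) \<in> seeds B \<Longrightarrow> (mutate k X, mutate_coeff k X C) \<in> seeds B"

definition skew_symmetrizer :: "real^'n^'n \<Rightarrow> ('n \<Rightarrow> real) \<Rightarrow> bool" where
  "skew_symmetrizer B d \<longleftrightarrow> (\<forall>i. 0 < d i) \<and> (\<forall>i j. d i * B $ i $ j = - (d j * B $ j $ i))"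

definition diag_matrix :: "('n \<Rightarrow> real) \<Rightarrow> real^'n^'n" where
  "diag_matrix d = (\<chi> i j. if i = j then d i else 0)"

text \<open>
  G-matrices by tropical duality (Nakanishi and Zelevinsky): \<open>G\<^sup>T D C = D\<close> for every seed, where \<open>D\<close> is
  the skew-symmetrizer of the initial exchange matrix. Columns of \<open>G\<close> are the g-vectors of the seed, in the basis of the initial
  g-vectors. For integer \<open>B\<close> these are the g-vectors of the cluster algebra of \<open>B\<close>.
\<close>

definition g_matrices :: "real^'n^'n \<Rightarrow> (real^'n^'n) set" where
  "g_matrices B = {G. \<exists>d X C. skew_symmetrizer B d \<and> (X, C) \<in> seeds B \<and>
     transpose G ** diag_matrix d ** C = diag_matrix d}"

definition g_vector_fan :: "real^'n^'n \<Rightarrow> (real^'n) set set" where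
  "g_vector_fan B = {convex_cone hull ((\<lambda>i. column i G) ` J) | G J. G \<in> g_matrices B}"


section \<open>Weighted unfoldings\<close>

text \<open>
  The defining conditions on the rescaled matrix \<open>W B W\<^sup>-\<^sup>1\<close>, \<open>W = diag w\<close>, with blocks the fibres of
  \<open>P\<close>: in every block all column sums are equal to the corresponding entry of \<open>B'\<close>, and the entries have the
  sign of that entry. For \<open>w = 1\<close> this is Zelevinsky's definition of an unfolding.
\<close>

definition folds_to :: "('n::finite \<Rightarrow> 'm) \<Rightarrow> ('n \<Rightarrow> real) \<Rightarrow> real^'n^'n \<Rightarrow> real^'m^'m \<Rightarrow> bool" where
  "folds_to P w B B' \<longleftrightarrow>
     (\<forall>I j. (\<Sum>i | P i = I. w i * B $ i $ j / w j) = B' $ I $ P j) \<and>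
     (\<forall>i j. B' $ P i $ P j \<ge> 0 \<longrightarrow> B $ i $ j \<ge> 0)"

text \<open>
  A mutation of \<open>B'\<close> at \<open>I\<close> is accompanied by the composite mutation of \<open>B\<close> at all vertices of the
  block of \<open>I\<close>, taken in any order (they commute when \<^const>\<open>folds_to\<close> holds).
\<close>

inductive composite_mutations ::
    "('n::finite \<Rightarrow> 'm::finite) \<Rightarrow> real^'n^'n \<Rightarrow> real^'m^'m \<Rightarrow> real^'n^'n \<Rightarrow> real^'m^'m \<Rightarrow> bool"
  for P :: "'n::finite \<Rightarrow> 'm::finite" and B :: "real^'n^'n" and B' :: "real^'m^'m" where
  initial: "composite_mutations P B B' B B'"
| mutation: "composite_mutations P B B' X X' \<Longrightarrow> distinct js \<Longrightarrow> set js = {j. P j = I}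
     \<Longrightarrow> composite_mutations P B B' (fold mutate js X) (mutate I X')"

definition weighted_unfolding ::
    "('n::finite \<Rightarrow> 'm::finite) \<Rightarrow> ('n \<Rightarrow> real) \<Rightarrow> real^'n^'n \<Rightarrow> real^'m^'m \<Rightarrow> bool" where
  "weighted_unfolding P w B B' \<longleftrightarrow> surj P \<and> (\<forall>j. 0 < w j) \<and>
     (\<forall>X X'. composite_mutations P B B' X X' \<longrightarrow> folds_to P w X X')"


section \<open>The mesh-relation construction\<close>

text \<open>
  For \<open>B\<close> an orientation of a simply-laced Dynkin diagram: \<open>(1, i)\<close> stands for the shifted
  projective at \<open>i\<close> (the almost positive root \<open>-\<alpha>\<^sub>i\<close>) and \<open>(k, i)\<close> with \<open>k \<ge> 2\<close> for the indecomposable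
  representation \<open>\<tau>\<^sup>-\<^sup>(\<^sup>k\<^sup>-\<^sup>2\<^sup>) P\<^sub>i\<close>. Representations enter through their dimension vectors, i.e. positive roots
  in the basis of simple roots.
\<close>

definition euler_matrix :: "real^'n^'n \<Rightarrow> real^'n^'n" where
  "euler_matrix B = (\<chi> i j. (if i = j then 1 else 0) - (if (i, j) \<in> arrows B then 1 else 0))"

text \<open>
  Inverse Coxeter transformation \<open>- E\<^sup>-\<^sup>T E\<close>, \<open>E\<close> the Euler matrix. It maps the dimension vector of a
  non-injective indecomposable \<open>M\<close> to that of \<open>\<tau>\<^sup>-\<^sup>1 M\<close>, and that of an injective one to a negative vector.
\<close>

definition coxeter_inv :: "real^'n^'n \<Rightarrow> real^'n \<Rightarrow> real^'n" where
  "coxeter_inv B v = - (matrix_inv (transpose (euler_matrix B)) *v (euler_matrix B *v v))"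

text \<open>Its \<open>j\<close>-th entry is the number of paths from \<open>i\<close> to \<open>j\<close>, which is at most 1 in a tree.\<close>

definition dim_projective :: "real^'n^'n \<Rightarrow> 'n \<Rightarrow> real^'n" where
  "dim_projective B i = (\<chi> j. if (i, j) \<in> (arrows B)\<^sup>* then 1 else 0)"

definition ar_objects :: "real^'n^'n \<Rightarrow> (nat \<times> 'n) set" where
  "ar_objects B = {(k, i). k \<ge> 1 \<and>
     (\<forall>l. l + 2 \<le> k \<longrightarrow> (\<forall>j. 0 \<le> (coxeter_inv B ^^ l) (dim_projective B i) $ j))}"

text \<open>
  Points of the coordinate space indexed by the objects are functions vanishing at all other indices. The
  middle term of the Auslander-Reiten sequence ending in \<open>(k + 1, i)\<close> has the summands \<open>(k + 1, j)\<close> for \<open>i \<rightarrow> j\<close> and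
  \<open>(k, j)\<close> for \<open>j \<rightarrow> i\<close>: the Auslander-Reiten quiver has the shape of a part of the translation quiver \<open>\<int>Q\<close>.
\<close>

definition mesh_space :: "real^'n^'n \<Rightarrow> (nat \<Rightarrow> 'n \<Rightarrow> real) \<Rightarrow> (nat \<Rightarrow> 'n::finite \<Rightarrow> real) set" where
  "mesh_space B c = {t.
     (\<forall>k i. (k, i) \<notin> ar_objects B \<longrightarrow> t k i = 0) \<and>
     (\<forall>k i. k \<ge> 1 \<and> (k + 1, i) \<in> ar_objects B \<longrightarrow>
        t k i + t (k + 1) i =
          (\<Sum>j | (i, j) \<in> arrows B. t (k + 1) j) + (\<Sum>j | (j, i) \<in> arrows B. t k j) + c (k + 1) i)}"

text \<open>The identification of the affine space \<^const>\<open>mesh_space\<close> with \<^typ>\<open>real^'n\<close>.\<close>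

definition initial_coords :: "(nat \<Rightarrow> 'n::finite \<Rightarrow> real) \<Rightarrow> real^'n" where
  "initial_coords t = (\<chi> i. t 1 i)"

definition associahedron :: "real^'n^'n \<Rightarrow> (nat \<Rightarrow> 'n \<Rightarrow> real) \<Rightarrow> (real^'n::finite) set" where
  "associahedron B c = initial_coords ` {t \<in> mesh_space B c. \<forall>k i. 0 \<le> t k i}"

definition folding_space ::
    "('n::finite \<Rightarrow> 'm) \<Rightarrow> ('n \<Rightarrow> real) \<Rightarrow> real^'n^'n \<Rightarrow> (nat \<Rightarrow> 'n \<Rightarrow> real) \<Rightarrow> (real^'n) set" where
  "folding_space P w B c = initial_coords ` {t \<in> mesh_space B c.
     \<forall>k i j. P i = P j \<and> (k, i) \<in> ar_objects B \<and> (k, j) \<in> ar_objects B \<longrightarrow> w j * t k i = w i * t k j}"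


section \<open>Normal fans\<close>

text \<open>Inner normals, inside a linear subspace \<open>V\<close> with the induced inner product.\<close>

definition normal_cone :: "'a::euclidean_space set \<Rightarrow> 'a set \<Rightarrow> 'a set \<Rightarrow> 'a set" where
  "normal_cone V S F = {v \<in> V. \<forall>x\<in>F. \<forall>y\<in>S. v \<bullet> x \<le> v \<bullet> y}"

definition normal_fan :: "'a::euclidean_space set \<Rightarrow> 'a set \<Rightarrow> 'a set set" where
  "normal_fan V S = {normal_cone V S F | F. F face_of S \<and> F \<noteq> {}}"

text \<open>
  The initial g-vectors of the folded quiver as vectors of the subspace where \<open>w j * x $ i = w i * x $ j\<close>
  within blocks: the orthogonal projection of the \<open>j\<close>-th standard basis vector (the normal of the facet
  \<open>t\<^sub>1\<^sub>j = 0\<close>) is \<open>w j *\<^sub>R initial_g_vector P w (P j)\<close>.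
\<close>

definition initial_g_vector :: "('n::finite \<Rightarrow> 'm) \<Rightarrow> ('n \<Rightarrow> real) \<Rightarrow> 'm \<Rightarrow> real^'n" where
  "initial_g_vector P w I =
     (1 / (\<Sum>j | P j = I. (w j)\<^sup>2)) *\<^sub>R (\<Sum>j | P j = I. w j *\<^sub>R axis j 1)"

definition from_g_coords :: "('n::finite \<Rightarrow> 'm) \<Rightarrow> ('n \<Rightarrow> real) \<Rightarrow> real^'m \<Rightarrow> real^'n" where
  "from_g_coords P w g = (\<Sum>I\<in>UNIV. g $ I *\<^sub>R initial_g_vector P w I)"

end

theory Submission
  imports Defs
begin

text \<open>
  A finite Coxeter diagram is a forest, so the orientation \<open>B'\<close> is given by a height function, and its
  vertices sorted by height form a word \<open>q\<close> for a Coxeter element \<open>c\<close>. Letting \<open>c\<close> act on the roots of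
  the projectives makes the objects \<open>\<tau>\<^sup>-\<^sup>k P\<^sub>i\<close> a set of positions in the periodic word
  \<open>q q q \<dots>\<close>, for crystallographic and non-crystallographic root systems alike. The facets of the resulting
  subword complex are the clusters. Each of them carries a basis of roots (its C-matrix) and the dual basis of
  g-vectors \<open>c\<^sup>k \<omega>\<^sub>i\<close> (its G-matrix), and a flip of facets is a mutation of seeds. The vertex
  attached to a facet by the brick polytope construction satisfies all mesh inequalities, with equality exactly at
  the positions of the facet; as the cones of g-vectors cover the space, this determines all faces and normal cones.

  Finally, folding dimension vectors with the weights \<open>w\<close> intertwines the inverse Coxeter transformation of
  \<open>B\<close> with \<open>c\<close>, so the objects of \<open>B\<close> are those of \<open>B'\<close>, one copy for every vertex in a
  block, and the points of \<open>\<Pi>\<close> are those of the form \<open>t\<^sub>k\<^sub>j = w\<^sub>j s\<^sub>k\<^sub>P\<^sub>j\<close> with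
  \<open>s\<close> satisfying the mesh relations of \<open>B'\<close>.
\<close>

text \<open>Non-crystallographic types have no representations, so homological facts become facts on
  real vectors: \<open>euler\<close> replaces Hom minus Ext, its isometry \<open>cox\<close> the
  inverse translation, and \<open>raise\<close> a reflection functor. Most of the translation goes
  through \<open>euler_cox_diff\<close>. Lengths of group elements are avoided too: the sign of a
  single root is followed along a word, and counting does the rest.

  That the cones cover comes from a minimum, not from topology. A flip moves the brick vertex by a
  positive multiple of the exchanged root, so a functional minimal at the vertex of F among the
  finitely many facets is nonnegative on the roots of F and lies in the cone of the dual g-vectors.
  Applied to a g-vector, with \<open>compat_cone\<close> to see that all minimal facets contain it,
  this also gives the mesh inequalities and their cases of equality.

  The relation \<open>compatible\<close> is defined by bipartite rotations, with any colouring at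
  each step, while the facets belong to one given orientation; sink reflections
  (\<open>exists_bipartite\<close>) and \<open>cmp_colour\<close> connect the two.\<close>

locale root_basis =
  fixes \<Phi> :: "(real^'n::finite) set" and \<alpha> :: "'n \<Rightarrow> real^'n"
  assumes root_system: "root_system \<Phi>" and simple_system: "simple_system \<Phi> \<alpha>"
begin

text \<open>Half the squared length is the value of the Euler form at a simple root and the standard
  skew-symmetrizer (\<open>symmetrizer_hsq\<close>). Dividing a simple root by it gives the
  coroot.\<close>

definition hsq :: "'n \<Rightarrow> real" where
  "hsq i = (\<alpha> i \<bullet> \<alpha> i) / 2"

text \<open>Fundamental weights, dual to the simple coroots; \<open>weight_simple\<close> shows that
  the choice exists. Consequently \<open>weight i \<bullet> x / hsq i\<close> is the coefficient of
  \<open>\<alpha> i\<close> in \<open>x\<close>.\<close>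

definition weight :: "'n \<Rightarrow> real^'n" where
  "weight i = (SOME x. \<forall>j. x \<bullet> \<alpha> j = (if i = j then hsq i else 0))"

definition srefl :: "'n \<Rightarrow> real^'n \<Rightarrow> real^'n" where
  "srefl i x = x - ((x \<bullet> \<alpha> i) / hsq i) *\<^sub>R \<alpha> i"

definition pos :: "(real^'n) set" where
  "pos = {\<gamma> \<in> \<Phi>. \<forall>i. 0 \<le> weight i \<bullet> \<gamma>}"

text \<open>Negated Cartan entry: off the diagonal the nonnegative weight of an edge, which is the
  absolute value of an exchange matrix entry, and -2 on the diagonal.\<close>

definition cf :: "'n \<Rightarrow> 'n \<Rightarrow> real" where
  "cf j i = - (\<alpha> j \<bullet> \<alpha> i) / hsq j"

section \<open>Expansions in roots and weights, simple reflections, positive roots\<close>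

lemma finite_roots: "finite \<Phi>" and zero_not_root: "0 \<notin> \<Phi>"
  and reflection_roots: "a \<in> \<Phi> \<Longrightarrow> reflection a ` \<Phi> = \<Phi>"
  and reduced: "a \<in> \<Phi> \<Longrightarrow> r *\<^sub>R a \<in> \<Phi> \<Longrightarrow> r = 1 \<or> r = - 1"
  using root_system unfolding root_system_def by blast+

lemma inj_simple: "inj \<alpha>" and simple_root: "\<alpha> i \<in> \<Phi>" and indep: "independent (range \<alpha>)"
  using simple_system unfolding simple_system_def by blast+

lemma simple_eq_iff [simp]: "\<alpha> i = \<alpha> j \<longleftrightarrow> i = j"
  using inj_simple by (auto simp: inj_def)

lemma simple_nonzero: "\<alpha> i \<noteq> 0"
  using simple_root zero_not_root by metis

lemma hsq_pos: "0 < hsq i"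
  unfolding hsq_def using simple_nonzero by simp

lemma hsq_nonzero [simp]: "hsq i \<noteq> 0"
  using hsq_pos[of i] by simp

lemma simple_self: "\<alpha> i \<bullet> \<alpha> i = 2 * hsq i"
  by (simp add: hsq_def)

lemma weight_simple: "weight i \<bullet> \<alpha> j = (if i = j then hsq i else 0)"
proof -
  obtain g :: "real^'n \<Rightarrow> real"
    where g: "linear g" "\<forall>x\<in>range \<alpha>. g x = (if x = \<alpha> i then hsq i else 0)"
    using linear_independent_extend[OF indep, of "\<lambda>x. if x = \<alpha> i then hsq i else 0"] by metis
  \<comment> \<open>\<open>adjoint g 1\<close> is the vector that represents the functional
    \<open>g\<close>.\<close>
  have "adjoint g 1 \<bullet> \<alpha> j = (if i = j then hsq i else 0)" for j
  proof -
    have "adjoint g 1 \<bullet> \<alpha> j = g (\<alpha> j)"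
      using adjoint_works[OF g(1), of "\<alpha> j" 1] by (simp add: inner_commute)
    then show ?thesis using g(2) by simp
  qed
  then have "\<exists>x. \<forall>j. x \<bullet> \<alpha> j = (if i = j then hsq i else 0)" by blast
  from someI_ex[OF this, folded weight_def] show ?thesis by (rule spec)
qed

lemma simple_weight: "\<alpha> j \<bullet> weight i = (if i = j then hsq i else 0)"
  by (metis inner_commute weight_simple)

lemma span_simple: "span (range \<alpha>) = UNIV"
proof -
  have "\<Phi> \<subseteq> span (range \<alpha>)"
  proof
    fix b assume "b \<in> \<Phi>"
    then obtain x where "b = (\<Sum>i\<in>UNIV. x i *\<^sub>R \<alpha> i)"
      using simple_system unfolding simple_system_def by blast
    then show "b \<in> span (range \<alpha>)"
      by (simp add: span_sum span_mul span_base)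
  qed
  then have "span \<Phi> \<subseteq> span (range \<alpha>)" by (simp add: span_minimal)
  then show ?thesis using root_system unfolding root_system_def by auto
qed

lemma eq_0_simple: assumes "\<And>i. \<alpha> i \<bullet> x = 0" shows "x = 0"
proof -
  have "orthogonal x x"
    by (rule orthogonal_to_span[of x "range \<alpha>"])
       (use assms span_simple in \<open>auto simp: orthogonal_def inner_commute\<close>)
  then show ?thesis by (simp add: orthogonal_self)
qed

lemma weight_expand: "x = (\<Sum>i\<in>UNIV. ((\<alpha> i \<bullet> x) / hsq i) *\<^sub>R weight i)"
proof -
  have "x - (\<Sum>i\<in>UNIV. ((\<alpha> i \<bullet> x) / hsq i) *\<^sub>R weight i) = 0"
    by (rule eq_0_simple) (simp add: inner_diff_right inner_sum_right simple_weight if_distrib cong: if_cong)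
  then show ?thesis by simp
qed

lemma eq_0_weight: assumes "\<And>i. weight i \<bullet> x = 0" shows "x = 0"
proof -
  have "x \<bullet> x = (\<Sum>i\<in>UNIV. ((\<alpha> i \<bullet> x) / hsq i) *\<^sub>R weight i) \<bullet> x"
    using weight_expand[of x] by simp
  also have "\<dots> = 0" by (simp add: inner_sum_left assms)
  finally show ?thesis by simp
qed

lemma eq_weight: assumes "\<And>i. weight i \<bullet> x = weight i \<bullet> y" shows "x = y"
  using eq_0_weight[of "x - y"] assms by (simp add: inner_diff_right)

lemma simple_expand: "x = (\<Sum>i\<in>UNIV. ((weight i \<bullet> x) / hsq i) *\<^sub>R \<alpha> i)"
  by (rule eq_weight) (simp add: inner_sum_right weight_simple if_distrib cong: if_cong)

lemma inner_expand: "x \<bullet> y = (\<Sum>i\<in>UNIV. (\<alpha> i \<bullet> x) * (weight i \<bullet> y) / hsq i)"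
  by (subst weight_expand[of x]) (simp add: inner_sum_left)

lemma linear_eq_weight:
  assumes "linear f" "linear g" "\<And>i. f (weight i) = g (weight i)"
  shows "f x = g x"
  by (subst (1 2) weight_expand[of x])
     (simp add: linear_sum[OF assms(1)] linear_sum[OF assms(2)] linear_scale[OF assms(1)] linear_scale[OF assms(2)] assms(3))

lemma refl_reflection: "srefl i x = reflection (\<alpha> i) x"
  by (simp add: srefl_def reflection_def hsq_def)

lemma linear_refl: "linear (srefl i)"
  by (rule linearI) (simp_all add: srefl_def inner_add_left add_divide_distrib scaleR_left_distrib algebra_simps)

lemma refl_refl [simp]: "srefl i (srefl i x) = x"
proof -
  have "srefl i x \<bullet> \<alpha> i = - (x \<bullet> \<alpha> i)" by (simp add: srefl_def inner_diff_left simple_self)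
  then show ?thesis by (simp add: srefl_def[of i "srefl i x"]) (simp add: srefl_def)
qed

lemma refl_adjoint: "srefl i x \<bullet> y = x \<bullet> srefl i y"
  by (simp add: srefl_def inner_diff_left inner_diff_right inner_commute)

lemma refl_inner [simp]: "srefl i x \<bullet> srefl i y = x \<bullet> y"
  by (simp add: refl_adjoint)

lemma refl_simple_self [simp]: "srefl i (\<alpha> i) = - \<alpha> i"
  by (simp add: srefl_def simple_self scaleR_2)

lemma refl_simple: "srefl i (\<alpha> j) = \<alpha> j + cf i j *\<^sub>R \<alpha> i"
  by (simp add: srefl_def cf_def inner_commute)

lemma refl_minus [simp]: "srefl i (- x) = - srefl i x"
  using linear_neg[OF linear_refl] .

lemma refl_root_iff [simp]: "srefl i \<gamma> \<in> \<Phi> \<longleftrightarrow> \<gamma> \<in> \<Phi>"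
proof -
  have "srefl i ` \<Phi> = \<Phi>"
    using reflection_roots[OF simple_root, of i] by (simp add: refl_reflection image_def)
  then show ?thesis by (metis imageI refl_refl)
qed

lemma refl_weight: "srefl i (weight j) = (if i = j then weight i - \<alpha> i else weight j)"
  by (simp add: srefl_def weight_simple)

lemma weight_refl: "i \<noteq> j \<Longrightarrow> weight j \<bullet> srefl i x = weight j \<bullet> x"
  by (metis refl_adjoint refl_weight)

lemma weight_refl_self: "weight i \<bullet> srefl i x = weight i \<bullet> x - \<alpha> i \<bullet> x"
proof -
  have "weight i \<bullet> srefl i x = (weight i - \<alpha> i) \<bullet> x"
    by (metis refl_adjoint refl_weight)
  then show ?thesis by (simp add: inner_diff_left)
qed

lemma cf_self: "cf i i = - 2" by (simp add: cf_def simple_self)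

lemma simple_weight_sum: "\<alpha> i = (\<Sum>j\<in>UNIV. - cf j i *\<^sub>R weight j)"
  by (subst weight_expand[of "\<alpha> i"]) (simp add: cf_def)

lemma refl_weight_self: "weight i - \<alpha> i = (\<Sum>j\<in>-{i}. cf j i *\<^sub>R weight j) - weight i"
proof -
  have "\<alpha> i = - cf i i *\<^sub>R weight i + (\<Sum>j\<in>-{i}. - cf j i *\<^sub>R weight j)"
    by (subst simple_weight_sum) (simp add: sum.remove[of UNIV i] Compl_eq_Diff_UNIV)
  then show ?thesis by (simp add: cf_self sum_negf scaleR_2)
qed

lemma pos_root: "\<gamma> \<in> pos \<Longrightarrow> \<gamma> \<in> \<Phi>" by (simp add: pos_def)

lemma pos_weight: "\<gamma> \<in> pos \<Longrightarrow> 0 \<le> weight i \<bullet> \<gamma>" by (simp add: pos_def)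

lemma pos_nonzero: "\<gamma> \<in> pos \<Longrightarrow> \<gamma> \<noteq> 0" using pos_root zero_not_root by metis

lemma finite_pos: "finite pos" using finite_roots by (simp add: pos_def)

lemma neg_root_iff [simp]: "- \<gamma> \<in> \<Phi> \<longleftrightarrow> \<gamma> \<in> \<Phi>"
proof -
  have "- \<gamma> \<in> \<Phi>" if "\<gamma> \<in> \<Phi>" for \<gamma>
  proof -
    have "reflection \<gamma> \<gamma> = - \<gamma>"
      using that zero_not_root by (auto simp: reflection_def scaleR_2)
    then show ?thesis using reflection_roots[OF that] that by (metis imageI)
  qed
  then show ?thesis by (metis minus_minus)
qed

lemma pos_or_neg: assumes "\<gamma> \<in> \<Phi>" shows "\<gamma> \<in> pos \<or> - \<gamma> \<in> pos"
proof -
  obtain x where x: "\<gamma> = (\<Sum>i\<in>UNIV. x i *\<^sub>R \<alpha> i)" "(\<forall>i. 0 \<le> x i) \<or> (\<forall>i. x i \<le> 0)"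
    using simple_system assms unfolding simple_system_def by blast
  have "weight i \<bullet> \<gamma> = x i * hsq i" for i
    by (simp add: x(1) inner_sum_right weight_simple if_distrib cong: if_cong)
  then show ?thesis using x(2) assms hsq_pos
    by (auto simp: pos_def mult_nonpos_nonneg less_imp_le)
qed

lemma pos_not_neg: "\<gamma> \<in> pos \<Longrightarrow> - \<gamma> \<notin> pos"
proof
  assume "\<gamma> \<in> pos" "- \<gamma> \<in> pos"
  then have "weight i \<bullet> \<gamma> = 0" for i
    using pos_weight[of \<gamma> i] pos_weight[of "- \<gamma>" i] by simp
  then show False using eq_0_weight pos_nonzero \<open>\<gamma> \<in> pos\<close> by metis
qed

lemma not_pos_iff: "\<gamma> \<in> \<Phi> \<Longrightarrow> \<gamma> \<notin> pos \<longleftrightarrow> - \<gamma> \<in> pos"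
  using pos_or_neg pos_not_neg by blast

lemma pos_if_weight_pos: "\<gamma> \<in> \<Phi> \<Longrightarrow> 0 < weight i \<bullet> \<gamma> \<Longrightarrow> \<gamma> \<in> pos"
  using pos_or_neg[of \<gamma>] pos_weight[of "- \<gamma>" i] by auto

lemma simple_pos: "\<alpha> i \<in> pos"
  using hsq_pos[of i] by (auto intro!: pos_if_weight_pos[of _ i] simp: simple_root weight_simple)

lemma pos_obtain_weight: assumes "\<gamma> \<in> pos" obtains i where "0 < weight i \<bullet> \<gamma>"
  using assms eq_0_weight pos_nonzero pos_weight by (metis less_eq_real_def)

text \<open>The reflection changes only the coefficient of \<open>\<alpha> i\<close>. If the result
  were negative, all other coefficients of \<open>\<gamma>\<close> would vanish, and reducedness
  would leave only \<open>\<gamma> = \<alpha> i\<close>.\<close>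

lemma refl_pos: assumes "\<gamma> \<in> pos" "\<gamma> \<noteq> \<alpha> i" shows "srefl i \<gamma> \<in> pos"
proof (rule ccontr)
  assume "srefl i \<gamma> \<notin> pos"
  then have n: "- srefl i \<gamma> \<in> pos"
    using pos_or_neg[of "srefl i \<gamma>"] assms(1) by (auto simp: pos_root)
  have z: "weight j \<bullet> \<gamma> = 0" if "j \<noteq> i" for j
    using pos_weight[OF n, of j] pos_weight[OF assms(1), of j] weight_refl[of i j \<gamma>] that by auto
  have "\<gamma> = (\<Sum>j\<in>UNIV. ((weight j \<bullet> \<gamma>) / hsq j) *\<^sub>R \<alpha> j)" by (rule simple_expand)
  also have "\<dots> = (\<Sum>j\<in>{i}. ((weight j \<bullet> \<gamma>) / hsq j) *\<^sub>R \<alpha> j)"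
    by (rule sum.mono_neutral_right) (auto simp: z)
  finally have g: "\<gamma> = ((weight i \<bullet> \<gamma>) / hsq i) *\<^sub>R \<alpha> i" by simp
  then have "(weight i \<bullet> \<gamma>) / hsq i = 1 \<or> (weight i \<bullet> \<gamma>) / hsq i = - 1"
    using reduced[OF simple_root, of "(weight i \<bullet> \<gamma>) / hsq i" i] pos_root[OF assms(1)] by simp
  moreover have "(weight i \<bullet> \<gamma>) / hsq i \<ge> 0"
    using pos_weight[OF assms(1)] hsq_pos[of i] by (simp add: less_imp_le)
  ultimately have "(weight i \<bullet> \<gamma>) / hsq i = 1" by linarith
  then have "\<gamma> = \<alpha> i" using g by (metis scaleR_one)
  then show False using assms(2) by simp
qed

section \<open>Angles between simple roots and the forest property\<close>

lemma simple_inner_le: assumes "i \<noteq> j" shows "\<alpha> i \<bullet> \<alpha> j \<le> 0"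
proof -
  have "srefl i (\<alpha> j) \<in> pos" using assms by (intro refl_pos simple_pos) auto
  from pos_weight[OF this, of i] show ?thesis using assms by (simp add: weight_refl_self weight_simple)
qed

lemma cf_nonneg: "i \<noteq> j \<Longrightarrow> 0 \<le> cf i j"
  using simple_inner_le[of i j] hsq_pos[of i] by (simp add: cf_def divide_nonpos_pos)

lemma cf_pos_iff: "i \<noteq> j \<Longrightarrow> 0 < cf i j \<longleftrightarrow> \<alpha> i \<bullet> \<alpha> j \<noteq> 0"
  using simple_inner_le[of i j] hsq_pos[of i] by (auto simp: cf_def divide_less_0_iff zero_less_divide_iff)

lemma cf_eq_0_iff: "cf i j = 0 \<longleftrightarrow> \<alpha> i \<bullet> \<alpha> j = 0"
  by (simp add: cf_def)

text \<open>An edge has label at least 3. The root \<open>?g\<close> has a positive coefficient at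
  \<open>\<alpha> i\<close>, so its coefficient at \<open>\<alpha> j\<close> is nonnegative, which
  says \<open>cf i j * cf j i \<ge> 1\<close>.\<close>

lemma simple_inner_sq: assumes "i \<noteq> j" "\<alpha> i \<bullet> \<alpha> j \<noteq> 0" shows "hsq i * hsq j \<le> (\<alpha> i \<bullet> \<alpha> j)\<^sup>2"
proof -
  let ?g = "srefl j (srefl i (\<alpha> j))"
  have g: "?g = (cf i j * cf j i - 1) *\<^sub>R \<alpha> j + cf i j *\<^sub>R \<alpha> i"
    unfolding refl_simple[of i j]
    by (simp add: linear_add[OF linear_refl] linear_scale[OF linear_refl] refl_simple scaleR_right_distrib scaleR_left_diff_distrib)
  have "?g \<in> \<Phi>" by (simp add: simple_root)
  moreover have "0 < weight i \<bullet> ?g"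
    using assms cf_pos_iff[of i j] hsq_pos[of i] by (simp add: g inner_add_right weight_simple)
  ultimately have "?g \<in> pos" by (rule pos_if_weight_pos)
  from pos_weight[OF this, of j] have "0 \<le> (cf i j * cf j i - 1) * hsq j"
    using assms(1) by (simp add: g inner_add_right weight_simple)
  then have "1 \<le> cf i j * cf j i" using hsq_pos[of j] by (simp add: zero_le_mult_iff)
  then show ?thesis using hsq_pos[of i] hsq_pos[of j]
    by (simp add: cf_def inner_commute power2_eq_square divide_simps split: if_splits)
qed

text \<open>Rescale the simple roots to squared length 2, so that neighbours have inner product at
  most -1. If every vertex of \<open>K\<close> had two neighbours in \<open>K\<close>, all row sums
  of the Gram matrix would be at most 2 - 1 - 1 = 0, and the sum of the rescaled roots would be
  zero, against independence.\<close>

lemma exists_leaf: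
  assumes "K \<noteq> ({} :: 'n set)"
  shows "\<exists>i\<in>K. \<exists>k. \<forall>j\<in>K. j \<noteq> i \<and> \<alpha> i \<bullet> \<alpha> j \<noteq> 0 \<longrightarrow> j = k"
proof (rule ccontr)
  assume no: "\<not> ?thesis"
  define b where "b i = (1 / sqrt (hsq i)) *\<^sub>R \<alpha> i" for i
  define x where "x = (\<Sum>i\<in>K. b i)"
  have bb: "b i \<bullet> b i = 2" for i
    using hsq_pos[of i] by (simp add: b_def simple_self real_sqrt_mult_self divide_simps)
  have le0: "b i \<bullet> b j \<le> 0" if "i \<noteq> j" for i j
    using simple_inner_le[OF that] hsq_pos[of i] hsq_pos[of j] by (simp add: b_def divide_nonpos_pos)
  have le1: "b i \<bullet> b j \<le> - 1" if "i \<noteq> j" "\<alpha> i \<bullet> \<alpha> j \<noteq> 0" for i j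
  proof -
    have p: "0 < sqrt (hsq i) * sqrt (hsq j)" using hsq_pos[of i] hsq_pos[of j] by simp
    have "sqrt (hsq i * hsq j) \<le> sqrt ((\<alpha> i \<bullet> \<alpha> j)\<^sup>2)"
      using simple_inner_sq[OF that] by (rule real_sqrt_le_mono)
    then have "sqrt (hsq i) * sqrt (hsq j) \<le> - (\<alpha> i \<bullet> \<alpha> j)"
      using simple_inner_le[OF that(1)] by (simp add: real_sqrt_mult)
    then show ?thesis using p by (simp add: b_def divide_le_eq mult.commute)
  qed
  have row: "(\<Sum>j\<in>K. b i \<bullet> b j) \<le> 0" if "i \<in> K" for i
  proof -
    from no that obtain k1 where k1: "k1 \<in> K" "k1 \<noteq> i" "\<alpha> i \<bullet> \<alpha> k1 \<noteq> 0" by blast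
    from no that obtain k2 where k2: "k2 \<in> K" "k2 \<noteq> i" "\<alpha> i \<bullet> \<alpha> k2 \<noteq> 0" "k2 \<noteq> k1" by blast
    have "(\<Sum>j\<in>K. b i \<bullet> b j) = (\<Sum>j\<in>{i,k1,k2}. b i \<bullet> b j) + (\<Sum>j\<in>K-{i,k1,k2}. b i \<bullet> b j)"
      by (rule sum.subset_diff[THEN trans[OF _ add.commute]]) (use that k1 k2 in auto)
    also have "(\<Sum>j\<in>{i,k1,k2}. b i \<bullet> b j) \<le> 0"
      using k1 k2 le1[of i k1] le1[of i k2] bb[of i] by simp
    also have "(\<Sum>j\<in>K-{i,k1,k2}. b i \<bullet> b j) \<le> 0" by (intro sum_nonpos le0) auto
    finally show ?thesis by simp
  qed
  have "x \<bullet> x = (\<Sum>i\<in>K. \<Sum>j\<in>K. b i \<bullet> b j)" by (simp add: x_def inner_sum_left inner_sum_right) (rule sum.swap)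
  also have "\<dots> \<le> 0" by (intro sum_nonpos row)
  finally have "x = 0" by (metis inner_eq_zero_iff inner_ge_zero order_antisym)
  obtain i where i: "i \<in> K" using assms by blast
  have "weight i \<bullet> x = hsq i / sqrt (hsq i)"
    using i by (simp add: x_def b_def inner_sum_right weight_simple if_distrib sum.delta' cong: if_cong)
  then show False using \<open>x = 0\<close> hsq_pos[of i] by simp
qed

text \<open>
  The Coxeter diagram is a forest, so an orientation of it is the same as a height function:
  arrows go down by one.
\<close>

definition height :: "('n \<Rightarrow> nat) \<Rightarrow> bool" where
  "height \<eta> \<longleftrightarrow> (\<forall>i j. i \<noteq> j \<and> \<alpha> i \<bullet> \<alpha> j \<noteq> 0 \<longrightarrow> \<eta> i = Suc (\<eta> j) \<or> \<eta> j = Suc (\<eta> i))"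

text \<open>Leaves are removed one by one; the value at a leaf is dictated by its only neighbour.
  Integers are used first because values may have to decrease, and a shift by the minimum makes them
  natural numbers.\<close>

lemma exists_height:
  assumes arr: "\<And>i j. i \<noteq> j \<Longrightarrow> \<alpha> i \<bullet> \<alpha> j \<noteq> 0 \<Longrightarrow> arr i j \<longleftrightarrow> \<not> arr j i"
  obtains \<eta> where "height \<eta>" "\<And>i j. i \<noteq> j \<Longrightarrow> \<alpha> i \<bullet> \<alpha> j \<noteq> 0 \<Longrightarrow> arr i j \<longleftrightarrow> \<eta> j < \<eta> i"
proof -
  have "\<exists>\<eta>::'n \<Rightarrow> int. \<forall>i\<in>K. \<forall>j\<in>K. i \<noteq> j \<and> \<alpha> i \<bullet> \<alpha> j \<noteq> 0 \<and> arr i j \<longrightarrow> \<eta> i = \<eta> j + 1" for K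
  proof (induction "card K" arbitrary: K)
    case 0
    then have "K = {}" by simp
    then show ?case by simp
  next
    case (Suc n)
    then have "K \<noteq> {}" by auto
    then obtain i k where i: "i \<in> K" and k: "\<forall>j\<in>K. j \<noteq> i \<and> \<alpha> i \<bullet> \<alpha> j \<noteq> 0 \<longrightarrow> j = k"
      using exists_leaf by blast
    have "n = card (K - {i})" using Suc.hyps(2) i by simp
    from Suc.hyps(1)[OF this] obtain \<eta> :: "'n \<Rightarrow> int" where
      \<eta>: "\<forall>a\<in>K-{i}. \<forall>b\<in>K-{i}. a \<noteq> b \<and> \<alpha> a \<bullet> \<alpha> b \<noteq> 0 \<and> arr a b \<longrightarrow> \<eta> a = \<eta> b + 1" by blast
    \<comment> \<open>For an isolated vertex \<open>k\<close> is arbitrary, which is harmless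
      because no edge constrains the value.\<close>
    let ?\<eta> = "\<eta>(i := if arr i k then \<eta> k + 1 else \<eta> k - 1)"
    have "?\<eta> a = ?\<eta> b + 1" if ab: "a \<in> K" "b \<in> K" "a \<noteq> b" "\<alpha> a \<bullet> \<alpha> b \<noteq> 0" "arr a b" for a b
    proof -
      consider "a = i" | "b = i" | "a \<noteq> i" "b \<noteq> i" by blast
      then show ?thesis
      proof cases
        case 1 then have "b = k" using k ab by auto
        then show ?thesis using 1 ab by auto
      next
        case 2 then have "a = k" using k ab by (auto simp: inner_commute)
        moreover have "\<not> arr i k" using arr[of i k] 2 ab calculation by (auto simp: inner_commute)
        ultimately show ?thesis using 2 ab by auto
      next
        case 3 then show ?thesis using \<eta> ab by auto
      qed
    qed
    then show ?case by blast
  qed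
  from this[of UNIV] obtain \<eta> :: "'n \<Rightarrow> int" where
    \<eta>: "\<And>i j. i \<noteq> j \<Longrightarrow> \<alpha> i \<bullet> \<alpha> j \<noteq> 0 \<Longrightarrow> arr i j \<Longrightarrow> \<eta> i = \<eta> j + 1" by auto
  define m where "m = Min (range \<eta>)"
  have m: "m \<le> \<eta> i" for i unfolding m_def by simp
  define h where "h i = nat (\<eta> i - m)" for i
  have h: "int (h i) = \<eta> i - m" for i using m by (simp add: h_def)
  have st: "arr i j \<Longrightarrow> h i = Suc (h j)" if "i \<noteq> j" "\<alpha> i \<bullet> \<alpha> j \<noteq> 0" for i j
    using \<eta>[OF that] h[of i] h[of j] by linarith
  show thesis
  proof
    show "height h" unfolding height_def using st arr by (metis inner_commute)
    show "arr i j \<longleftrightarrow> h j < h i" if "i \<noteq> j" "\<alpha> i \<bullet> \<alpha> j \<noteq> 0" for i j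
      using st[of i j] st[of j i] arr[of i j] that by (auto simp: inner_commute)
  qed
qed

end

context root_basis
begin

subsection \<open>Coxeter elements and Euler forms\<close>

lemma cf_nonneg_less: "\<eta> k < (\<eta> i :: nat) \<Longrightarrow> 0 \<le> cf k i" "\<eta> k < \<eta> i \<Longrightarrow> 0 \<le> cf i k"
  using cf_nonneg by (metis less_irrefl)+

lemma height_eq: "height \<eta> \<Longrightarrow> \<eta> i = \<eta> j \<Longrightarrow> i \<noteq> j \<Longrightarrow> \<alpha> i \<bullet> \<alpha> j = 0"
  unfolding height_def by (metis n_not_Suc_n)

lemma sum_Collect_if: "(\<Sum>i | P i. f i) = (\<Sum>i\<in>(UNIV :: 'n set). if P i then f i else (0 :: real))"
  using sum.inter_filter[of "UNIV :: 'n set" f P] by simp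

text \<open>
  \<open>proj \<eta> i\<close> is the root of the indecomposable projective at \<open>i\<close>. The product of the simple
  reflections, sorted by height, sends \<open>weight i\<close> to \<open>weight i - proj \<eta> i\<close>; \<open>cox\<close> is this
  Coxeter element in closed form, and \<open>euler\<close> is the Euler form of the quiver.
\<close>

function proj :: "('n \<Rightarrow> nat) \<Rightarrow> 'n \<Rightarrow> real^'n" where
  "proj \<eta> i = \<alpha> i + (\<Sum>j | \<eta> j < \<eta> i. cf j i *\<^sub>R proj \<eta> j)"
  by pat_completeness auto
termination by (relation "Wellfounded.measure (\<lambda>(\<eta>, i). \<eta> i)") auto

declare proj.simps [simp del]

definition cox :: "('n \<Rightarrow> nat) \<Rightarrow> real^'n \<Rightarrow> real^'n" where
  "cox \<eta> x = x - (\<Sum>i\<in>UNIV. ((\<alpha> i \<bullet> x) / hsq i) *\<^sub>R proj \<eta> i)"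

definition euler :: "('n \<Rightarrow> nat) \<Rightarrow> real^'n \<Rightarrow> real^'n \<Rightarrow> real" where
  "euler \<eta> x y = (\<Sum>i\<in>UNIV. (weight i \<bullet> x) * (weight i \<bullet> y) / hsq i) +
     (\<Sum>j\<in>UNIV. \<Sum>i | \<eta> i < \<eta> j. (\<alpha> i \<bullet> \<alpha> j) * (weight i \<bullet> x / hsq i) * (weight j \<bullet> y / hsq j))"

text \<open>
  Reflecting the quiver at a sink turns it into a source, which raises its height by two.
\<close>

definition sink :: "('n \<Rightarrow> nat) \<Rightarrow> 'n \<Rightarrow> bool" where
  "sink \<eta> i \<longleftrightarrow> (\<forall>j. j \<noteq> i \<and> \<alpha> i \<bullet> \<alpha> j \<noteq> 0 \<longrightarrow> \<eta> i < \<eta> j)"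

definition raise :: "'n \<Rightarrow> ('n \<Rightarrow> nat) \<Rightarrow> 'n \<Rightarrow> nat" where
  "raise i \<eta> = \<eta>(i := \<eta> i + 2)"

lemma linear_cox: "linear (cox \<eta>)"
  by (rule linearI)
     (simp_all add: cox_def inner_add_right add_divide_distrib scaleR_left_distrib sum.distrib
       scaleR_right_diff_distrib scaleR_sum_right)

lemma linear_euler1: "linear (\<lambda>x. euler \<eta> x y)"
  by (rule linearI)
     (simp_all add: euler_def inner_add_right add_divide_distrib sum.distrib sum_distrib_left algebra_simps)

lemma linear_euler2: "linear (\<lambda>y. euler \<eta> x y)"
  by (rule linearI)
     (simp_all add: euler_def inner_add_right add_divide_distrib sum.distrib sum_distrib_left algebra_simps)

lemmas euler_add = linear_add[OF linear_euler1] linear_add[OF linear_euler2]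
lemmas euler_diff = linear_diff[OF linear_euler1] linear_diff[OF linear_euler2]
lemmas euler_scale = linear_scale[OF linear_euler1] linear_scale[OF linear_euler2]
lemmas euler_neg = linear_neg[OF linear_euler1] linear_neg[OF linear_euler2]
lemmas euler_sum = linear_sum[OF linear_euler1] linear_sum[OF linear_euler2]
lemmas euler_0 = linear_0[OF linear_euler1] linear_0[OF linear_euler2]

lemma euler_simple: "euler \<eta> y (\<alpha> i) = weight i \<bullet> y - (\<Sum>j | \<eta> j < \<eta> i. cf j i * (weight j \<bullet> y))"
proof -
  have "euler \<eta> y (\<alpha> i) = weight i \<bullet> y +
     (\<Sum>j\<in>UNIV. if j = i then (\<Sum>k | \<eta> k < \<eta> j. (\<alpha> k \<bullet> \<alpha> j) * (weight k \<bullet> y / hsq k)) else 0)"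
    unfolding euler_def
    by (intro arg_cong2[where f = "(+)"] sum.cong) (auto simp: weight_simple if_distrib if_distribR cong: if_cong)
  also have "\<dots> = weight i \<bullet> y + (\<Sum>k | \<eta> k < \<eta> i. (\<alpha> k \<bullet> \<alpha> i) * (weight k \<bullet> y / hsq k))"
    by simp
  also have "\<dots> = weight i \<bullet> y - (\<Sum>j | \<eta> j < \<eta> i. cf j i * (weight j \<bullet> y))"
    by (simp add: cf_def sum_negf)
  finally show ?thesis .
qed

text \<open>Numerical form of dim Hom(P_i, M) = dim M_i. Compared with the usual Euler form the
  arguments are in reversed order: the projective stands second.\<close>

lemma euler_proj: "euler \<eta> y (proj \<eta> i) = weight i \<bullet> y"
proof (induction "\<eta> i" arbitrary: i rule: less_induct)
  case less
  have "euler \<eta> y (proj \<eta> i) = euler \<eta> y (\<alpha> i) + (\<Sum>j | \<eta> j < \<eta> i. cf j i * euler \<eta> y (proj \<eta> j))"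
    by (subst proj.simps) (simp add: euler_add euler_sum euler_scale)
  also have "(\<Sum>j | \<eta> j < \<eta> i. cf j i * euler \<eta> y (proj \<eta> j)) = (\<Sum>j | \<eta> j < \<eta> i. cf j i * (weight j \<bullet> y))"
    by (intro sum.cong) (auto simp: less)
  finally show ?case by (simp add: euler_simple)
qed

lemma cox_weight: "cox \<eta> (weight i) = weight i - proj \<eta> i"
  by (simp add: cox_def simple_weight if_distrib if_distribR cong: if_cong)

text \<open>\<open>x - cox \<eta> x\<close> is the combination of the projectives whose coefficients
  are the weight coordinates of \<open>x\<close>, and projectives are dual to the weights under the
  Euler form.\<close>

lemma euler_cox_diff: "euler \<eta> y (x - cox \<eta> x) = x \<bullet> y"
proof -
  have "euler \<eta> y (x - cox \<eta> x) = (\<Sum>i\<in>UNIV. (\<alpha> i \<bullet> x) / hsq i * (weight i \<bullet> y))"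
    by (simp add: cox_def euler_sum euler_scale euler_proj)
  then show ?thesis by (simp add: inner_expand[of x y])
qed

text \<open>The form is triangular with respect to height: pairing with \<open>\<alpha> i\<close>
  gives the coefficient at \<open>i\<close> plus terms from higher vertices, so coefficients vanish
  from the top down.\<close>

lemma euler_nondeg: assumes "\<And>y. euler \<eta> y x = 0" shows "x = 0"
proof -
  have "x = (\<Sum>i\<in>UNIV. ((weight i \<bullet> x) / hsq i) *\<^sub>R \<alpha> i)" by (rule simple_expand)
  have w: "weight i \<bullet> x = 0" for i
  \<comment> \<open>The truncated differences make this measure decrease when
    \<open>\<eta> i\<close> increases.\<close>
  proof (induction "\<Sum>j\<in>UNIV. \<eta> j - \<eta> i" arbitrary: i rule: less_induct)
    case less
    have "weight j \<bullet> x = 0" if "\<eta> i < \<eta> j" for j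
    proof (rule less)
      show "(\<Sum>k\<in>UNIV. \<eta> k - \<eta> j) < (\<Sum>k\<in>UNIV. \<eta> k - \<eta> i)"
        by (rule sum_strict_mono_ex1) (use that in \<open>auto intro!: exI[of _ j]\<close>)
    qed
    then have "(\<Sum>j\<in>UNIV. \<Sum>k | \<eta> k < \<eta> j. (\<alpha> k \<bullet> \<alpha> j) * (weight k \<bullet> \<alpha> i / hsq k) * (weight j \<bullet> x / hsq j)) = 0"
      by (intro sum.neutral ballI) (auto simp: weight_simple)
    moreover have "(\<Sum>k\<in>UNIV. (weight k \<bullet> \<alpha> i) * (weight k \<bullet> x) / hsq k) = weight i \<bullet> x"
      by (simp add: weight_simple if_distrib if_distribR cong: if_cong)
    ultimately have "euler \<eta> (\<alpha> i) x = weight i \<bullet> x"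
      unfolding euler_def by simp
    then show ?case using assms by simp
  qed
  then show ?thesis by (rule eq_0_weight)
qed

text \<open>Each edge is counted in exactly one of the two terms because vertices of equal height
  are orthogonal, and each term contributes half of the diagonal.\<close>

lemma euler_sym: assumes "height \<eta>" shows "euler \<eta> x y + euler \<eta> y x = x \<bullet> y"
proof -
  let ?x = "\<lambda>i. weight i \<bullet> x / hsq i" and ?y = "\<lambda>i. weight i \<bullet> y / hsq i"
  let ?f = "\<lambda>i j. (\<alpha> i \<bullet> \<alpha> j) * ?x i * ?y j"
  have e1: "euler \<eta> x y = (\<Sum>i\<in>UNIV. ?f i i / 2) + (\<Sum>j\<in>UNIV. \<Sum>i\<in>UNIV. if \<eta> i < \<eta> j then ?f i j else 0)"
    unfolding euler_def sum_Collect_if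
    by (intro arg_cong2[where f = "(+)"] sum.cong) (auto simp: simple_self)
  have e2: "euler \<eta> y x = (\<Sum>i\<in>UNIV. ?f i i / 2) + (\<Sum>j\<in>UNIV. \<Sum>i\<in>UNIV. if \<eta> i < \<eta> j then ?f j i else 0)"
    unfolding euler_def sum_Collect_if
    by (intro arg_cong2[where f = "(+)"] sum.cong) (auto simp: simple_self inner_commute mult_ac)
  have e2': "(\<Sum>j\<in>UNIV. \<Sum>i\<in>UNIV. if \<eta> i < \<eta> j then ?f j i else 0) = (\<Sum>j\<in>UNIV. \<Sum>i\<in>UNIV. if \<eta> j < \<eta> i then ?f i j else 0)"
    by (rule sum.swap)
  have d: "(\<Sum>i\<in>UNIV. ?f i i / 2) + (\<Sum>i\<in>UNIV. ?f i i / 2) = (\<Sum>j\<in>UNIV. \<Sum>i\<in>UNIV. if i = j then ?f i j else 0)"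
    by (simp add: sum.distrib[symmetric] mult.assoc)
  have "x \<bullet> y = (\<Sum>i\<in>UNIV. ?x i *\<^sub>R \<alpha> i) \<bullet> (\<Sum>j\<in>UNIV. ?y j *\<^sub>R \<alpha> j)"
    using simple_expand[of x] simple_expand[of y] by simp
  also have "\<dots> = (\<Sum>j\<in>UNIV. \<Sum>i\<in>UNIV. ?f i j)"
    by (simp add: inner_sum_left inner_sum_right sum_distrib_left sum_divide_distrib mult_ac)
  also have "\<dots> = (\<Sum>j\<in>UNIV. \<Sum>i\<in>UNIV. (if i = j then ?f i j else 0) + (if \<eta> i < \<eta> j then ?f i j else 0) +
      (if \<eta> j < \<eta> i then ?f i j else 0))"
  proof (intro sum.cong refl)
    fix i j
    show "?f i j = (if i = j then ?f i j else 0) + (if \<eta> i < \<eta> j then ?f i j else 0) + (if \<eta> j < \<eta> i then ?f i j else 0)"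
      using height_eq[OF assms, of i j] by (cases "\<eta> i" "\<eta> j" rule: linorder_cases) auto
  qed
  finally show ?thesis unfolding e1 e2 e2' using d by (simp add: sum.distrib)
qed

text \<open>The Auslander-Reiten formula on dimension vectors. It characterizes \<open>cox\<close>
  through the Euler form and makes it an isometry.\<close>

lemma cox_adj: assumes "height \<eta>" shows "euler \<eta> y (cox \<eta> x) = - euler \<eta> x y"
  using euler_cox_diff[of \<eta> y x] euler_sym[OF assms, of x y] by (simp add: euler_diff)

lemma euler_cox: assumes "height \<eta>" shows "euler \<eta> (cox \<eta> x) (cox \<eta> y) = euler \<eta> x y"
  by (simp add: cox_adj[OF assms])

lemma cox_inner: assumes "height \<eta>" shows "cox \<eta> x \<bullet> cox \<eta> y = x \<bullet> y"
  using euler_sym[OF assms, of "cox \<eta> x" "cox \<eta> y"] euler_sym[OF assms, of x y] by (simp add: euler_cox[OF assms])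

lemma cox_fixed: assumes "cox \<eta> x = x" shows "x = 0"
  using euler_cox_diff[of \<eta> x x] assms by (simp add: euler_0)

lemma proj_weight_0: assumes "\<eta> i \<le> \<eta> j" "j \<noteq> i" shows "weight j \<bullet> proj \<eta> i = 0"
  using assms
proof (induction "\<eta> i" arbitrary: i rule: less_induct)
  case less
  have "(\<Sum>k | \<eta> k < \<eta> i. cf k i * (weight j \<bullet> proj \<eta> k)) = 0"
  proof (intro sum.neutral ballI)
    fix k assume k: "k \<in> {k. \<eta> k < \<eta> i}"
    then have "j \<noteq> k" using less.prems by auto
    then show "cf k i * (weight j \<bullet> proj \<eta> k) = 0" using less.hyps[of k] less.prems k by simp
  qed
  then show ?case using less.prems by (subst proj.simps) (simp add: inner_add_right inner_sum_right weight_simple)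
qed

lemma proj_weight_self: "weight i \<bullet> proj \<eta> i = hsq i"
proof -
  have "(\<Sum>k | \<eta> k < \<eta> i. cf k i * (weight i \<bullet> proj \<eta> k)) = 0"
  proof (intro sum.neutral ballI)
    fix k assume "k \<in> {k. \<eta> k < \<eta> i}"
    then show "cf k i * (weight i \<bullet> proj \<eta> k) = 0" using proj_weight_0[of \<eta> k i] by (cases "i = k") auto
  qed
  then show ?thesis by (subst proj.simps) (simp add: inner_add_right inner_sum_right weight_simple)
qed

lemma proj_weight_nonneg: "0 \<le> weight j \<bullet> proj \<eta> i"
proof (induction "\<eta> i" arbitrary: i rule: less_induct)
  case less
  have "0 \<le> (\<Sum>k | \<eta> k < \<eta> i. cf k i * (weight j \<bullet> proj \<eta> k))"
  proof (rule sum_nonneg)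
    fix k assume k: "k \<in> {k. \<eta> k < \<eta> i}"
    then have "k \<noteq> i" by auto
    then show "0 \<le> cf k i * (weight j \<bullet> proj \<eta> k)" using less k cf_nonneg[of k i] by simp
  qed
  moreover have "0 \<le> weight j \<bullet> \<alpha> i" using pos_weight[OF simple_pos] .
  ultimately show ?case by (subst proj.simps) (simp add: inner_add_right inner_sum_right)
qed

lemma proj_weight_pos: assumes "\<eta> j < \<eta> i" "\<alpha> j \<bullet> \<alpha> i \<noteq> 0" shows "0 < weight j \<bullet> proj \<eta> i"
proof -
  have ji: "j \<noteq> i" using assms by auto
  have "0 < (\<Sum>k | \<eta> k < \<eta> i. cf k i * (weight j \<bullet> proj \<eta> k))"
  proof (rule sum_pos2[where i = j])
    show "0 < cf j i * (weight j \<bullet> proj \<eta> j)"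
      using cf_pos_iff[OF ji] assms hsq_pos by (simp add: proj_weight_self)
    show "0 \<le> cf k i * (weight j \<bullet> proj \<eta> k)" if "k \<in> {k. \<eta> k < \<eta> i}" for k
      using that cf_nonneg_less proj_weight_nonneg by auto
  qed (use assms in auto)
  then show ?thesis using ji by (subst proj.simps) (simp add: inner_add_right inner_sum_right weight_simple)
qed

text \<open>The mesh relations, in the shape they take on weights.\<close>

lemma cox_mesh:
  assumes "height \<eta>"
  shows "weight i + cox \<eta> (weight i) =
    (\<Sum>j | \<eta> j < \<eta> i. cf j i *\<^sub>R cox \<eta> (weight j)) + (\<Sum>j | \<eta> i < \<eta> j. cf j i *\<^sub>R weight j)"
proof -
  have s: "(\<Sum>j\<in>-{i}. cf j i *\<^sub>R weight j) =
      (\<Sum>j | \<eta> j < \<eta> i. cf j i *\<^sub>R weight j) + (\<Sum>j | \<eta> i < \<eta> j. cf j i *\<^sub>R weight j)"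
  proof -
    have "(\<Sum>j\<in>-{i}. cf j i *\<^sub>R weight j) = (\<Sum>j\<in>{j. \<eta> j < \<eta> i} \<union> {j. \<eta> i < \<eta> j}. cf j i *\<^sub>R weight j)"
      by (rule sum.mono_neutral_right) (auto simp: cf_eq_0_iff intro!: height_eq[OF assms] dest!: order_antisym[OF leI leI])
    also have "\<dots> = (\<Sum>j | \<eta> j < \<eta> i. cf j i *\<^sub>R weight j) + (\<Sum>j | \<eta> i < \<eta> j. cf j i *\<^sub>R weight j)"
      by (rule sum.union_disjoint) auto
    finally show ?thesis .
  qed
  have "weight i + cox \<eta> (weight i) = weight i + (weight i - \<alpha> i) - (\<Sum>j | \<eta> j < \<eta> i. cf j i *\<^sub>R proj \<eta> j)"
    by (simp add: cox_weight proj.simps[of \<eta> i])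
  also have "\<dots> = (\<Sum>j\<in>-{i}. cf j i *\<^sub>R weight j) - (\<Sum>j | \<eta> j < \<eta> i. cf j i *\<^sub>R proj \<eta> j)"
    by (simp only: refl_weight_self) simp
  also have "\<dots> = (\<Sum>j | \<eta> j < \<eta> i. cf j i *\<^sub>R (weight j - proj \<eta> j)) + (\<Sum>j | \<eta> i < \<eta> j. cf j i *\<^sub>R weight j)"
    by (simp add: s scaleR_right_diff_distrib sum_subtractf)
  finally show ?thesis by (simp add: cox_weight)
qed

text \<open>This is \<open>cox_mesh\<close> under the map id - cox, which sends weights to
  projectives and commutes with cox.\<close>

lemma cox_mesh_proj:
  assumes "height \<eta>"
  shows "proj \<eta> i + cox \<eta> (proj \<eta> i) =
    (\<Sum>j | \<eta> j < \<eta> i. cf j i *\<^sub>R cox \<eta> (proj \<eta> j)) + (\<Sum>j | \<eta> i < \<eta> j. cf j i *\<^sub>R proj \<eta> j)"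
proof -
  note lin = linear_cox[of \<eta>]
  have p: "proj \<eta> j = weight j - cox \<eta> (weight j)" for j by (simp add: cox_weight)
  have "proj \<eta> i + cox \<eta> (proj \<eta> i) = (weight i + cox \<eta> (weight i)) - cox \<eta> (weight i + cox \<eta> (weight i))"
    by (simp add: p linear_add[OF lin] linear_diff[OF lin])
  also have "\<dots> = (\<Sum>j | \<eta> j < \<eta> i. cf j i *\<^sub>R cox \<eta> (proj \<eta> j)) + (\<Sum>j | \<eta> i < \<eta> j. cf j i *\<^sub>R proj \<eta> j)"
    unfolding cox_mesh[OF assms] p
    by (simp add: linear_add[OF lin] linear_sum[OF lin] linear_scale[OF lin] linear_diff[OF lin]
        scaleR_right_diff_distrib sum_subtractf)
  finally show ?thesis .
qed

text \<open>Induction on the height in the \<open>j\<close> coordinate of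
  \<open>cox_mesh_proj\<close>, where \<open>proj \<eta> x\<close> has no component at the higher
  vertex \<open>j\<close>. The strict version below is what keeps adjacent rows of objects in step
  (\<open>pred_closed_Ob\<close>).\<close>

lemma cox_proj_weight_nonneg:
  assumes "height \<eta>" "\<eta> x < \<eta> j" shows "0 \<le> weight j \<bullet> cox \<eta> (proj \<eta> x)"
  using assms(2)
proof (induction "\<eta> x" arbitrary: x rule: less_induct)
  case less
  have "weight j \<bullet> (proj \<eta> x + cox \<eta> (proj \<eta> x)) =
    (\<Sum>k | \<eta> k < \<eta> x. cf k x * (weight j \<bullet> cox \<eta> (proj \<eta> k))) + (\<Sum>k | \<eta> x < \<eta> k. cf k x * (weight j \<bullet> proj \<eta> k))"
    by (simp add: cox_mesh_proj[OF assms(1)] inner_add_right inner_sum_right)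
  moreover have "weight j \<bullet> proj \<eta> x = 0" using less.prems by (intro proj_weight_0) auto
  moreover have "0 \<le> (\<Sum>k | \<eta> k < \<eta> x. cf k x * (weight j \<bullet> cox \<eta> (proj \<eta> k)))"
    by (intro sum_nonneg mult_nonneg_nonneg) (use less cf_nonneg_less in auto)
  moreover have "0 \<le> (\<Sum>k | \<eta> x < \<eta> k. cf k x * (weight j \<bullet> proj \<eta> k))"
    by (intro sum_nonneg mult_nonneg_nonneg) (use cf_nonneg_less proj_weight_nonneg in auto)
  ultimately show ?case by (simp add: inner_add_right)
qed

lemma cox_proj_weight_pos:
  assumes "height \<eta>" "\<eta> i < \<eta> j" "\<alpha> j \<bullet> \<alpha> i \<noteq> 0" shows "0 < weight j \<bullet> cox \<eta> (proj \<eta> i)"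
proof -
  have ji: "j \<noteq> i" using assms by auto
  have "weight j \<bullet> (proj \<eta> i + cox \<eta> (proj \<eta> i)) =
    (\<Sum>k | \<eta> k < \<eta> i. cf k i * (weight j \<bullet> cox \<eta> (proj \<eta> k))) + (\<Sum>k | \<eta> i < \<eta> k. cf k i * (weight j \<bullet> proj \<eta> k))"
    by (simp add: cox_mesh_proj[OF assms(1)] inner_add_right inner_sum_right)
  moreover have "weight j \<bullet> proj \<eta> i = 0" using assms by (intro proj_weight_0) auto
  moreover have "0 \<le> (\<Sum>k | \<eta> k < \<eta> i. cf k i * (weight j \<bullet> cox \<eta> (proj \<eta> k)))"
    by (intro sum_nonneg mult_nonneg_nonneg) (use assms cox_proj_weight_nonneg cf_nonneg_less in auto)
  moreover have "0 < (\<Sum>k | \<eta> i < \<eta> k. cf k i * (weight j \<bullet> proj \<eta> k))"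
  proof (rule sum_pos2[where i = j])
    show "0 < cf j i * (weight j \<bullet> proj \<eta> j)"
      using cf_pos_iff[OF ji] assms hsq_pos by (simp add: proj_weight_self)
    show "0 \<le> cf k i * (weight j \<bullet> proj \<eta> k)" if "k \<in> {k. \<eta> i < \<eta> k}" for k
      using that cf_nonneg_less proj_weight_nonneg by auto
  qed (use assms in auto)
  ultimately show ?thesis by (simp add: inner_add_right)
qed

section \<open>Reflection of the quiver at a sink\<close>

lemma height_raise: assumes "height \<eta>" "sink \<eta> i" shows "height (raise i \<eta>)"
  unfolding height_def
proof (intro allI impI)
  fix a b assume ab: "a \<noteq> b \<and> \<alpha> a \<bullet> \<alpha> b \<noteq> 0"
  then have h: "\<eta> a = Suc (\<eta> b) \<or> \<eta> b = Suc (\<eta> a)" using assms(1) by (auto simp: height_def)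
  have "a = i \<Longrightarrow> \<eta> a < \<eta> b" "b = i \<Longrightarrow> \<eta> b < \<eta> a"
    using assms(2) ab by (auto simp: sink_def inner_commute)
  then show "raise i \<eta> a = Suc (raise i \<eta> b) \<or> raise i \<eta> b = Suc (raise i \<eta> a)"
    using h ab by (cases "a = i"; cases "b = i") (auto simp: raise_def)
qed

lemma sink_cf: "sink \<eta> i \<Longrightarrow> \<eta> j < \<eta> i \<Longrightarrow> cf j i = 0"
  unfolding sink_def cf_eq_0_iff by (metis inner_commute less_asym less_irrefl)

lemma proj_sink: assumes "sink \<eta> i" shows "proj \<eta> i = \<alpha> i"
  by (subst proj.simps) (simp add: sink_cf[OF assms])

lemma cox_sink: "sink \<eta> i \<Longrightarrow> cox \<eta> (weight i) = srefl i (weight i)"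
  by (simp add: cox_weight proj_sink refl_weight)

text \<open>The reflection functor at a sink keeps the projectives at the other vertices. Only
  \<open>i\<close> changes its height, so the two recursions differ in the \<open>i\<close> term
  alone, which \<open>srefl i (\<alpha> j)\<close> absorbs.\<close>

lemma proj_raise:
  assumes "height \<eta>" "sink \<eta> i" "j \<noteq> i"
  shows "proj (raise i \<eta>) j = srefl i (proj \<eta> j)"
  using assms(3)
proof (induction "\<eta> j" arbitrary: j rule: less_induct)
  case less
  note lin = linear_refl[of i]
  let ?S = "{k. \<eta> k < \<eta> j} - {i}"
  have adj: "\<eta> j = Suc (\<eta> i)" if "cf i j \<noteq> 0"
  proof -
    have a: "\<alpha> i \<bullet> \<alpha> j \<noteq> 0" using that by (simp add: cf_eq_0_iff)
    then have "\<eta> i < \<eta> j" using assms(2) less.prems by (simp add: sink_def)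
    moreover have "\<eta> i = Suc (\<eta> j) \<or> \<eta> j = Suc (\<eta> i)"
      using assms(1) a less.prems unfolding height_def by simp
    ultimately show ?thesis by linarith
  qed
  have "proj (raise i \<eta>) j = \<alpha> j + (\<Sum>k | raise i \<eta> k < raise i \<eta> j. cf k j *\<^sub>R proj (raise i \<eta>) k)"
    by (rule proj.simps)
  also have "(\<Sum>k | raise i \<eta> k < raise i \<eta> j. cf k j *\<^sub>R proj (raise i \<eta>) k) = (\<Sum>k\<in>?S. cf k j *\<^sub>R proj (raise i \<eta>) k)"
  proof (rule sum.mono_neutral_right)
    show "?S \<subseteq> {k. raise i \<eta> k < raise i \<eta> j}" using less.prems by (auto simp: raise_def)
    show "\<forall>k\<in>{k. raise i \<eta> k < raise i \<eta> j} - ?S. cf k j *\<^sub>R proj (raise i \<eta>) k = 0"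
    proof
      fix k assume k: "k \<in> {k. raise i \<eta> k < raise i \<eta> j} - ?S"
      have r: "raise i \<eta> j = \<eta> j" "k \<noteq> i \<Longrightarrow> raise i \<eta> k = \<eta> k" "raise i \<eta> i = \<eta> i + 2"
        using less.prems by (simp_all add: raise_def)
      have k1: "raise i \<eta> k < raise i \<eta> j" and k2: "\<not> (\<eta> k < \<eta> j \<and> k \<noteq> i)" using k by blast+
      \<comment> \<open>The only possible extra index is \<open>i\<close>, in case it stays below
        \<open>j\<close> even after being raised by two; then \<open>j\<close> is too high to be a
        neighbour of \<open>i\<close>.\<close>
      have "k = i" using k1 k2 r(1,2) by metis
      then have "\<eta> i + 2 < \<eta> j" using k1 r(1,3) by metis
      then have "cf i j = 0" using adj by linarith
      then show "cf k j *\<^sub>R proj (raise i \<eta>) k = 0" using \<open>k = i\<close> by simp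
    qed
  qed simp
  also have "\<dots> = (\<Sum>k\<in>?S. cf k j *\<^sub>R srefl i (proj \<eta> k))"
    by (rule sum.cong) (use less in auto)
  finally have 1: "proj (raise i \<eta>) j = \<alpha> j + (\<Sum>k\<in>?S. cf k j *\<^sub>R srefl i (proj \<eta> k))" .
  have "(\<Sum>k | \<eta> k < \<eta> j. cf k j *\<^sub>R proj \<eta> k) = cf i j *\<^sub>R proj \<eta> i + (\<Sum>k\<in>?S. cf k j *\<^sub>R proj \<eta> k)"
  proof (cases "\<eta> i < \<eta> j")
    case True then show ?thesis by (intro sum.remove) auto
  next
    case False
    then have "cf i j = 0" using adj by auto
    moreover have "?S = {k. \<eta> k < \<eta> j}" using False by auto
    ultimately show ?thesis by simp
  qed
  then have "proj \<eta> j = \<alpha> j + cf i j *\<^sub>R \<alpha> i + (\<Sum>k\<in>?S. cf k j *\<^sub>R proj \<eta> k)"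
    by (subst proj.simps) (simp add: proj_sink[OF assms(2)])
  also have "\<alpha> j + cf i j *\<^sub>R \<alpha> i = srefl i (\<alpha> j)" by (simp add: refl_simple)
  finally have "srefl i (proj \<eta> j) = \<alpha> j + (\<Sum>k\<in>?S. cf k j *\<^sub>R srefl i (proj \<eta> k))"
    by (simp add: linear_add[OF lin] linear_sum[OF lin] linear_scale[OF lin])
  with 1 show ?case by simp
qed

lemma proj_raise_self:
  assumes "height \<eta>" "sink \<eta> i"
  shows "proj (raise i \<eta>) i = \<alpha> i + (\<Sum>j\<in>-{i}. cf j i *\<^sub>R srefl i (proj \<eta> j))"
proof -
  have *: "raise i \<eta> j < raise i \<eta> i" if "j \<noteq> i" "cf j i \<noteq> 0" for j
  proof -
    have a: "\<alpha> i \<bullet> \<alpha> j \<noteq> 0" using that by (simp add: cf_eq_0_iff inner_commute)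
    then have "\<eta> i = Suc (\<eta> j) \<or> \<eta> j = Suc (\<eta> i)"
      using assms(1) that unfolding height_def by simp
    then show ?thesis using that by (auto simp: raise_def)
  qed
  have "proj (raise i \<eta>) i = \<alpha> i + (\<Sum>k | raise i \<eta> k < raise i \<eta> i. cf k i *\<^sub>R proj (raise i \<eta>) k)"
    by (rule proj.simps)
  also have "(\<Sum>k | raise i \<eta> k < raise i \<eta> i. cf k i *\<^sub>R proj (raise i \<eta>) k) = (\<Sum>k\<in>-{i}. cf k i *\<^sub>R proj (raise i \<eta>) k)"
    by (rule sum.mono_neutral_left) (use * in auto)
  also have "\<dots> = (\<Sum>k\<in>-{i}. cf k i *\<^sub>R srefl i (proj \<eta> k))"
    by (rule sum.cong) (use proj_raise[OF assms] in auto)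
  finally show ?thesis .
qed

text \<open>By linearity it suffices to compare on weights. At \<open>i\<close> itself
  \<open>refl_weight_self\<close> expresses the reflected weight in the weights, and the result is
  the recursion \<open>proj_raise_self\<close>.\<close>

lemma cox_raise:
  assumes "height \<eta>" "sink \<eta> i"
  shows "cox (raise i \<eta>) (srefl i x) = srefl i (cox \<eta> x)"
proof -
  note lin = linear_refl[of i] and lc = linear_cox
  let ?c = "\<lambda>x. srefl i (cox \<eta> (srefl i x))"
  have l: "linear ?c" using linear_compose[OF linear_compose[OF lin lc[of \<eta>]] lin] by (simp add: o_def)
  have "cox (raise i \<eta>) (weight j) = ?c (weight j)" for j
  proof (cases "j = i")
    case False
    then show ?thesis
      by (simp add: cox_weight refl_weight proj_raise[OF assms] linear_diff[OF lin])
  next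
    case True
    have w: "srefl i (weight i) = (\<Sum>j\<in>-{i}. cf j i *\<^sub>R weight j) - weight i"
      by (simp add: refl_weight refl_weight_self)
    have "cox \<eta> (srefl i (weight i)) = srefl i (weight i) + \<alpha> i - (\<Sum>j\<in>-{i}. cf j i *\<^sub>R proj \<eta> j)"
      unfolding w by (simp add: linear_diff[OF lc] linear_sum[OF lc] linear_scale[OF lc] cox_weight
          proj_sink[OF assms(2)] scaleR_right_diff_distrib sum_subtractf)
    then have "?c (weight i) = weight i - \<alpha> i - (\<Sum>j\<in>-{i}. cf j i *\<^sub>R srefl i (proj \<eta> j))"
      by (simp add: linear_diff[OF lin] linear_add[OF lin] linear_sum[OF lin] linear_scale[OF lin])
    then show ?thesis using True by (simp add: cox_weight proj_raise_self[OF assms])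
  qed
  from linear_eq_weight[OF lc l this, of "srefl i x"] show ?thesis by simp
qed

lemma cox_surj: obtains x where "y = x - cox \<eta> x"
proof -
  have l: "linear (\<lambda>x. x - cox \<eta> x)"
    using linear_compose_sub[OF linear_id linear_cox] by (simp add: id_def)
  have "inj (\<lambda>x. x - cox \<eta> x)"
    unfolding linear_injective_0[OF l] using cox_fixed by (metis eq_iff_diff_eq_0)
  then have "surj (\<lambda>x. x - cox \<eta> x)" using linear_injective_imp_surjective[OF l] by simp
  then show thesis using that by (metis surjD)
qed

text \<open>Since id - cox is onto, \<open>euler_cox_diff\<close> reduces the Euler form to the
  inner product, which reflections preserve.\<close>

lemma euler_raise:
  assumes "height \<eta>" "sink \<eta> i"
  shows "euler (raise i \<eta>) (srefl i x) (srefl i y) = euler \<eta> x y"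
proof -
  obtain z where z: "y = z - cox \<eta> z" by (rule cox_surj)
  have "srefl i y = srefl i z - cox (raise i \<eta>) (srefl i z)"
    by (simp add: z linear_diff[OF linear_refl] cox_raise[OF assms])
  then show ?thesis by (simp add: euler_cox_diff z)
qed

text \<open>The hypothesis says \<open>cox \<eta> x = srefl i x\<close>. At a sink both differ from
  \<open>x\<close> by combinations of projectives, and comparing them under the Euler form kills
  every weight coordinate of \<open>x\<close> except the one at \<open>i\<close>.\<close>

lemma sink_cox_fixed:
  assumes "sink \<eta> i" "srefl i (cox \<eta> x) = x"
  shows "x = ((\<alpha> i \<bullet> x) / hsq i) *\<^sub>R weight i"
proof -
  have "cox \<eta> x = srefl i x" using assms(2) by (metis refl_refl)
  then have "(\<Sum>j\<in>UNIV. ((\<alpha> j \<bullet> x) / hsq j) *\<^sub>R proj \<eta> j) = ((\<alpha> i \<bullet> x) / hsq i) *\<^sub>R proj \<eta> i"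
    by (simp add: cox_def srefl_def proj_sink[OF assms(1)] inner_commute)
  then have "euler \<eta> (\<alpha> k) (\<Sum>j\<in>UNIV. ((\<alpha> j \<bullet> x) / hsq j) *\<^sub>R proj \<eta> j) =
      euler \<eta> (\<alpha> k) (((\<alpha> i \<bullet> x) / hsq i) *\<^sub>R proj \<eta> i)" for k by simp
  then have d: "\<alpha> k \<bullet> x = (if k = i then \<alpha> i \<bullet> x else 0)" for k
    by (simp add: euler_sum euler_scale euler_proj weight_simple if_distrib cong: if_cong)
  have "x - ((\<alpha> i \<bullet> x) / hsq i) *\<^sub>R weight i = 0"
  proof (rule eq_0_simple)
    fix k show "\<alpha> k \<bullet> (x - ((\<alpha> i \<bullet> x) / hsq i) *\<^sub>R weight i) = 0"
      using d[of k] by (cases "k = i") (simp_all add: inner_diff_right simple_weight)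
  qed
  then show ?thesis by simp
qed

end

context root_basis
begin

text \<open>An orbit that stays among the finitely many positive roots repeats. The sum over one
  period is fixed by \<open>g\<close>, hence zero, but a sum of positive roots is not zero.\<close>

lemma exists_not_pos:
  assumes lin: "linear g" and fixed: "\<And>x. g x = x \<Longrightarrow> x = 0" and root: "\<And>x. x \<in> \<Phi> \<Longrightarrow> g x \<in> \<Phi>"
    and "\<gamma> \<in> \<Phi>"
  shows "\<exists>n. (g ^^ n) \<gamma> \<notin> pos"
proof (rule ccontr)
  assume "\<not> ?thesis"
  then have p: "(g ^^ n) \<gamma> \<in> pos" for n by blast
  have "\<not> inj (\<lambda>n. (g ^^ n) \<gamma>)"
    using finite_subset[OF _ finite_pos, of "range (\<lambda>n. (g ^^ n) \<gamma>)"] p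
    by (metis (no_types, lifting) finite_imageD image_subset_iff infinite_UNIV_nat)
  then obtain a b where ab: "(g ^^ a) \<gamma> = (g ^^ b) \<gamma>" "a < b"
    unfolding inj_def by (metis linorder_neqE_nat)
  define z where "z = (\<Sum>l\<in>{a..<b}. (g ^^ l) \<gamma>)"
  have "g z = (\<Sum>l\<in>{a..<b}. (g ^^ Suc l) \<gamma>)" by (simp add: z_def linear_sum[OF lin])
  also have "\<dots> = (\<Sum>l\<in>{Suc a..<Suc b}. (g ^^ l) \<gamma>)" by (simp only: sum.shift_bounds_Suc_ivl)
  also have "\<dots> = (\<Sum>l\<in>{Suc a..<b}. (g ^^ l) \<gamma>) + (g ^^ b) \<gamma>" using ab(2) by simp
  also have "\<dots> = z" using ab by (simp add: z_def sum.atLeast_Suc_lessThan[of a b])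
  finally have "z = 0" by (rule fixed)
  obtain i where i: "0 < weight i \<bullet> (g ^^ a) \<gamma>" using pos_obtain_weight[OF p] .
  have "0 < (\<Sum>l\<in>{a..<b}. weight i \<bullet> (g ^^ l) \<gamma>)"
    by (rule sum_pos2[where i = a]) (use ab i pos_weight[OF p] in auto)
  then show False using \<open>z = 0\<close> by (simp add: z_def inner_sum_right flip: inner_sum_right)
qed

end

section \<open>The periodic word of a Coxeter element and the roots crossed by its subwords\<close>

locale coxeter_word = root_basis \<Phi> \<alpha>
  for \<Phi> :: "(real^'n::finite) set" and \<alpha> :: "'n \<Rightarrow> real^'n" +
  fixes \<eta> :: "'n \<Rightarrow> nat" and q :: "nat \<Rightarrow> 'n"
  assumes height: "height \<eta>" and q_bij: "bij_betw q {..<CARD('n)} UNIV" and q_mod: "q (t mod CARD('n)) = q t"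
    and q_mono: "a < CARD('n) \<Longrightarrow> b < CARD('n) \<Longrightarrow> \<eta> (q a) < \<eta> (q b) \<Longrightarrow> a < b"
begin

abbreviation "c \<equiv> cox \<eta>"
abbreviation "pr \<equiv> proj \<eta>"

lemma linear_cpow: "linear (c ^^ k)"
  by (induction k) (simp_all add: linear_compose linear_cox linear_ident id_def del: o_apply)

text \<open>
  Prefix products \<open>srefl (q t\<^sub>1) srefl (q t\<^sub>2) \<dots>\<close> over the positions
  \<open>t\<^sub>1 < t\<^sub>2 < \<dots>\<close> in \<open>S\<close>, and their inverses.
\<close>

primrec wd :: "nat set \<Rightarrow> nat \<Rightarrow> real^'n \<Rightarrow> real^'n" where
  "wd S 0 x = x"
| "wd S (Suc t) x = (if t \<in> S then wd S t (srefl (q t) x) else wd S t x)"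

primrec wi :: "nat set \<Rightarrow> nat \<Rightarrow> real^'n \<Rightarrow> real^'n" where
  "wi S 0 x = x"
| "wi S (Suc t) x = (if t \<in> S then srefl (q t) (wi S t x) else wi S t x)"

definition rt :: "nat set \<Rightarrow> nat \<Rightarrow> real^'n" where
  "rt S t = wd S t (\<alpha> (q t))"

lemma wd_wi [simp]: "wd S t (wi S t x) = x" by (induction t arbitrary: x) auto
lemma wi_wd [simp]: "wi S t (wd S t x) = x" by (induction t arbitrary: x) auto

lemma wd_adjoint: "wd S t x \<bullet> y = x \<bullet> wi S t y"
  by (induction t arbitrary: x) (auto simp: refl_adjoint)

lemma wd_inner [simp]: "wd S t x \<bullet> wd S t y = x \<bullet> y" by (simp add: wd_adjoint)
lemma wi_inner [simp]: "wi S t x \<bullet> wi S t y = x \<bullet> y" by (metis wd_inner wd_wi)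

lemma linear_wd: "linear (wd S t)"
proof (induction t)
  case (Suc t)
  have "wd S (Suc t) = (if t \<in> S then wd S t \<circ> srefl (q t) else wd S t)" by (auto simp: fun_eq_iff)
  then show ?case using linear_compose[OF linear_refl Suc] Suc by simp
qed (simp add: linear_iff)

lemma linear_wi: "linear (wi S t)"
proof (induction t)
  case (Suc t)
  have "wi S (Suc t) = (if t \<in> S then srefl (q t) \<circ> wi S t else wi S t)" by (auto simp: fun_eq_iff)
  then show ?case using linear_compose[OF Suc linear_refl] Suc by simp
qed (simp add: linear_iff)

lemma wd_root [simp]: "wd S t x \<in> \<Phi> \<longleftrightarrow> x \<in> \<Phi>" by (induction t arbitrary: x) auto
lemma wd_minus [simp]: "wd S t (- x) = - wd S t x" using linear_neg[OF linear_wd] .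
lemma wi_minus [simp]: "wi S t (- x) = - wi S t x" using linear_neg[OF linear_wi] .

lemma wd_eq_iff [simp]: "wd S t x = wd S t y \<longleftrightarrow> x = y" by (metis wi_wd)
lemma rt_root [simp]: "rt S t \<in> \<Phi>" by (simp add: rt_def simple_root)

lemma wi_rt [simp]: "wi S t (rt S t) = \<alpha> (q t)" by (simp add: rt_def)

text \<open>Along a word the image of a root changes sign only if the letter read is, up to sign,
  its current image, that is, if the root of that letter is \<open>\<gamma>\<close> up to sign. This
  lemma and the two after it replace inversion sets and lengths.\<close>

lemma wi_pos_uncrossed:
  assumes "\<gamma> \<in> pos" "\<And>t'. t' < t \<Longrightarrow> t' \<in> S \<Longrightarrow> rt S t' \<noteq> \<gamma> \<and> rt S t' \<noteq> - \<gamma>"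
  shows "wi S t \<gamma> \<in> pos"
  using assms(2)
proof (induction t)
  case (Suc t)
  then have p: "wi S t \<gamma> \<in> pos" by simp
  show ?case
  proof (cases "t \<in> S")
    case True
    then have "wi S t \<gamma> \<noteq> \<alpha> (q t)" using Suc.prems[of t] by (metis lessI rt_def wd_wi)
    then show ?thesis using True p by (simp add: refl_pos)
  qed (use p in simp)
qed (use assms in simp)

lemma wi_neg_crossed_once:
  assumes "\<gamma> \<in> pos" "t0 < t" "t0 \<in> S" "rt S t0 = \<gamma>"
    and "\<And>t'. t' < t \<Longrightarrow> t' \<in> S \<Longrightarrow> t' \<noteq> t0 \<Longrightarrow> rt S t' \<noteq> \<gamma> \<and> rt S t' \<noteq> - \<gamma>"
  shows "- wi S t \<gamma> \<in> pos"
  using assms(2,5)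
proof (induction t)
  case (Suc t)
  show ?case
  proof (cases "t = t0")
    case True
    have "wi S t0 \<gamma> = \<alpha> (q t0)" using assms(4) by (metis wi_rt)
    then show ?thesis using True assms(3) by (simp add: simple_pos)
  next
    case False
    then have p: "- wi S t \<gamma> \<in> pos" using Suc by simp
    show ?thesis
    proof (cases "t \<in> S")
      case True
      have "- wi S t \<gamma> \<noteq> \<alpha> (q t)"
      proof
        assume "- wi S t \<gamma> = \<alpha> (q t)"
        then have "rt S t = - \<gamma>" by (metis rt_def wd_minus wd_wi)
        then show False using Suc.prems(2)[of t] True False by simp
      qed
      then have "srefl (q t) (- wi S t \<gamma>) \<in> pos" using p by (rule refl_pos[rotated])
      then show ?thesis using True by simp
    qed (use p in simp)
  qed
qed simp

lemma exists_crossing: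
  assumes "\<gamma> \<in> pos" "wi S t \<gamma> \<notin> pos"
  shows "\<exists>t'<t. t' \<in> S \<and> rt S t' = \<gamma>"
  using assms(2)
proof (induction t)
  case (Suc t)
  show ?case
  proof (cases "wi S t \<gamma> \<in> pos")
    case True
    then have "t \<in> S" using Suc.prems by (auto split: if_splits)
    then have "wi S t \<gamma> = \<alpha> (q t)" using Suc.prems True refl_pos by auto
    then show ?thesis using \<open>t \<in> S\<close> by (metis lessI rt_def wd_wi)
  next
    case False then show ?thesis using Suc.IH less_SucI by blast
  qed
qed (use assms in simp)

subsection \<open>Positions in the translation quiver\<close>

definition ps :: "'n \<Rightarrow> nat" where "ps = the_inv_into {..<CARD('n)} q"

definition pt :: "nat \<Rightarrow> 'n \<Rightarrow> nat" where "pt k i = k * CARD('n) + ps i"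

lemma ps_less: "ps i < CARD('n)" and q_ps [simp]: "q (ps i) = i"
  using q_bij by (auto simp: ps_def bij_betw_def f_the_inv_into_f intro: the_inv_into_into[of q "{..<CARD('n)}", THEN lessThan_iff[THEN iffD1]])

lemma ps_q: "a < CARD('n) \<Longrightarrow> ps (q a) = a"
  using q_bij by (simp add: ps_def bij_betw_def the_inv_into_f_f)

lemma ps_mono: "\<eta> i < \<eta> j \<Longrightarrow> ps i < ps j"
  using q_mono[of "ps i" "ps j"] ps_less by simp

lemma q_pt [simp]: "q (pt k i) = i"
  using q_mod[of "pt k i"] ps_less[of i] by (simp add: pt_def)

lemma pt_div [simp]: "pt k i div CARD('n) = k" using ps_less[of i] by (simp add: pt_def)

lemma pt_q: "pt (t div CARD('n)) (q t) = t"
proof -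
  have "ps (q t) = t mod CARD('n)" using ps_q[of "t mod CARD('n)"] q_mod[of t] by simp
  then show ?thesis by (simp add: pt_def)
qed

lemma pt_eq_iff [simp]: "pt k i = pt l j \<longleftrightarrow> k = l \<and> i = j"
  by (metis pt_div q_pt)

lemma pt_less: "pt l j < pt k i \<longleftrightarrow> l < k \<or> (l = k \<and> ps j < ps i)"
proof -
  have "pt l j < pt k i" if "l < k"
  proof -
    have "pt l j < Suc l * CARD('n)" using ps_less[of j] by (simp add: pt_def)
    also have "\<dots> \<le> k * CARD('n)" using that by (intro mult_le_mono1) auto
    finally show ?thesis by (simp add: pt_def)
  qed
  moreover have "\<not> pt l j < pt k i" if "k < l"
  proof -
    have "pt k i < Suc k * CARD('n)" using ps_less[of i] by (simp add: pt_def)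
    also have "\<dots> \<le> l * CARD('n)" using that by (intro mult_le_mono1) auto
    finally show ?thesis by (simp add: pt_def)
  qed
  ultimately show ?thesis by (cases l k rule: linorder_cases) (auto simp: pt_def)
qed

lemma less_rank_iff: "t < CARD('n) \<longleftrightarrow> t div CARD('n) = 0" by (simp add: div_eq_0_iff)

section \<open>Reading letters at sinks\<close>

primrec cnt :: "nat set \<Rightarrow> nat \<Rightarrow> 'n \<Rightarrow> nat" where
  "cnt S 0 j = 0"
| "cnt S (Suc t) j = (if t \<in> S \<and> q t = j then Suc (cnt S t j) else cnt S t j)"

text \<open>The height function obtained by reflecting the quiver at all letters of \<open>S\<close>
  read so far; it is meaningful when each of them is a sink at its turn
  (\<open>sink_hs\<close>).\<close>

primrec hs :: "nat set \<Rightarrow> nat \<Rightarrow> 'n \<Rightarrow> nat" where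
  "hs S 0 = \<eta>"
| "hs S (Suc t) = (if t \<in> S then raise (q t) (hs S t) else hs S t)"

lemma hs_cnt: "hs S t j = \<eta> j + 2 * cnt S t j"
  by (induction t arbitrary: j) (auto simp: raise_def)

lemma cnt_card: "cnt S t j = card {t'. t' < t \<and> t' \<in> S \<and> q t' = j}"
proof (induction t)
  case (Suc t)
  have "{t'. t' < Suc t \<and> t' \<in> S \<and> q t' = j} =
      (if t \<in> S \<and> q t = j then insert t {t'. t' < t \<and> t' \<in> S \<and> q t' = j} else {t'. t' < t \<and> t' \<in> S \<and> q t' = j})"
    by (auto simp: less_Suc_eq)
  then show ?case using Suc by simp
qed simp

lemma cnt_eq:
  assumes "\<And>l. l < r \<Longrightarrow> pt l j \<in> S" "\<And>l. pt l j < t \<longleftrightarrow> l < r"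
  shows "cnt S t j = r"
proof -
  have "{t'. t' < t \<and> t' \<in> S \<and> q t' = j} = (\<lambda>l. pt l j) ` {..<r}"
  proof (intro set_eqI iffI)
    fix x assume x: "x \<in> {t'. t' < t \<and> t' \<in> S \<and> q t' = j}"
    then have "x = pt (x div CARD('n)) j" using pt_q[of x] by simp
    moreover have "x div CARD('n) < r" using x assms(2) calculation by (metis mem_Collect_eq)
    ultimately show "x \<in> (\<lambda>l. pt l j) ` {..<r}" by blast
  qed (use assms in auto)
  then show ?thesis by (simp add: cnt_card card_image inj_on_def)
qed

text \<open>Closure under predecessors in the translation quiver: earlier positions of the row, the
  same column for lower neighbours, the previous column for higher ones.\<close>

definition pred_closed :: "nat set \<Rightarrow> bool" where
  "pred_closed S \<longleftrightarrow> (\<forall>k i. pt k i \<in> S \<longrightarrow> (\<forall>l<k. pt l i \<in> S) \<and>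
     (\<forall>j. \<alpha> i \<bullet> \<alpha> j \<noteq> 0 \<and> \<eta> j < \<eta> i \<longrightarrow> pt k j \<in> S) \<and>
     (\<forall>j. \<alpha> i \<bullet> \<alpha> j \<noteq> 0 \<and> \<eta> i < \<eta> j \<and> 0 < k \<longrightarrow> pt (k - 1) j \<in> S))"

lemma pred_closed_row: "pred_closed S \<Longrightarrow> pt k i \<in> S \<Longrightarrow> l \<le> k \<Longrightarrow> pt l i \<in> S"
  unfolding pred_closed_def by (metis le_eq_less_or_eq)

context
  fixes S assumes S: "pred_closed S"
begin

lemma cnt_self: assumes "pt k i \<in> S" shows "cnt S (pt k i) i = k"
  by (rule cnt_eq) (use assms pred_closed_row[OF S] in \<open>auto simp: pt_less\<close>)

lemma cnt_lower:
  assumes "pt k i \<in> S" "\<alpha> i \<bullet> \<alpha> j \<noteq> 0" "\<eta> j < \<eta> i" shows "cnt S (pt k i) j = Suc k"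
proof (rule cnt_eq)
  have "pt k j \<in> S" using S assms unfolding pred_closed_def by blast
  then show "\<And>l. l < Suc k \<Longrightarrow> pt l j \<in> S" using pred_closed_row[OF S] by auto
qed (use ps_mono[OF assms(3)] in \<open>auto simp: pt_less\<close>)

lemma cnt_upper:
  assumes "pt k i \<in> S" "\<alpha> i \<bullet> \<alpha> j \<noteq> 0" "\<eta> i < \<eta> j" shows "cnt S (pt k i) j = k"
proof (rule cnt_eq)
  show "pt l j \<in> S" if "l < k" for l
  proof -
    have "pt (k - 1) j \<in> S" using S assms that unfolding pred_closed_def by (metis not_gr0 not_less_zero)
    then show ?thesis using pred_closed_row[OF S] that by auto
  qed
qed (use ps_mono[OF assms(3)] in \<open>auto simp: pt_less\<close>)

text \<open>When \<open>pt k i\<close> is read, \<open>i\<close> has been raised \<open>k\<close>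
  times, its lower neighbours \<open>k + 1\<close> times and its upper neighbours \<open>k\<close>
  times, so \<open>i\<close> lies one below all of them.\<close>

lemma sink_hs: assumes "t \<in> S" shows "sink (hs S t) (q t)"
proof -
  define k i where "k = t div CARD('n)" and "i = q t"
  have t: "t = pt k i" by (simp add: k_def i_def pt_q)
  then have ki: "pt k i \<in> S" using assms by simp
  have "hs S t i < hs S t j" if j: "j \<noteq> i" "\<alpha> i \<bullet> \<alpha> j \<noteq> 0" for j
  proof -
    have "\<eta> i = Suc (\<eta> j) \<or> \<eta> j = Suc (\<eta> i)" using height j unfolding height_def by metis
    then show ?thesis
      using cnt_lower[OF ki j(2)] cnt_upper[OF ki j(2)] cnt_self[OF ki] t by (auto simp: hs_cnt)
  qed
  then show ?thesis by (simp add: sink_def i_def)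
qed

lemma height_hs: "height (hs S t)"
  by (induction t) (auto simp: height height_raise sink_hs)

lemma cox_hs: "cox (hs S t) (wi S t x) = wi S t (c x)"
  by (induction t) (auto simp: cox_raise[OF height_hs sink_hs])

lemma wd_cox_hs: "wd S t (cox (hs S t) x) = c (wd S t x)"
  by (metis cox_hs wd_wi wi_wd)

text \<open>A letter other than \<open>j\<close> fixes \<open>weight j\<close>. The letter
  \<open>j\<close> is read at a sink, where its reflection acts on \<open>weight j\<close> like the
  Coxeter element of the current quiver, and \<open>wd_cox_hs\<close> moves that element to the
  front as a factor \<open>c\<close>.\<close>

lemma wd_weight: "wd S t (weight j) = (c ^^ cnt S t j) (weight j)"
proof (induction t)
  case (Suc t)
  show ?case
  proof (cases "t \<in> S \<and> q t = j")
    case True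
    have "wd S t (srefl j (weight j)) = wd S t (cox (hs S t) (weight j))"
      using True cox_sink[OF sink_hs[of t]] by auto
    then show ?thesis using True Suc by (simp add: wd_cox_hs)
  next
    case False
    then show ?thesis using Suc by (auto simp: refl_weight)
  qed
qed simp

lemma wd_weight_self: "pt k i \<in> S \<Longrightarrow> wd S (pt k i) (weight i) = (c ^^ k) (weight i)"
  by (simp add: wd_weight cnt_self)

lemma rt_closed: assumes "pt k i \<in> S" shows "rt S (pt k i) = (c ^^ k) (pr i)"
proof -
  have s: "sink (hs S (pt k i)) i" using sink_hs[OF assms] by simp
  have "\<alpha> i = weight i - cox (hs S (pt k i)) (weight i)" by (simp add: cox_weight proj_sink[OF s])
  then have "rt S (pt k i) = wd S (pt k i) (weight i - cox (hs S (pt k i)) (weight i))" by (simp add: rt_def)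
  also have "\<dots> = (c ^^ k) (weight i) - c ((c ^^ k) (weight i))"
    by (simp add: linear_diff[OF linear_wd] wd_cox_hs wd_weight_self[OF assms])
  also have "\<dots> = (c ^^ k) (weight i - c (weight i))"
    by (simp add: linear_diff[OF linear_cpow] funpow_swap1)
  finally show ?thesis by (simp add: cox_weight)
qed

lemma wd_rank: assumes "{..<CARD('n)} \<subseteq> S" shows "wd S CARD('n) x = c x"
proof (rule linear_eq_weight[OF linear_wd linear_cox])
  fix i
  have "cnt S CARD('n) i = 1"
  proof (rule cnt_eq)
    show "pt l i < CARD('n) \<longleftrightarrow> l < 1" for l using less_rank_iff[of "pt l i"] by simp
    then show "pt l i \<in> S" if "l < 1" for l using assms that by blast
  qed
  then show "wd S CARD('n) (weight i) = c (weight i)" by (simp add: wd_weight)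
qed

end

section \<open>Translation orbits of the projectives and the set of objects\<close>

lemma pt_lessThan: "pt k i \<in> {..<CARD('n)} \<longleftrightarrow> k = 0"
  using less_rank_iff[of "pt k i"] by simp

lemma pred_closed_initial: "pred_closed {..<CARD('n)}"
  unfolding pred_closed_def pt_lessThan by auto

lemma proj_pos: "pr i \<in> pos"
proof -
  have "pt 0 i \<in> {..<CARD('n)}" by (simp only: pt_lessThan)
  from rt_closed[OF pred_closed_initial this] have "pr i \<in> \<Phi>" by (metis funpow_0 rt_root)
  then show ?thesis by (simp add: pos_def proj_weight_nonneg)
qed

lemma proj_eq_iff [simp]: "pr i = pr j \<longleftrightarrow> i = j"
proof
  assume "pr i = pr j"
  then have "weight i \<bullet> \<alpha> i = weight j \<bullet> \<alpha> i" by (metis euler_proj)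
  then show "i = j" by (simp add: weight_simple split: if_splits)
qed simp

text \<open>The inverse of \<open>c\<close> written as a product of reflections, so that its effect
  on signs can be followed letter by letter.\<close>

definition ci :: "real^'n \<Rightarrow> real^'n" where "ci = wi {..<CARD('n)} CARD('n)"

lemma wd_init: "wd {..<CARD('n)} CARD('n) x = c x"
  using wd_rank[OF pred_closed_initial] by simp

lemma c_ci [simp]: "c (ci x) = x" and ci_c [simp]: "ci (c x) = x"
  by (metis ci_def wd_init wd_wi) (metis ci_def wd_init wi_wd)

lemma linear_ci: "linear ci" unfolding ci_def by (rule linear_wi)

lemma c_root [simp]: "c x \<in> \<Phi> \<longleftrightarrow> x \<in> \<Phi>" by (metis wd_init wd_root)
lemma ci_root [simp]: "ci x \<in> \<Phi> \<longleftrightarrow> x \<in> \<Phi>" by (metis c_ci c_root)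
lemma cpow_root [simp]: "(c ^^ k) x \<in> \<Phi> \<longleftrightarrow> x \<in> \<Phi>" by (induction k) auto

lemma c_eq_iff [simp]: "c x = c y \<longleftrightarrow> x = y" by (metis ci_c)

lemma cpow_eq_iff [simp]: "(c ^^ k) x = (c ^^ k) y \<longleftrightarrow> x = y" by (induction k) auto

lemma ci_minus [simp]: "ci (- x) = - ci x" using linear_neg[OF linear_ci] .

lemma c_adjoint: "c x \<bullet> y = x \<bullet> ci y" by (metis c_ci cox_inner height)

lemma rt_init: assumes "t < CARD('n)" shows "rt {..<CARD('n)} t = pr (q t)"
proof -
  have t: "t = pt 0 (q t)" using pt_q[of t] assms by (simp add: less_rank_iff)
  have "pt 0 (q t) \<in> {..<CARD('n)}" by (simp only: pt_lessThan)
  from rt_closed[OF pred_closed_initial this] show ?thesis using t by simp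
qed

text \<open>The roots crossed in one period are the \<open>pr i\<close>, so only these become
  negative; homologically, only projectives have no translate.\<close>

lemma ci_pos: assumes "\<gamma> \<in> pos" "\<And>i. \<gamma> \<noteq> pr i" shows "ci \<gamma> \<in> pos"
  unfolding ci_def
proof (rule wi_pos_uncrossed[OF assms(1)])
  fix t assume "t < CARD('n)" "t \<in> {..<CARD('n)}"
  then show "rt {..<CARD('n)} t \<noteq> \<gamma> \<and> rt {..<CARD('n)} t \<noteq> - \<gamma>"
    using rt_init[of t] assms proj_pos[of "q t"] pos_not_neg[OF assms(1)] by metis
qed

lemma ci_proj: "- ci (pr i) \<in> pos"
  unfolding ci_def
proof (rule wi_neg_crossed_once[OF proj_pos, of "ps i"])
  show "rt {..<CARD('n)} (ps i) = pr i" using rt_init[OF ps_less] by simp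
  fix t assume t: "t < CARD('n)" "t \<in> {..<CARD('n)}" "t \<noteq> ps i"
  then have "q t \<noteq> i" using ps_q by auto
  then show "rt {..<CARD('n)} t \<noteq> pr i \<and> rt {..<CARD('n)} t \<noteq> - pr i"
    using rt_init[OF t(1)] proj_pos pos_not_neg by (metis proj_eq_iff)
qed (use ps_less in auto)

lemma not_pos_c: assumes "\<gamma> \<in> pos" "c \<gamma> \<notin> pos" obtains i where "c \<gamma> = - pr i"
proof -
  have "- c \<gamma> \<in> pos" using assms pos_or_neg[of "c \<gamma>"] by (simp add: pos_root)
  moreover have "ci (- c \<gamma>) \<notin> pos" using pos_not_neg[OF assms(1)] by simp
  ultimately obtain i where "- c \<gamma> = pr i" using ci_pos by blast
  then show thesis using that by (metis minus_minus)
qed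

text \<open>Every indecomposable is preprojective: translate until positivity is lost, which happens
  by \<open>exists_not_pos\<close>; the last positive root is a projective one by
  \<open>ci_pos\<close>.\<close>

lemma pos_orbit:
  assumes "\<gamma> \<in> pos"
  obtains k i where "\<gamma> = (c ^^ k) (pr i)" "\<And>l. l \<le> k \<Longrightarrow> (c ^^ l) (pr i) \<in> pos"
proof -
  have "x = 0" if "ci x = x" for x using that cox_fixed[of \<eta> x] by (metis c_ci)
  from exists_not_pos[OF linear_ci this _ pos_root[OF assms]]
  have ex: "\<exists>n. (ci ^^ n) \<gamma> \<notin> pos" by simp
  define n where "n = (LEAST n. (ci ^^ n) \<gamma> \<notin> pos)"
  have n: "(ci ^^ n) \<gamma> \<notin> pos" and lt: "(ci ^^ l) \<gamma> \<in> pos" if "l < n" for l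
    using LeastI_ex[OF ex] not_less_Least that unfolding n_def by blast+
  have n: "(ci ^^ n) \<gamma> \<notin> pos" using LeastI_ex[OF ex] unfolding n_def .
  then obtain k where k: "n = Suc k" using assms by (cases n) auto
  have "ci ((ci ^^ k) \<gamma>) \<notin> pos" "(ci ^^ k) \<gamma> \<in> pos" using n lt[of k] k by auto
  then obtain i where i: "(ci ^^ k) \<gamma> = pr i" using ci_pos by blast
  have p: "(c ^^ l) (pr i) = (ci ^^ (k - l)) \<gamma>" if "l \<le> k" for l
    using that
  proof (induction l)
    case (Suc l)
    then have "k - l = Suc (k - Suc l)" by simp
    then show ?case using Suc by simp
  qed (simp add: i)
  show thesis
  proof
    show "\<gamma> = (c ^^ k) (pr i)" using p[of k] by simp
    show "(c ^^ l) (pr i) \<in> pos" if "l \<le> k" for l using p[OF that] lt[of "k - l"] k by simp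
  qed
qed

text \<open>
  Positions are numbered from 0: \<open>pt k i\<close> stands for the object \<open>(k + 1, i)\<close>, so that the positions
  below the rank are the shifted projectives.
\<close>

definition Ob :: "nat set" where
  "Ob = {t. \<forall>l < t div CARD('n). (c ^^ l) (pr (q t)) \<in> pos}"

lemma pt_Ob: "pt k i \<in> Ob \<longleftrightarrow> (\<forall>l<k. (c ^^ l) (pr i) \<in> pos)" by (simp add: Ob_def)

text \<open>At its first exit from the positive roots an orbit hits the negative of a projective
  root. This makes its Euler pairings computable by \<open>euler_proj\<close>.\<close>

lemma cpow_not_pos:
  assumes "\<not> (\<forall>l<k. (c ^^ l) (pr j) \<in> pos)"
  obtains l x where "l < k" "0 < l" "(c ^^ l) (pr j) = - pr x"
proof -
  define l where "l = (LEAST l. (c ^^ l) (pr j) \<notin> pos)"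
  have ex: "\<exists>l. (c ^^ l) (pr j) \<notin> pos" using assms by blast
  have l: "(c ^^ l) (pr j) \<notin> pos" using LeastI_ex[OF ex] unfolding l_def .
  have "l < k" unfolding l_def using assms by (meson Least_le le_less_trans)
  obtain l' where l': "l = Suc l'" using l proj_pos by (cases l) auto
  have "(c ^^ l') (pr j) \<in> pos" using not_less_Least[of l' "\<lambda>l. (c ^^ l) (pr j) \<notin> pos"] l' l_def by auto
  moreover have "c ((c ^^ l') (pr j)) \<notin> pos" using l l' by simp
  ultimately obtain x where "c ((c ^^ l') (pr j)) = - pr x" by (rule not_pos_c)
  then show thesis using that[of l x] \<open>l < k\<close> l' by simp
qed

lemma euler_cpow: "euler \<eta> ((c ^^ l) x) ((c ^^ l) y) = euler \<eta> x y"
  by (induction l) (simp_all add: euler_cox[OF height])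

text \<open>If the neighbouring row had ended too early, one of its roots would be
  \<open>- pr x\<close> while the row of \<open>i\<close> is still positive there. Since
  \<open>c\<close> preserves the Euler form, a coefficient of \<open>pr i\<close> or
  \<open>c (pr i)\<close> at \<open>j\<close> would be nonpositive, against
  \<open>proj_weight_pos\<close> or \<open>cox_proj_weight_pos\<close>.\<close>

lemma pred_closed_Ob: "pred_closed Ob"
  unfolding pred_closed_def
proof (intro allI impI conjI)
  fix k i assume ki: "pt k i \<in> Ob"
  show "pt l i \<in> Ob" if "l < k" for l using ki that by (auto simp: pt_Ob)
  show "pt k j \<in> Ob" if j: "\<alpha> i \<bullet> \<alpha> j \<noteq> 0 \<and> \<eta> j < \<eta> i" for j
  proof (rule ccontr)
    assume "pt k j \<notin> Ob"
    then have "\<not> (\<forall>l<k. (c ^^ l) (pr j) \<in> pos)" by (simp add: pt_Ob)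
    then obtain l x where l: "l < k" "0 < l" "(c ^^ l) (pr j) = - pr x" by (rule cpow_not_pos)
    have "euler \<eta> ((c ^^ l) (pr i)) ((c ^^ l) (pr j)) = weight j \<bullet> pr i" by (simp add: euler_cpow euler_proj)
    then have "weight j \<bullet> pr i = - (weight x \<bullet> (c ^^ l) (pr i))" by (simp add: l(3) euler_neg euler_proj)
    also have "\<dots> \<le> 0" using ki l(1) by (simp add: pt_Ob pos_weight)
    finally show False using proj_weight_pos[of \<eta> j i] j by (simp add: inner_commute)
  qed
  show "pt (k - 1) j \<in> Ob" if j: "\<alpha> i \<bullet> \<alpha> j \<noteq> 0 \<and> \<eta> i < \<eta> j \<and> 0 < k" for j
  proof (rule ccontr)
    assume "pt (k - 1) j \<notin> Ob"
    then have "\<not> (\<forall>l<k - 1. (c ^^ l) (pr j) \<in> pos)" by (simp add: pt_Ob)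
    then obtain l x where l: "l < k - 1" "0 < l" "(c ^^ l) (pr j) = - pr x" by (rule cpow_not_pos)
    have "euler \<eta> ((c ^^ l) (c (pr i))) ((c ^^ l) (pr j)) = weight j \<bullet> c (pr i)"
      by (simp add: euler_cpow euler_proj)
    then have "weight j \<bullet> c (pr i) = - (weight x \<bullet> (c ^^ Suc l) (pr i))"
      by (simp add: l(3) euler_neg euler_proj funpow_swap1)
    also have "\<dots> \<le> 0" using ki l(1) by (simp add: pt_Ob pos_weight del: funpow.simps)
    finally show False using cox_proj_weight_pos[OF height, of i j] j by (simp add: inner_commute)
  qed
qed

lemma initial_Ob: "{..<CARD('n)} \<subseteq> Ob" by (auto simp: Ob_def less_rank_iff)

text \<open>
  The root of the representation at position \<open>t\<close>; meaningless for the shifted projectives, where the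
  subtraction is truncated.
\<close>

definition oroot :: "nat \<Rightarrow> real^'n" where
  "oroot t = (c ^^ (t div CARD('n) - 1)) (pr (q t))"

text \<open>With \<open>oroot_image\<close> this is Gabriel's theorem on the level of roots. If two
  orbits met, cancelling powers of \<open>c\<close> would put a projective root at a later place of
  a positive orbit, and its image under \<open>ci\<close> would be positive, against
  \<open>ci_proj\<close>.\<close>

lemma oroot_inj: "inj_on oroot {t \<in> Ob. CARD('n) \<le> t}"
proof -
  have key: "k = k' \<and> i = i'"
    if "(c ^^ k) (pr i) = (c ^^ k') (pr i')" "k \<le> k'" "\<And>l. l \<le> k' \<Longrightarrow> (c ^^ l) (pr i') \<in> pos" for k k' i i'
  proof -
    have "(c ^^ k) (pr i) = (c ^^ k) ((c ^^ (k' - k)) (pr i'))"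
      using that(1,2) by (metis comp_apply funpow_add le_add_diff_inverse)
    then have e: "pr i = (c ^^ (k' - k)) (pr i')" by simp
    show ?thesis
    proof (cases "k' - k")
      case 0 then show ?thesis using e that(2) by simp
    next
      case (Suc n)
      then have "ci (pr i) = (c ^^ n) (pr i')" using e by simp
      then have "ci (pr i) \<in> pos" using that(3)[of n] Suc by simp
      then show ?thesis using ci_proj pos_not_neg by metis
    qed
  qed
  show ?thesis
  proof (rule inj_onI)
    fix s t assume s: "s \<in> {t \<in> Ob. CARD('n) \<le> t}" and t: "t \<in> {t \<in> Ob. CARD('n) \<le> t}" and e: "oroot s = oroot t"
    have d: "0 < s div CARD('n)" "0 < t div CARD('n)" using s t by (auto simp: div_greater_zero_iff)
    have po: "(c ^^ l) (pr (q s)) \<in> pos" if "l \<le> s div CARD('n) - 1" for l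
      using s d that by (auto simp: Ob_def)
    have po': "(c ^^ l) (pr (q t)) \<in> pos" if "l \<le> t div CARD('n) - 1" for l
      using t d that by (auto simp: Ob_def)
    have "s div CARD('n) - 1 = t div CARD('n) - 1 \<and> q s = q t"
      using key[OF e[unfolded oroot_def] _ po'] key[OF e[unfolded oroot_def, symmetric] _ po] by (metis nat_le_linear)
    then have "s div CARD('n) = t div CARD('n)" "q s = q t" using d by auto
    then show "s = t" by (metis pt_q)
  qed
qed

lemma oroot_image: "oroot ` {t \<in> Ob. CARD('n) \<le> t} = pos"
proof (intro set_eqI iffI)
  fix \<gamma> assume "\<gamma> \<in> oroot ` {t \<in> Ob. CARD('n) \<le> t}"
  then show "\<gamma> \<in> pos" by (auto simp: oroot_def Ob_def div_greater_zero_iff)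
next
  fix \<gamma> assume "\<gamma> \<in> pos"
  then obtain k i where ki: "\<gamma> = (c ^^ k) (pr i)" "\<And>l. l \<le> k \<Longrightarrow> (c ^^ l) (pr i) \<in> pos" by (rule pos_orbit) blast
  have "pt (Suc k) i \<in> Ob" using ki(2) by (simp add: pt_Ob)
  moreover have "\<not> pt (Suc k) i < CARD('n)" using pt_lessThan[of "Suc k" i] by simp
  moreover have "oroot (pt (Suc k) i) = \<gamma>" by (simp add: oroot_def ki)
  ultimately show "\<gamma> \<in> oroot ` {t \<in> Ob. CARD('n) \<le> t}" by (metis (mono_tags, lifting) imageI linorder_not_less mem_Collect_eq)
qed

lemma oroot_bij: "bij_betw oroot {t \<in> Ob. CARD('n) \<le> t} pos"
  using oroot_inj oroot_image by (simp add: bij_betw_def)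

lemma finite_Ob: "finite Ob"
proof -
  have "finite {t \<in> Ob. CARD('n) \<le> t}" using oroot_bij finite_pos bij_betw_finite by blast
  moreover have "Ob \<subseteq> {..<CARD('n)} \<union> {t \<in> Ob. CARD('n) \<le> t}" by auto
  ultimately show ?thesis by (meson finite_Un finite_lessThan finite_subset)
qed

end

lemma reflection_reflection [simp]: "reflection a (reflection a x) = x"
  by (cases "a = 0") (simp_all add: reflection_def inner_diff_left)

lemma reflection_uminus: "reflection (- a) x = reflection a x"
  by (simp add: reflection_def)

lemma reflection_orthogonal: "x \<bullet> a = 0 \<Longrightarrow> reflection a x = x"
  by (simp add: reflection_def)

context root_basis
begin

text \<open>Such a \<open>z\<close> is a nonnegative combination of the other simple roots.\<close>

lemma inner_simple_nonpos:
  assumes "z \<in> pos" "weight i \<bullet> z = 0" shows "z \<bullet> \<alpha> i \<le> 0"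
proof -
  have "z \<bullet> \<alpha> i = (\<Sum>j\<in>UNIV. ((weight j \<bullet> z) / hsq j) *\<^sub>R \<alpha> j) \<bullet> \<alpha> i"
    using simple_expand[of z] by simp
  also have "\<dots> = (\<Sum>j\<in>UNIV. (weight j \<bullet> z) / hsq j * (\<alpha> j \<bullet> \<alpha> i))" by (simp add: inner_sum_left)
  also have "\<dots> \<le> 0"
  proof (rule sum_nonpos)
    fix j show "(weight j \<bullet> z) / hsq j * (\<alpha> j \<bullet> \<alpha> i) \<le> 0"
      using assms simple_inner_le[of j i] pos_weight[OF assms(1), of j] hsq_pos[of j]
      by (cases "j = i") (auto intro!: divide_nonpos_pos mult_nonneg_nonpos)
  qed
  finally show ?thesis .
qed

end

context coxeter_word
begin

lemma wd_srefl: "wd S t (srefl i x) = reflection (wd S t (\<alpha> i)) (wd S t x)"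
  by (simp add: refl_reflection reflection_def linear_diff[OF linear_wd] linear_scale[OF linear_wd])

section \<open>The subword complex of the word of objects\<close>

definition ltop :: nat where "ltop = Suc (Max Ob)"

lemma Ob_top: "t \<in> Ob \<Longrightarrow> t < ltop"
  using Max_ge[OF finite_Ob] by (simp add: ltop_def less_Suc_eq_le)

lemma rank_top: "CARD('n) \<le> ltop"
proof -
  have "CARD('n) - 1 \<in> Ob" using initial_Ob by (auto simp: subset_iff)
  then show ?thesis using Ob_top by fastforce
qed

text \<open>The positions of \<open>F\<close> are skipped in the word, but they still carry roots
  \<open>r F\<close>: the images of their letters under the prefix read so far.\<close>

abbreviation "U F \<equiv> wd (Ob - F)"
abbreviation "Ui F \<equiv> wi (Ob - F)"
abbreviation "r F \<equiv> rt (Ob - F)"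

definition gv :: "nat \<Rightarrow> real^'n" where "gv t = (c ^^ (t div CARD('n))) (weight (q t))"

lemma wd_gv: assumes "t \<in> Ob" shows "wd Ob t (weight (q t)) = gv t"
  using wd_weight_self[OF pred_closed_Ob, of "t div CARD('n)" "q t"] assms by (simp add: pt_q gv_def)

lemma rt_Ob: assumes "t \<in> Ob" shows "rt Ob t = (c ^^ (t div CARD('n))) (pr (q t))"
  using rt_closed[OF pred_closed_Ob, of "t div CARD('n)" "q t"] assms by (simp add: pt_q)

lemma gv_inner_rt: "t \<in> Ob \<Longrightarrow> gv t \<bullet> rt Ob t = hsq (q t)"
  by (simp add: wd_gv[symmetric] rt_def weight_simple)

lemma gv_init: "t < CARD('n) \<Longrightarrow> gv t = weight (q t)"
  by (simp add: gv_def less_rank_iff)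

lemma U_F0_init: "t \<le> CARD('n) \<Longrightarrow> U {..<CARD('n)} t x = x"
  by (induction t arbitrary: x) auto

text \<open>The first period contributes the factor \<open>c\<close>, after which both words read
  the same letters.\<close>

lemma wd_Ob_eq: assumes "CARD('n) \<le> t" shows "wd Ob t x = c (U {..<CARD('n)} t x)"
  using assms
proof (induction t arbitrary: x rule: dec_induct)
  case base then show ?case using wd_rank[OF pred_closed_Ob initial_Ob] by (simp add: U_F0_init)
qed auto

lemma wi_Ob_eq: assumes "CARD('n) \<le> t" shows "wi Ob t (c x) = Ui {..<CARD('n)} t x"
  by (metis assms wd_Ob_eq wd_wi wi_wd)

lemma r_F0: assumes "t \<in> Ob" "CARD('n) \<le> t" shows "r {..<CARD('n)} t = oroot t"
proof -
  have "t div CARD('n) \<noteq> 0" using assms(2) less_rank_iff[of t] by auto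
  then obtain k where k: "t div CARD('n) = Suc k" using not0_implies_Suc by blast
  have "c (r {..<CARD('n)} t) = rt Ob t" by (simp add: rt_def wd_Ob_eq[OF assms(2)])
  then show ?thesis by (simp add: rt_Ob[OF assms(1)] k oroot_def)
qed

lemma c_oroot: assumes "t \<in> Ob" "CARD('n) \<le> t" shows "c (oroot t) = rt Ob t"
  by (metis assms r_F0 rt_def wd_Ob_eq)

lemma oroot_gv: assumes "CARD('n) \<le> t" shows "oroot t = ci (gv t) - gv t"
proof -
  have "t div CARD('n) \<noteq> 0" using assms less_rank_iff[of t] by auto
  then obtain k where k: "t div CARD('n) = Suc k" using not0_implies_Suc by blast
  have p: "pr (q t) = weight (q t) - c (weight (q t))" by (simp add: cox_weight)
  have "oroot t = (c ^^ k) (weight (q t)) - (c ^^ k) (c (weight (q t)))"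
    unfolding oroot_def k p by (simp add: linear_diff[OF linear_cpow])
  also have "(c ^^ k) (c (weight (q t))) = gv t" by (simp add: gv_def k funpow_swap1)
  also have "(c ^^ k) (weight (q t)) = ci (gv t)" by (simp add: gv_def k)
  finally show ?thesis .
qed

lemma oroot_pos: "t \<in> Ob \<Longrightarrow> CARD('n) \<le> t \<Longrightarrow> oroot t \<in> pos"
  using oroot_image by blast

text \<open>By \<open>oroot_inj\<close> the root is crossed at \<open>s\<close> and at no other
  position of the word without its first period. Since every positive root is some
  \<open>oroot s\<close>, that word makes all of them negative.\<close>

lemma Ui_F0_neg:
  assumes "s \<in> Ob" "CARD('n) \<le> s" "s < t" shows "- Ui {..<CARD('n)} t (oroot s) \<in> pos"
proof (rule wi_neg_crossed_once[OF oroot_pos[OF assms(1,2)] assms(3)])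
  show "s \<in> Ob - {..<CARD('n)}" "r {..<CARD('n)} s = oroot s" using assms r_F0 by auto
  fix t' assume t': "t' < t" "t' \<in> Ob - {..<CARD('n)}" "t' \<noteq> s"
  then have "r {..<CARD('n)} t' = oroot t'" using r_F0 by auto
  moreover have "oroot t' \<noteq> oroot s" using oroot_inj t' assms unfolding inj_on_def by auto
  moreover have "oroot t' \<noteq> - oroot s" using oroot_pos[of t'] oroot_pos[OF assms(1,2)] t' pos_not_neg by force
  ultimately show "r {..<CARD('n)} t' \<noteq> oroot s \<and> r {..<CARD('n)} t' \<noteq> - oroot s" by simp
qed

text \<open>
  Facets of the subword complex of the word of all objects: positions whose deletion leaves a
  word for the longest element.
\<close>

definition facet :: "nat set \<Rightarrow> bool" where
  "facet F \<longleftrightarrow> F \<subseteq> Ob \<and> card F = CARD('n) \<and> (\<forall>x. U F ltop x = U {..<CARD('n)} ltop x)"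

lemma facet_F0: "facet {..<CARD('n)}" by (simp add: facet_def initial_Ob)

lemma facet_Ob: "facet F \<Longrightarrow> F \<subseteq> Ob" by (simp add: facet_def)

lemma facet_finite: "facet F \<Longrightarrow> finite F" using finite_Ob finite_subset facet_Ob by blast

lemma finite_facets: "finite {F. facet F}"
  by (rule finite_subset[of _ "Pow Ob"]) (use facet_Ob finite_Ob in auto)

lemma facet_Ui: assumes "facet F" shows "Ui F ltop x = Ui {..<CARD('n)} ltop x"
  using assms unfolding facet_def by (metis wd_wi wi_wd)

text \<open>The whole word makes every positive root negative, so each of them is crossed. As many
  letters remain as there are positive roots, so none is crossed twice and no letter has a negative
  root.\<close>

lemma facet_roots: assumes "facet F" shows "bij_betw (r F) (Ob - F) pos"
proof -
  have sub: "pos \<subseteq> r F ` (Ob - F)"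
  proof
    fix \<gamma> assume g: "\<gamma> \<in> pos"
    then have "\<gamma> \<in> oroot ` {t \<in> Ob. CARD('n) \<le> t}" by (simp only: oroot_image)
    then obtain s where s: "s \<in> Ob" "CARD('n) \<le> s" "oroot s = \<gamma>" by auto
    have "- Ui F ltop \<gamma> \<in> pos"
      using Ui_F0_neg[OF s(1,2) Ob_top[OF s(1)]] s(3) facet_Ui[OF assms] by simp
    then have "Ui F ltop \<gamma> \<notin> pos" using pos_not_neg by force
    from exists_crossing[OF g this] show "\<gamma> \<in> r F ` (Ob - F)" by blast
  qed
  have fin: "finite (Ob - F)" using finite_Ob by simp
  have "card (Ob - F) = card Ob - CARD('n)"
    using assms facet_finite[OF assms] by (simp add: facet_def card_Diff_subset)
  also have "\<dots> = card (Ob - {..<CARD('n)})" using initial_Ob by (simp add: card_Diff_subset)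
  also have "Ob - {..<CARD('n)} = {t \<in> Ob. CARD('n) \<le> t}" by auto
  also have "card \<dots> = card pos" using oroot_bij by (rule bij_betw_same_card)
  finally have cd: "card (Ob - F) = card pos" .
  have le: "card (r F ` (Ob - F)) \<le> card pos" using card_image_le[OF fin, of "r F"] cd by simp
  have eq: "pos = r F ` (Ob - F)" using card_seteq[OF finite_imageI[OF fin] sub le] .
  moreover have "inj_on (r F) (Ob - F)" using eq_card_imp_inj_on[OF fin, of "r F"] eq cd by metis
  ultimately show ?thesis by (simp add: bij_betw_def)
qed

lemma facet_r_pos: "facet F \<Longrightarrow> p \<in> Ob - F \<Longrightarrow> r F p \<in> pos"
  using facet_roots by (metis bij_betwE)

lemma facet_r_distinct:
  assumes "facet F" "p \<in> Ob - F" "t \<in> Ob - F" "t \<noteq> p" shows "r F t \<noteq> r F p \<and> r F t \<noteq> - r F p"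
proof
  show "r F t \<noteq> r F p" using facet_roots[OF assms(1)] assms unfolding bij_betw_def inj_on_def by blast
  show "r F t \<noteq> - r F p" using facet_r_pos[OF assms(1)] assms(2,3) pos_not_neg by force
qed

lemma Ui_pos: assumes "facet F" "p \<in> Ob - F" "t \<le> p" shows "Ui F t (r F p) \<in> pos"
  by (rule wi_pos_uncrossed) (use assms facet_r_pos facet_r_distinct in auto)

lemma Ui_neg: assumes "facet F" "p \<in> Ob - F" "p < t" shows "- Ui F t (r F p) \<in> pos"
  by (rule wi_neg_crossed_once[OF facet_r_pos[OF assms(1,2)] assms(3)])
     (use assms facet_r_distinct in auto)

text \<open>
  Removing \<open>a\<close> from a facet \<open>F\<close> leaves room for exactly one other position, \<open>star F a\<close>: the one
  outside \<open>F\<close> whose root agrees with that of \<open>a\<close> up to sign.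
\<close>

definition absr :: "nat set \<Rightarrow> nat \<Rightarrow> real^'n" where
  "absr F a = (if r F a \<in> pos then r F a else - r F a)"

definition star :: "nat set \<Rightarrow> nat \<Rightarrow> nat" where
  "star F a = inv_into (Ob - F) (r F) (absr F a)"

lemma absr_pos: "absr F a \<in> pos"
  using not_pos_iff[of "r F a"] by (auto simp: absr_def)

lemma reflection_absr: "reflection (absr F a) x = reflection (r F a) x"
  by (simp add: absr_def reflection_uminus)

lemma star: assumes "facet F" shows "star F a \<in> Ob - F" and r_star: "r F (star F a) = absr F a"
proof -
  have "absr F a \<in> r F ` (Ob - F)" using facet_roots[OF assms] absr_pos by (metis bij_betw_imp_surj_on)
  then show "star F a \<in> Ob - F" "r F (star F a) = absr F a"
    unfolding star_def by (rule inv_into_into, rule f_inv_into_f)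
qed

lemma star_unique: assumes "facet F" "p \<in> Ob - F" "r F p = absr F a" shows "star F a = p"
  using facet_r_distinct[OF assms(1,2) star(1)[OF assms(1)], of a] r_star[OF assms(1), of a] assms(3) by metis

text \<open>At position \<open>a\<close> the root of \<open>a\<close> is moved to a simple root. The
  root of \<open>star F a\<close> is the same up to sign, and its image there is still positive if
  \<open>star F a\<close> comes later and already negative if it came earlier.\<close>

lemma less_star_iff: assumes "facet F" "a \<in> F" shows "a < star F a \<longleftrightarrow> r F a \<in> pos"
proof
  assume "r F a \<in> pos"
  then have e: "r F (star F a) = r F a" using r_star[OF assms(1)] by (simp add: absr_def)
  show "a < star F a"
  proof (rule ccontr)
    assume "\<not> a < star F a"
    moreover have "star F a \<noteq> a" using star(1)[OF assms(1), of a] assms(2) by auto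
    ultimately have "- Ui F a (r F (star F a)) \<in> pos" using Ui_neg[OF assms(1) star(1)[OF assms(1)]] by auto
    then have "- \<alpha> (q a) \<in> pos" by (simp add: e)
    then show False using simple_pos pos_not_neg by metis
  qed
next
  assume "a < star F a"
  then have p: "Ui F a (r F (star F a)) \<in> pos" using Ui_pos[OF assms(1) star(1)[OF assms(1)]] by auto
  show "r F a \<in> pos"
  proof (rule ccontr)
    assume "r F a \<notin> pos"
    then have "r F (star F a) = - r F a" using r_star[OF assms(1)] by (simp add: absr_def)
    then have "- \<alpha> (q a) \<in> pos" using p by simp
    then show False using simple_pos pos_not_neg by metis
  qed
qed

subsection \<open>Duality between roots and g-vectors of a facet\<close>

text \<open>Compares the full word with the word that skips \<open>F\<close>. By
  \<open>A_Suc\<close> it is the product of the reflections in the facet roots before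
  \<open>t\<close>, in the order of positions; the complete product is the Coxeter element
  (\<open>A_top\<close>).\<close>

definition A :: "nat set \<Rightarrow> nat \<Rightarrow> real^'n \<Rightarrow> real^'n" where
  "A F t x = wd Ob t (Ui F t x)"

lemma A_inner [simp]: "A F t x \<bullet> A F t y = x \<bullet> y" by (simp add: A_def)

lemma A_Suc: assumes "F \<subseteq> Ob" shows "A F (Suc t) x = (if t \<in> F then A F t (reflection (r F t) x) else A F t x)"
proof -
  have "A F t (reflection (r F t) x) = wd Ob t (srefl (q t) (Ui F t x))" if "t \<in> F"
  proof -
    have "reflection (r F t) x = U F t (srefl (q t) (Ui F t x))" by (simp add: wd_srefl rt_def)
    then show ?thesis by (simp add: A_def)
  qed
  then show ?thesis using assms by (auto simp: A_def)
qed

lemma A_stable: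
  assumes "F \<subseteq> Ob" "s \<le> t" "\<And>p. p \<in> F \<Longrightarrow> s \<le> p \<Longrightarrow> p < t \<Longrightarrow> x \<bullet> r F p = 0"
  shows "A F t x = A F s x"
  using assms(2,3)
proof (induction t rule: dec_induct)
  case (step t)
  then show ?case by (auto simp: A_Suc[OF assms(1)] reflection_orthogonal)
qed simp

lemma A_0 [simp]: "A F 0 x = x" by (simp add: A_def)

lemma A_top: assumes "facet F" shows "A F ltop x = c x"
  by (simp add: A_def facet_Ui[OF assms] wd_Ob_eq[OF rank_top])

text \<open>A vector orthogonal to all facet roots is fixed by their reflections, hence by
  \<open>c\<close>, which has no eigenvalue 1. So the facet roots span the space.\<close>

lemma facet_orthogonal_0: assumes "facet F" "\<And>k. k \<in> F \<Longrightarrow> x \<bullet> r F k = 0" shows "x = 0"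
proof -
  have "A F ltop x = A F 0 x" by (rule A_stable) (use assms facet_Ob in auto)
  then show ?thesis using A_top[OF assms(1)] cox_fixed by simp
qed

text \<open>A nonzero \<open>x\<close> orthogonal to the facet roots other than that of
  \<open>l\<close> exists by dimension. Of the factorization of \<open>c\<close> only the reflection
  at \<open>l\<close> acts on it, and this forces \<open>x\<close> to be a multiple of the vector in
  question.\<close>

lemma U_weight_orthogonal:
  assumes F: "facet F" and l: "l \<in> F" and k: "k \<in> F" "k \<noteq> l"
  shows "U F l (weight (q l)) \<bullet> r F k = 0"
proof -
  have "dim (r F ` (F - {l})) \<le> card (F - {l})"
    by (meson card_image_le dim_le_card' facet_finite[OF F] finite_Diff finite_imageI le_trans)
  also have "\<dots> < CARD('n)"
    using F l facet_finite[OF F] by (simp add: facet_def card_gt_0_iff)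
  finally have "dim (span (r F ` (F - {l}))) < DIM(real^'n)" by simp
  then obtain x where x: "x \<noteq> 0" "\<And>y. y \<in> span (span (r F ` (F - {l}))) \<Longrightarrow> orthogonal x y"
    using orthogonal_to_subspace_exists by metis
  have xo: "x \<bullet> r F p = 0" if "p \<in> F" "p \<noteq> l" for p
    using x(2)[of "r F p"] that by (simp add: orthogonal_def span_base)
  have lO: "l \<in> Ob" using F l facet_Ob by blast
  define z where "z = Ui F l x"
  have Al: "A F l x = x" using A_stable[OF facet_Ob[OF F], of 0 l x] xo by auto
  have "c x = A F ltop x" using A_top[OF F] by simp
  also have "\<dots> = A F (Suc l) x"
    by (rule A_stable[OF facet_Ob[OF F]]) (use xo Ob_top[OF lO] in auto)
  also have "\<dots> = A F l (reflection (r F l) x)" using l by (simp add: A_Suc[OF facet_Ob[OF F]])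
  also have "reflection (r F l) x = U F l (srefl (q l) z)" by (simp add: wd_srefl rt_def z_def)
  also have "A F l \<dots> = wd Ob l (srefl (q l) z)" by (simp add: A_def)
  finally have cx: "wi Ob l (c x) = srefl (q l) z" by simp
  have "wi Ob l x = z" using Al by (metis A_def wi_wd z_def)
  \<comment> \<open>\<open>cox_hs\<close> carries the equation to the quiver at position
    \<open>l\<close>, where the letter \<open>q l\<close> is a sink, so that
    \<open>sink_cox_fixed\<close> applies.\<close>
  then have "cox (hs Ob l) z = srefl (q l) z" using cox_hs[OF pred_closed_Ob, of l x] cx by simp
  then have "srefl (q l) (cox (hs Ob l) z) = z" by simp
  from sink_cox_fixed[OF sink_hs[OF pred_closed_Ob lO] this]
  obtain \<mu> where \<mu>: "z = \<mu> *\<^sub>R weight (q l)" by blast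
  have xz: "x = \<mu> *\<^sub>R U F l (weight (q l))"
    using \<mu> by (metis linear_scale linear_wd wd_wi z_def)
  then have "\<mu> \<noteq> 0" using x(1) by auto
  then show ?thesis using xo[OF k] xz by simp
qed

text \<open>By orthogonality \<open>A F l\<close> fixes the left side, while it maps that vector to
  the one computed with the full word. Hence the dual basis vector at \<open>l\<close> depends on
  the position only and not on the facet.\<close>

lemma U_weight: assumes F: "facet F" and l: "l \<in> F" shows "U F l (weight (q l)) = gv l"
proof -
  have "gv l = A F l (U F l (weight (q l)))" using l facet_Ob[OF F] wd_gv[of l] by (auto simp: A_def)
  also have "\<dots> = A F 0 (U F l (weight (q l)))"
    by (rule A_stable[OF facet_Ob[OF F]]) (use U_weight_orthogonal[OF F l] in auto)
  finally show ?thesis by simp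
qed

lemma gv_r: assumes "facet F" "l \<in> F" "k \<in> F" shows "gv l \<bullet> r F k = (if k = l then hsq (q l) else 0)"
  using U_weight_orthogonal[OF assms] by (auto simp: U_weight[OF assms(1,2), symmetric] rt_def weight_simple)

lemma A_gv: assumes "facet F" "l \<in> F" "t \<le> l" shows "A F t (gv l) = gv l"
  using A_stable[OF facet_Ob[OF assms(1)], of 0 t "gv l"] gv_r[OF assms(1,2)] assms(3) by auto

lemma A_gv_c: assumes "facet F" "l \<in> F" "l < t" "t \<le> ltop" shows "A F t (gv l) = c (gv l)"
  using A_stable[OF facet_Ob[OF assms(1)], of t ltop "gv l"] gv_r[OF assms(1,2)] assms(3,4) A_top[OF assms(1)] by auto

lemma facet_expand:
  assumes F: "facet F" shows "f = (\<Sum>k\<in>F. ((f \<bullet> r F k) / hsq (q k)) *\<^sub>R gv k)"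
proof -
  have "f - (\<Sum>k\<in>F. ((f \<bullet> r F k) / hsq (q k)) *\<^sub>R gv k) = 0"
  proof (rule facet_orthogonal_0[OF F])
    fix l assume l: "l \<in> F"
    have "(\<Sum>k\<in>F. (f \<bullet> r F k) / hsq (q k) * (gv k \<bullet> r F l)) = (\<Sum>k\<in>F. if k = l then f \<bullet> r F l else 0)"
      by (rule sum.cong) (use l gv_r[OF F] in auto)
    also have "\<dots> = f \<bullet> r F l" using l facet_finite[OF F] by simp
    finally show "(f - (\<Sum>k\<in>F. ((f \<bullet> r F k) / hsq (q k)) *\<^sub>R gv k)) \<bullet> r F l = 0"
      by (simp add: inner_diff_left inner_sum_left)
  qed
  then show ?thesis by simp
qed

subsection \<open>Compatibility of positions\<close>

text \<open>The pairing plays the role of minus the dimension of Ext from the object at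
  \<open>N\<close> to the one at \<open>t\<close>. Positive roots crossed before \<open>N\<close>
  have become negative there; shifted projectives are treated separately.\<close>

lemma gv_rt_nonpos: assumes "t \<in> Ob" "N \<in> Ob" "t < N" shows "gv N \<bullet> rt Ob t \<le> 0"
proof (cases "CARD('n) \<le> t")
  case True
  have "gv N \<bullet> rt Ob t = weight (q N) \<bullet> wi Ob N (c (oroot t))"
    by (simp add: wd_gv[OF assms(2), symmetric] wd_adjoint c_oroot[OF assms(1) True])
  also have "\<dots> = weight (q N) \<bullet> Ui {..<CARD('n)} N (oroot t)" using True assms(3) by (simp add: wi_Ob_eq)
  also have "\<dots> \<le> 0" using pos_weight[OF Ui_F0_neg[OF assms(1) True assms(3)], of "q N"] by simp
  finally show ?thesis .
next
  case False
  then have R: "rt Ob t = pr (q t)" using rt_Ob[OF assms(1)] less_rank_iff[of t] by simp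
  show ?thesis
  proof (cases "CARD('n) \<le> N")
    case True
    have "gv N \<bullet> pr (q t) = gv N \<bullet> weight (q t) - gv N \<bullet> c (weight (q t))"
      by (simp add: cox_weight inner_diff_right)
    also have "\<dots> = - (weight (q t) \<bullet> oroot N)"
      by (simp add: oroot_gv[OF True] inner_diff_right c_adjoint inner_commute[of "gv N"])
    also have "\<dots> \<le> 0" using pos_weight[OF oroot_pos[OF assms(2) True]] by simp
    finally show ?thesis by (simp add: R)
  next
    case N: False
    have "\<eta> (q t) \<le> \<eta> (q N)" using q_mono[of N t] N False assms(3) by (meson leI not_less_iff_gr_or_eq)
    moreover have "q t \<noteq> q N" using ps_q[of t] ps_q[of N] N False assms(3) by auto
    ultimately have "weight (q N) \<bullet> pr (q t) = 0" by (intro proj_weight_0) auto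
    then show ?thesis using N by (simp add: R gv_init)
  qed
qed

text \<open>Both vectors are images under the isometry \<open>A F t\<close>, of \<open>gv k\<close>
  and of \<open>r F t\<close>, and these are orthogonal by duality.\<close>

lemma facet_gv_rt: assumes F: "facet F" and "t \<in> F" "k \<in> F" "t < k" shows "gv k \<bullet> rt Ob t = 0"
proof -
  have "rt Ob t = A F t (r F t)" by (simp add: A_def rt_def)
  moreover have "gv k = A F t (gv k)" using A_gv[OF F assms(3)] assms(4) by simp
  ultimately have "gv k \<bullet> rt Ob t = A F t (gv k) \<bullet> A F t (r F t)" by metis
  also have "\<dots> = 0" using gv_r[OF F assms(3,2)] assms(4) by simp
  finally show ?thesis .
qed

definition compat :: "nat \<Rightarrow> nat \<Rightarrow> bool" where
  "compat s t \<longleftrightarrow> (if s < t then gv t \<bullet> rt Ob s = 0 else gv s \<bullet> rt Ob t = 0)"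

lemma compat_sym: "s \<noteq> t \<Longrightarrow> compat s t \<longleftrightarrow> compat t s" by (auto simp: compat_def)

lemma facet_compat: "facet F \<Longrightarrow> s \<in> F \<Longrightarrow> t \<in> F \<Longrightarrow> s \<noteq> t \<Longrightarrow> compat s t"
  using facet_gv_rt by (auto simp: compat_def)

text \<open>
  Pairing with the vectors \<open>rt Ob t\<close>, in the order of the positions \<open>t\<close>, reads off the
  coefficients of a nonnegative combination of pairwise compatible g-vectors one after the other.
\<close>

lemma compat_cone:
  assumes F: "facet F" and X: "X \<subseteq> Ob" and comp: "\<And>s t. s \<in> X \<Longrightarrow> t \<in> X \<Longrightarrow> s \<noteq> t \<Longrightarrow> compat s t"
    and eq: "(\<Sum>k\<in>X. gv k) = (\<Sum>k\<in>F. \<mu> k *\<^sub>R gv k)" and nonneg: "\<And>k. k \<in> F \<Longrightarrow> 0 \<le> \<mu> k"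
  shows "X \<subseteq> F"
proof -
  have finX: "finite X" using X finite_Ob finite_subset by blast
  have finF: "finite F" using facet_finite[OF F] .
  have main: "(t \<in> X \<longrightarrow> t \<in> F) \<and> (t \<in> F \<longrightarrow> \<mu> t = (if t \<in> X then 1 else 0))" for t
  proof (induction t rule: less_induct)
    case (less t)
    show ?case
    proof (cases "t \<in> Ob")
      case False
      then show ?thesis using X facet_Ob[OF F] by auto
    next
      case tO: True
      let ?R = "rt Ob t"
      have sX: "(\<Sum>k\<in>X. gv k) = (\<Sum>k | k \<in> X \<and> k < t. gv k) + (\<Sum>k | k \<in> X \<and> t \<le> k. gv k)"
        by (subst sum.union_disjoint[symmetric]) (use finX in \<open>auto intro: sum.cong\<close>)
      have sF: "(\<Sum>k\<in>F. \<mu> k *\<^sub>R gv k) = (\<Sum>k | k \<in> F \<and> k < t. \<mu> k *\<^sub>R gv k) + (\<Sum>k | k \<in> F \<and> t \<le> k. \<mu> k *\<^sub>R gv k)"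
        by (subst sum.union_disjoint[symmetric]) (use finF in \<open>auto intro: sum.cong\<close>)
      have "(\<Sum>k | k \<in> F \<and> k < t. \<mu> k *\<^sub>R gv k) = (\<Sum>k | k \<in> X \<and> k < t. \<mu> k *\<^sub>R gv k)"
        by (rule sum.mono_neutral_right) (use less finF in auto)
      also have "\<dots> = (\<Sum>k | k \<in> X \<and> k < t. gv k)"
        by (rule sum.cong) (use less in auto)
      finally have eq': "(\<Sum>k | k \<in> X \<and> t \<le> k. gv k) = (\<Sum>k | k \<in> F \<and> t \<le> k. \<mu> k *\<^sub>R gv k)"
        using eq sX sF by simp
      have L: "(\<Sum>k | k \<in> X \<and> t \<le> k. gv k) \<bullet> ?R = (if t \<in> X then hsq (q t) else 0) + (\<Sum>k | k \<in> X \<and> t < k. gv k \<bullet> ?R)"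
      proof (cases "t \<in> X")
        case True
        then have "{k. k \<in> X \<and> t \<le> k} = insert t {k. k \<in> X \<and> t < k}" by auto
        then show ?thesis using True finX tO by (simp add: inner_add_left inner_sum_left gv_inner_rt)
      next
        case False
        then have "{k. k \<in> X \<and> t \<le> k} = {k. k \<in> X \<and> t < k}" using le_eq_less_or_eq by auto
        then show ?thesis using False by (simp add: inner_sum_left)
      qed
      have Rr: "(\<Sum>k | k \<in> F \<and> t \<le> k. \<mu> k *\<^sub>R gv k) \<bullet> ?R = (if t \<in> F then \<mu> t * hsq (q t) else 0) +
          (\<Sum>k | k \<in> F \<and> t < k. \<mu> k * (gv k \<bullet> ?R))"
      proof (cases "t \<in> F")
        case True
        then have "{k. k \<in> F \<and> t \<le> k} = insert t {k. k \<in> F \<and> t < k}" by auto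
        then show ?thesis using True finF tO by (simp add: inner_add_left inner_sum_left gv_inner_rt)
      next
        case False
        then have "{k. k \<in> F \<and> t \<le> k} = {k. k \<in> F \<and> t < k}" using le_eq_less_or_eq by auto
        then show ?thesis using False by (simp add: inner_sum_left)
      qed
      have X0: "(\<Sum>k | k \<in> X \<and> t < k. gv k \<bullet> ?R) \<le> 0"
        by (intro sum_nonpos gv_rt_nonpos) (use X tO in auto)
      have X1: "(\<Sum>k | k \<in> X \<and> t < k. gv k \<bullet> ?R) = 0" if "t \<in> X"
        by (intro sum.neutral) (use comp that in \<open>auto simp: compat_def\<close>)
      have F1: "(\<Sum>k | k \<in> F \<and> t < k. \<mu> k * (gv k \<bullet> ?R)) = 0" if "t \<in> F"
        by (intro sum.neutral) (use facet_gv_rt[OF F that] in auto)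
      have FF: "(\<Sum>k | k \<in> F \<and> t < k. \<mu> k * (gv k \<bullet> ?R)) \<le> 0"
        by (intro sum_nonpos mult_nonneg_nonpos gv_rt_nonpos) (use nonneg facet_Ob[OF F] tO in auto)
      \<comment> \<open>The terms before \<open>t\<close> have cancelled by induction. The sums over
        later positions are nonpositive, and such a sum vanishes on a side that contains
        \<open>t\<close>, so signs decide whether \<open>t\<close> occurs and with which
        coefficient.\<close>
      note all = eq' [THEN arg_cong[where f = "\<lambda>x. x \<bullet> ?R"], unfolded L Rr] hsq_pos[of "q t"]
      show ?thesis
      proof (cases "t \<in> F")
        case tF: True
        show ?thesis
        proof (cases "t \<in> X")
          case True then show ?thesis using all X1 F1 tF by simp
        next
          case False
          have "\<mu> t * hsq (q t) \<le> 0" using all X0 F1 tF False by simp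
          then have "\<mu> t = 0" using nonneg[OF tF] hsq_pos[of "q t"] by (simp add: mult_le_0_iff)
          then show ?thesis using tF False by simp
        qed
      next
        case False
        have "t \<notin> X" using all X1 FF False by fastforce
        then show ?thesis using False by simp
      qed
    qed
  qed
  then show ?thesis by blast
qed

subsection \<open>Flips\<close>

text \<open>Toggling the letter at \<open>lo\<close> inserts its reflection into the prefix product;
  toggling the letter at \<open>hi\<close> inserts the same reflection again and cancels it.\<close>

lemma wd_exchange:
  assumes "lo < hi" and S': "\<And>t. t \<in> S' \<longleftrightarrow> (if t = lo \<or> t = hi then t \<notin> S else t \<in> S)"
    and one: "lo \<in> S \<longleftrightarrow> hi \<notin> S" and refl: "\<And>x. reflection (rt S lo) x = reflection (rt S hi) x"
  shows "wd S' t x = (if lo < t \<and> t \<le> hi then reflection (rt S lo) (wd S t x) else wd S t x)"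
proof (induction t arbitrary: x)
  case (Suc t)
  note IH = Suc
  consider "t = lo" | "t = hi" | "t \<noteq> lo" "t \<noteq> hi" by blast
  then show ?case
  proof cases
    case 1
    then show ?thesis using IH[of x] IH[of "srefl (q lo) x"] S'[of lo] assms(1)
      by (auto simp: wd_srefl rt_def)
  next
    case 2
    then show ?thesis using IH[of x] IH[of "srefl (q hi) x"] S'[of hi] assms(1) refl
      by (auto simp: wd_srefl rt_def[symmetric])
  next
    case 3
    then have "t \<in> S' \<longleftrightarrow> t \<in> S" using S'[of t] by simp
    moreover have "(lo < Suc t \<and> Suc t \<le> hi) \<longleftrightarrow> (lo < t \<and> t \<le> hi)" using 3 by auto
    ultimately show ?thesis using IH by simp
  qed
qed simp

definition flip :: "nat set \<Rightarrow> nat \<Rightarrow> nat set" where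
  "flip F a = insert (star F a) (F - {a})"

context
  fixes F a assumes F: "facet F" and a: "a \<in> F"
begin

lemma star_neq: "star F a \<noteq> a" "star F a \<notin> F" "star F a \<in> Ob" using star(1)[OF F, of a] a by auto

lemma U_flip:
  "U (flip F a) t x =
    (if min a (star F a) < t \<and> t \<le> max a (star F a) then reflection (r F a) (U F t x) else U F t x)"
proof -
  let ?p = "star F a"
  have refl: "reflection (r F ?p) x = reflection (r F a) x" for x by (simp add: r_star[OF F] reflection_absr)
  have S': "t \<in> Ob - flip F a \<longleftrightarrow> (if t = a \<or> t = ?p then t \<notin> Ob - F else t \<in> Ob - F)" for t
    using star_neq a facet_Ob[OF F] by (auto simp: flip_def)
  show ?thesis
  proof (cases "a < ?p")
    case True
    from wd_exchange[OF True, of "Ob - flip F a" "Ob - F" t x] S' refl star_neq a True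
    show ?thesis by simp
  next
    case False
    then have "?p < a" using star_neq by auto
    from wd_exchange[OF this, of "Ob - flip F a" "Ob - F" t x] S' refl star_neq a \<open>?p < a\<close>
    show ?thesis by (simp add: disj_commute)
  qed
qed

lemma r_flip:
  "r (flip F a) t =
    (if min a (star F a) < t \<and> t \<le> max a (star F a) then reflection (r F a) (r F t) else r F t)"
  by (simp add: rt_def[of "Ob - flip F a"] U_flip) (simp add: rt_def)

lemma facet_flip: "facet (flip F a)"
  unfolding facet_def
proof (intro conjI allI)
  show "flip F a \<subseteq> Ob" using facet_Ob[OF F] star_neq by (auto simp: flip_def)
  show "card (flip F a) = CARD('n)"
  proof -
    have "card (F - {a}) = CARD('n) - 1" using F a facet_finite[OF F] by (simp add: facet_def)
    then show ?thesis using star_neq facet_finite[OF F] zero_less_card_finite[where 'a='n] by (simp add: flip_def)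
  qed
  show "U (flip F a) ltop x = U {..<CARD('n)} ltop x" for x
    using F Ob_top[of a] Ob_top[OF star_neq(3)] a facet_Ob[OF F] by (auto simp: U_flip facet_def)
qed

text \<open>The interval in \<open>r_flip\<close> is open below and closed above: a later
  \<open>star F a\<close> is reflected and an earlier one is not, and both times the result is the
  negated root, as for c-vectors under mutation.\<close>

lemma r_flip_star: "r (flip F a) (star F a) = - r F a"
proof (cases "r F a \<in> pos")
  case True
  then have "a < star F a" using less_star_iff[OF F a] by simp
  moreover have "r F (star F a) = r F a" using r_star[OF F] True by (simp add: absr_def)
  moreover have "r F a \<noteq> 0" using True pos_nonzero by simp
  ultimately show ?thesis by (simp add: r_flip reflection_def scaleR_2)
next
  case False
  then have "\<not> a < star F a" using less_star_iff[OF F a] by simp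
  moreover have "r F (star F a) = - r F a" using r_star[OF F] False by (simp add: absr_def)
  ultimately show ?thesis by (simp add: r_flip)
qed

lemma hsq_star: "hsq (q (star F a)) = hsq (q a)"
proof -
  have "r F (star F a) \<bullet> r F (star F a) = r F a \<bullet> r F a" by (simp add: r_star[OF F] absr_def)
  then show ?thesis by (simp add: rt_def simple_self)
qed

lemma star_flip: "star (flip F a) (star F a) = a"
proof (rule star_unique[OF facet_flip])
  show "a \<in> Ob - flip F a" using star_neq a facet_Ob[OF F] by (auto simp: flip_def)
  have n0: "r F a \<noteq> 0" using rt_root zero_not_root by metis
  show "r (flip F a) a = absr (flip F a) (star F a)"
  proof (cases "r F a \<in> pos")
    case True
    then have "r (flip F a) a = r F a" using less_star_iff[OF F a] by (simp add: r_flip)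
    then show ?thesis using True pos_not_neg by (simp add: absr_def r_flip_star)
  next
    case False
    then have "star F a < a" using less_star_iff[OF F a] star_neq by auto
    then have "r (flip F a) a = - r F a" using n0 by (simp add: r_flip reflection_def scaleR_2)
    moreover have "- r F a \<in> pos" using False not_pos_iff by simp
    ultimately show ?thesis by (simp add: absr_def r_flip_star)
  qed
qed

lemma flip_flip: "flip (flip F a) (star F a) = F"
  using star_neq a by (auto simp: flip_def[of "flip F a"] star_flip) (auto simp: flip_def)

end

text \<open>At position \<open>l\<close> the image of \<open>absr F a\<close> is positive before its
  crossing and negative after it. By duality it has no component at the letter of \<open>l\<close>,
  so \<open>inner_simple_nonpos\<close> fixes the sign of its pairing with that simple root.\<close>

lemma facet_sign:
  assumes F: "facet F" and a: "a \<in> F" and l: "l \<in> F" "l \<noteq> a"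
  shows "l < star F a \<Longrightarrow> absr F a \<bullet> r F l \<le> 0" and "star F a < l \<Longrightarrow> 0 \<le> absr F a \<bullet> r F l"
proof -
  let ?z = "Ui F l (absr F a)"
  have w: "weight (q l) \<bullet> ?z = 0"
    using gv_r[OF F l(1) a] l(2) by (simp add: wd_adjoint[symmetric] U_weight[OF F l(1)] absr_def)
  have e: "absr F a \<bullet> r F l = ?z \<bullet> \<alpha> (q l)"
    by (metis inner_commute rt_def wd_adjoint)
  show "absr F a \<bullet> r F l \<le> 0" if "l < star F a"
    using inner_simple_nonpos[OF _ w] Ui_pos[OF F star(1)[OF F], of l a] that e by (simp add: r_star[OF F])
  show "0 \<le> absr F a \<bullet> r F l" if "star F a < l"
    using inner_simple_nonpos[of "- ?z" "q l"] w Ui_neg[OF F star(1)[OF F] that] e by (simp add: r_star[OF F])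
qed

end

context coxeter_word
begin

subsection \<open>The vertex of the polytope belonging to a facet\<close>

text \<open>
  A brick vector, as in the brick polytopes of Pilaud and Stump, with one weight \<open>b k\<close> for every
  representation; \<open>ell b N\<close> is the coordinate \<open>t\<^sub>N\<close> of the mesh construction, as an affine function.
\<close>

definition vert :: "(nat \<Rightarrow> real) \<Rightarrow> nat set \<Rightarrow> real^'n" where
  "vert b F = (\<Sum>k | k \<in> Ob \<and> CARD('n) \<le> k. b k *\<^sub>R (ci (gv k) - U F k (weight (q k))))"

definition ell :: "(nat \<Rightarrow> real) \<Rightarrow> nat \<Rightarrow> real^'n \<Rightarrow> real" where
  "ell b N x = gv N \<bullet> x - (\<Sum>k | k \<in> Ob \<and> CARD('n) \<le> k \<and> k \<le> N. b k * (gv N \<bullet> oroot k))"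

lemma ell_vert: assumes F: "facet F" and N: "N \<in> F" shows "ell b N (vert b F) = 0"
proof -
  have t: "gv N \<bullet> (ci (gv k) - U F k (weight (q k))) = (if k \<le> N then gv N \<bullet> oroot k else 0)"
    if k: "k \<in> Ob" "CARD('n) \<le> k" for k
  proof -
    \<comment> \<open>The isometry \<open>A F k\<close> replaces the facet dependent vector by
      \<open>gv k\<close>. On \<open>gv N\<close> it is the identity for \<open>k \<le> N\<close>
      and equal to \<open>c\<close> afterwards, where the two parts of the brick cancel.\<close>
    have "A F k (U F k (weight (q k))) = gv k" by (simp add: A_def wd_gv[OF k(1)])
    then have e: "gv N \<bullet> U F k (weight (q k)) = A F k (gv N) \<bullet> gv k" by (metis A_inner)
    show ?thesis
    proof (cases "k \<le> N")
      case True
      then show ?thesis using e by (simp add: A_gv[OF F N] oroot_gv[OF k(2)] inner_diff_right)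
    next
      case False
      then have "A F k (gv N) = c (gv N)" using A_gv_c[OF F N, of k] Ob_top[OF k(1)] by simp
      then show ?thesis using e False by (simp add: inner_diff_right c_adjoint)
    qed
  qed
  have "gv N \<bullet> vert b F = (\<Sum>k | k \<in> Ob \<and> CARD('n) \<le> k. b k * (if k \<le> N then gv N \<bullet> oroot k else 0))"
    unfolding vert_def inner_sum_right by (rule sum.cong) (auto simp: t)
  also have "\<dots> = (\<Sum>k | k \<in> Ob \<and> CARD('n) \<le> k \<and> k \<le> N. b k * (gv N \<bullet> oroot k))"
    by (rule sum.mono_neutral_cong_right) (use finite_Ob in auto)
  finally show ?thesis by (simp add: ell_def)
qed

text \<open>Within the first period the letter of \<open>star F a\<close> has not been read before,
  so its root has a component at that letter and earlier roots have none; the two roots could not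
  coincide. A flip upwards therefore always involves a representation, whose parameter is
  positive.\<close>

lemma star_initial:
  assumes F: "facet F" and a: "a \<in> F" "r F a \<in> pos" shows "CARD('n) \<le> star F a"
proof (rule ccontr)
  let ?p = "star F a"
  assume p: "\<not> CARD('n) \<le> ?p"
  have lt: "a < ?p" using less_star_iff[OF F a(1)] a(2) by simp
  have w: "weight (q ?p) \<bullet> U F t x = weight (q ?p) \<bullet> x" if "t \<le> ?p" for t x
    using that
  proof (induction t arbitrary: x)
    case (Suc t)
    have "q t \<noteq> q ?p"
    proof
      assume "q t = q ?p"
      then have "t = ?p" using ps_q[of t] ps_q[of ?p] p Suc.prems by simp
      then show False using Suc.prems by simp
    qed
    then show ?case using Suc weight_refl by auto
  qed simp
  have "q a \<noteq> q ?p" using ps_q[of a] ps_q[of ?p] p lt by auto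
  then have "weight (q ?p) \<bullet> r F a = 0" using w[of a] lt by (simp add: rt_def weight_simple)
  moreover have "weight (q ?p) \<bullet> r F ?p = hsq (q ?p)" using w[of ?p] by (simp add: rt_def weight_simple)
  moreover have "r F ?p = r F a" using r_star[OF F] a(2) by (simp add: absr_def)
  ultimately show False by simp
qed

context
  fixes b :: "nat \<Rightarrow> real" assumes b_pos: "\<And>k. k \<in> Ob \<Longrightarrow> CARD('n) \<le> k \<Longrightarrow> 0 < b k"
begin

text \<open>Only the bricks at \<open>a < k \<le> star F a\<close> change, each by a nonnegative
  multiple of the root because that root is still uncrossed there; the brick at
  \<open>star F a\<close> changes strictly.\<close>

lemma vert_flip_pos:
  assumes F: "facet F" and a: "a \<in> F" "r F a \<in> pos"
  obtains \<kappa> where "0 < \<kappa>" "vert b (flip F a) - vert b F = \<kappa> *\<^sub>R r F a"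
proof -
  let ?p = "star F a" and ?g = "r F a"
  have lt: "a < ?p" using less_star_iff[OF F a(1)] a(2) by simp
  have rp: "r F ?p = ?g" using r_star[OF F] a(2) by (simp add: absr_def)
  have gg: "0 < ?g \<bullet> ?g" using pos_nonzero[OF a(2)] by simp
  define f where "f k = (if a < k \<and> k \<le> ?p then b k * (2 * (U F k (weight (q k)) \<bullet> ?g) / (?g \<bullet> ?g)) else 0)" for k
  let ?K = "{k. k \<in> Ob \<and> CARD('n) \<le> k}"
  have fin: "finite ?K" using finite_Ob by simp
  have "vert b (flip F a) - vert b F = (\<Sum>k\<in>?K. b k *\<^sub>R (U F k (weight (q k)) - U (flip F a) k (weight (q k))))"
    by (simp add: vert_def sum_subtractf[symmetric] scaleR_right_diff_distrib[symmetric])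
  also have "\<dots> = (\<Sum>k\<in>?K. f k *\<^sub>R ?g)"
    by (rule sum.cong) (use lt in \<open>auto simp: U_flip[OF F a(1)] reflection_def f_def\<close>)
  finally have 1: "vert b (flip F a) - vert b F = (\<Sum>k\<in>?K. f k) *\<^sub>R ?g" by (simp add: scaleR_sum_left)
  have w: "U F k (weight (q k)) \<bullet> ?g = weight (q k) \<bullet> Ui F k (r F ?p)" for k by (simp add: wd_adjoint rp)
  have "0 < (\<Sum>k\<in>?K. f k)"
  proof (rule sum_pos2[OF fin, of ?p])
    show pK: "?p \<in> ?K" using star(1)[OF F] star_initial[OF F a] by auto
    have "U F ?p (weight (q ?p)) \<bullet> ?g = hsq (q ?p)" by (simp add: w weight_simple)
    then show "0 < f ?p" using lt gg b_pos pK hsq_pos[of "q ?p"] by (simp add: f_def)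
    fix k assume k: "k \<in> ?K"
    have "0 \<le> U F k (weight (q k)) \<bullet> ?g" if "k \<le> ?p"
      unfolding w using pos_weight[OF Ui_pos[OF F star(1)[OF F] that]] .
    then show "0 \<le> f k" using gg b_pos[of k] k by (simp add: f_def less_imp_le)
  qed
  then show thesis using that 1 by blast
qed

lemma vert_flip:
  assumes F: "facet F" and a: "a \<in> F"
  obtains \<kappa> where "0 < \<kappa>" "vert b (flip F a) - vert b F = \<kappa> *\<^sub>R r F a"
proof (cases "r F a \<in> pos")
  case True then show thesis using vert_flip_pos[OF F a] that by blast
next
  case False
  let ?p = "star F a" and ?F = "flip F a"
  have p: "?p \<in> ?F" by (simp add: flip_def)
  have rp: "r ?F ?p = - r F a" by (rule r_flip_star[OF F a])
  moreover have "- r F a \<in> pos" using False not_pos_iff by simp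
  ultimately obtain \<kappa> where k: "0 < \<kappa>" "vert b (flip ?F ?p) - vert b ?F = \<kappa> *\<^sub>R r ?F ?p"
    using vert_flip_pos[OF facet_flip[OF F a] p] by metis
  have "vert b ?F - vert b F = - (vert b (flip ?F ?p) - vert b ?F)" by (simp add: flip_flip[OF F a])
  also have "\<dots> = \<kappa> *\<^sub>R r F a" by (simp only: k(2) rp) simp
  finally show thesis using that k(1) by blast
qed

section \<open>Minimal vertices and the covering by cones\<close>

lemma vert_minimal:
  obtains F where "facet F" "\<And>G. facet G \<Longrightarrow> f \<bullet> vert b F \<le> f \<bullet> vert b G"
proof -
  have "{F. facet F} \<noteq> {}" using facet_F0 by blast
  from ex_is_arg_min_if_finite[OF finite_facets this, of "\<lambda>F. f \<bullet> vert b F"]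
  obtain F where "is_arg_min (\<lambda>F. f \<bullet> vert b F) (\<lambda>F. F \<in> {F. facet F}) F" by blast
  then show thesis using that by (auto simp: is_arg_min_linorder)
qed

lemma vert_minimal_cone:
  assumes F: "facet F" and min: "\<And>G. facet G \<Longrightarrow> f \<bullet> vert b F \<le> f \<bullet> vert b G" and a: "a \<in> F"
  shows "0 \<le> f \<bullet> r F a"
proof -
  obtain \<kappa> where k: "0 < \<kappa>" "vert b (flip F a) - vert b F = \<kappa> *\<^sub>R r F a" using vert_flip[OF F a] .
  have "0 \<le> f \<bullet> (vert b (flip F a) - vert b F)" using min[OF facet_flip[OF F a]] by (simp add: inner_diff_right)
  then show ?thesis using k by (simp add: zero_le_mult_iff)
qed

lemma cone_cover_aux:
  obtains F u where "facet F" "\<And>k. k \<in> F \<Longrightarrow> (0::real) \<le> u k" "f = (\<Sum>k\<in>F. u k *\<^sub>R gv k)"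
    "\<And>G. facet G \<Longrightarrow> f \<bullet> vert b F \<le> f \<bullet> vert b G"
proof -
  obtain F where F: "facet F" "\<And>G. facet G \<Longrightarrow> f \<bullet> vert b F \<le> f \<bullet> vert b G" using vert_minimal[of f] by blast
  show thesis
    by (rule that[OF F(1) _ facet_expand[OF F(1)] F(2)])
       (use vert_minimal_cone[OF F] hsq_pos in \<open>auto intro!: divide_nonneg_pos\<close>)
qed

text \<open>Any facet minimizing \<open>gv N\<close> has \<open>gv N\<close> in its cone, and
  \<open>compat_cone\<close> for the singleton shows that it contains \<open>N\<close>. So the
  minimum of \<open>ell b N\<close> is 0 by \<open>ell_vert\<close>, and a facet attaining it is a
  minimizer and contains \<open>N\<close>.\<close>

lemma ell_vert_nonneg: assumes F: "facet F" and N: "N \<in> Ob" shows "0 \<le> ell b N (vert b F)"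
  and "ell b N (vert b F) = 0 \<Longrightarrow> N \<in> F"
proof -
  have in_min: "N \<in> G" if G: "facet G" "\<And>H. facet H \<Longrightarrow> gv N \<bullet> vert b G \<le> gv N \<bullet> vert b H" for G
  proof -
    have "{N} \<subseteq> G"
    proof (rule compat_cone[OF G(1)])
      show "(\<Sum>k\<in>{N}. gv k) = (\<Sum>k\<in>G. ((gv N \<bullet> r G k) / hsq (q k)) *\<^sub>R gv k)"
        using facet_expand[OF G(1), of "gv N"] by simp
      show "0 \<le> (gv N \<bullet> r G k) / hsq (q k)" if "k \<in> G" for k
        using vert_minimal_cone[OF G that] hsq_pos[of "q k"] by simp
    qed (use N in auto)
    then show ?thesis by simp
  qed
  obtain G where G: "facet G" "\<And>H. facet H \<Longrightarrow> gv N \<bullet> vert b G \<le> gv N \<bullet> vert b H"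
    using vert_minimal[of "gv N"] by blast
  have G0: "ell b N (vert b G) = 0" using ell_vert[OF G(1) in_min[OF G]] .
  then show "0 \<le> ell b N (vert b F)" using G(2)[OF F] by (simp add: ell_def)
  assume F0: "ell b N (vert b F) = 0"
  then have "gv N \<bullet> vert b F = gv N \<bullet> vert b G" using G0 by (simp add: ell_def)
  then show "N \<in> F" using in_min[OF F] G(2) by simp
qed

end

text \<open>The covering does not depend on the parameters, so all of them are set to 1.\<close>

lemma cone_cover:
  obtains F u where "facet F" "\<And>k. k \<in> F \<Longrightarrow> (0::real) \<le> u k" "f = (\<Sum>k\<in>F. u k *\<^sub>R gv k)"
proof (rule cone_cover_aux[of "\<lambda>_. 1" f])
  fix F u assume "facet F" "\<And>k. k \<in> F \<Longrightarrow> (0::real) \<le> u k" "f = (\<Sum>k\<in>F. u k *\<^sub>R gv k)"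
  then show thesis by (rule that)
qed simp

text \<open>The complex is a flag complex: the sum of the g-vectors of \<open>X\<close> lies in the
  cone of some facet, and \<open>compat_cone\<close> reads off that \<open>X\<close> is contained in
  it.\<close>

lemma compat_facet:
  assumes X: "X \<subseteq> Ob" and comp: "\<And>s t. s \<in> X \<Longrightarrow> t \<in> X \<Longrightarrow> s \<noteq> t \<Longrightarrow> compat s t"
  obtains F where "facet F" "X \<subseteq> F"
proof (rule cone_cover[of "\<Sum>k\<in>X. gv k"])
  fix F u assume F: "facet F" and u: "\<And>k. k \<in> F \<Longrightarrow> (0::real) \<le> u k"
    and eq: "(\<Sum>k\<in>X. gv k) = (\<Sum>k\<in>F. u k *\<^sub>R gv k)"
  have "X \<subseteq> F" by (rule compat_cone[OF F X comp eq u])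
  then show thesis by (rule that[OF F])
qed

text \<open>Fundamental weights pair nonnegatively with positive roots, so the initial g-vectors lie
  in the cone of \<open>F\<close>, and \<open>F\<close> contains the initial positions.\<close>

lemma all_positive_facet: assumes F: "facet F" and p: "\<And>k. k \<in> F \<Longrightarrow> r F k \<in> pos" shows "F = {..<CARD('n)}"
proof -
  have "t \<in> F" if t: "t < CARD('n)" for t
  proof -
    have "{t} \<subseteq> F"
    proof (rule compat_cone[OF F])
      show "(\<Sum>k\<in>{t}. gv k) = (\<Sum>k\<in>F. ((gv t \<bullet> r F k) / hsq (q k)) *\<^sub>R gv k)"
        using facet_expand[OF F, of "gv t"] by simp
      show "0 \<le> (gv t \<bullet> r F k) / hsq (q k)" if "k \<in> F" for k
        using pos_weight[OF p[OF that], of "q t"] hsq_pos[of "q k"] t by (simp add: gv_init)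
    qed (use initial_Ob t in auto)
    then show ?thesis by simp
  qed
  then have "{..<CARD('n)} \<subseteq> F" by blast
  then show ?thesis using card_subset_eq[OF facet_finite[OF F]] F by (metis card_lessThan facet_def)
qed

text \<open>A flip at a negative root replaces a position by a smaller one, so the sum of the
  positions decreases until all roots are positive.\<close>

lemma facet_induct [consumes 1, case_names initial flip]:
  assumes "facet F" and "Q {..<CARD('n)}" and "\<And>F a. facet F \<Longrightarrow> a \<in> F \<Longrightarrow> Q F \<Longrightarrow> Q (flip F a)"
  shows "Q F"
  using assms(1)
proof (induction "\<Sum>F" arbitrary: F rule: less_induct)
  case (less F)
  show ?case
  proof (cases "\<forall>k\<in>F. r F k \<in> pos")
    case True then show ?thesis using all_positive_facet[OF less.prems] assms(2) by simp
  next
    case False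
    then obtain a where a: "a \<in> F" "r F a \<notin> pos" by blast
    let ?p = "star F a"
    have "\<not> a < ?p" using less_star_iff[OF less.prems a(1)] a(2) by simp
    then have lt: "?p < a" using star_neq[OF less.prems a(1)] by auto
    have "\<Sum>(flip F a) = ?p + \<Sum>(F - {a})"
      using star_neq[OF less.prems a(1)] facet_finite[OF less.prems] by (simp add: flip_def)
    also have "\<dots> < a + \<Sum>(F - {a})" using lt by simp
    also have "\<dots> = \<Sum>F" using a(1) facet_finite[OF less.prems] by (simp add: sum.remove)
    finally have "Q (flip F a)" using less.hyps facet_flip[OF less.prems a(1)] by blast
    then have "Q (flip (flip F a) ?p)"
      by (intro assms(3)[OF facet_flip[OF less.prems a(1)]]) (simp add: flip_def)
    then show ?thesis by (simp add: flip_flip[OF less.prems a(1)])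
  qed
qed

subsection \<open>The exchange matrix of a facet\<close>

lemma rt_gv: assumes "l \<in> Ob" shows "rt Ob l = gv l - c (gv l)"
proof -
  have p: "pr (q l) = weight (q l) - c (weight (q l))" by (simp add: cox_weight)
  show ?thesis unfolding rt_Ob[OF assms] p gv_def by (simp add: linear_diff[OF linear_cpow] funpow_swap1)
qed

lemma A_diff_span: assumes "F \<subseteq> Ob" shows "A F t x - x \<in> span (r F ` {p \<in> F. p < t})"
proof (induction t arbitrary: x)
  case (Suc t)
  have sub: "span (r F ` {p \<in> F. p < t}) \<subseteq> span (r F ` {p \<in> F. p < Suc t})"
    by (intro span_mono image_mono) auto
  show ?case
  proof (cases "t \<in> F")
    case True
    let ?y = "reflection (r F t) x"
    have "A F t ?y - ?y \<in> span (r F ` {p \<in> F. p < Suc t})" using Suc.IH sub by blast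
    moreover have "?y - x \<in> span (r F ` {p \<in> F. p < Suc t})"
    proof -
      have "- (2 * (x \<bullet> r F t) / (r F t \<bullet> r F t)) *\<^sub>R r F t \<in> span (r F ` {p \<in> F. p < Suc t})"
        using True by (intro span_scale span_base) auto
      then show ?thesis by (simp add: reflection_def)
    qed
    ultimately have "(A F t ?y - ?y) + (?y - x) \<in> span (r F ` {p \<in> F. p < Suc t})" by (rule span_add)
    then show ?thesis using True by (simp add: A_Suc[OF assms])
  next
    case False then show ?thesis using Suc sub by (auto simp: A_Suc[OF assms])
  qed
qed (simp add: span_0)

text \<open>The facet roots are triangular for the Euler form, like an exceptional sequence. The
  root \<open>rt Ob l\<close> agrees with \<open>r F l\<close> up to earlier facet roots, and its
  Euler pairing is \<open>gv l \<bullet> r F a\<close>, which vanishes by duality.\<close>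

lemma euler_r_0: assumes F: "facet F" and "a \<in> F" "l \<in> F" "l < a" shows "euler \<eta> (r F a) (r F l) = 0"
  using assms(3,4)
proof (induction l rule: less_induct)
  case (less l)
  have lO: "l \<in> Ob" using less.prems facet_Ob[OF F] by blast
  have "rt Ob l = gv l - c (gv l)"
    by (rule rt_gv[OF lO])
  then have "euler \<eta> (r F a) (rt Ob l) = gv l \<bullet> r F a" by (simp add: euler_cox_diff)
  then have 0: "euler \<eta> (r F a) (rt Ob l) = 0" using gv_r[OF F less.prems(1) assms(2)] less.prems by simp
  have "rt Ob l = A F l (r F l)" by (simp add: A_def rt_def)
  then have s: "rt Ob l - r F l \<in> span (r F ` {p \<in> F. p < l})" using A_diff_span[OF facet_Ob[OF F]] by metis
  have "euler \<eta> (r F a) (rt Ob l - r F l) = 0"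
    using s
  proof (rule linear_eq_0_on_span[OF linear_euler2, rotated])
    show "\<And>x. x \<in> r F ` {p \<in> F. p < l} \<Longrightarrow> euler \<eta> (r F a) x = 0" using less by auto
  qed
  then show ?case using 0 by (simp add: euler_diff)
qed

lemma euler_r: assumes F: "facet F" and "a \<in> F" "l \<in> F" "a < l" shows "euler \<eta> (r F a) (r F l) = r F a \<bullet> r F l"
  using euler_sym[OF height, of "r F a" "r F l"] euler_r_0[OF F assms(3,2,4)] by simp

end

context coxeter_word
begin

definition skew :: "real^'n \<Rightarrow> real^'n \<Rightarrow> real" where
  "skew x y = euler \<eta> x y - euler \<eta> y x"

lemma skew_simps:
  "skew (x + y) z = skew x z + skew y z" "skew x (y + z) = skew x y + skew x z"
  "skew (a *\<^sub>R x) y = a * skew x y" "skew x (a *\<^sub>R y) = a * skew x y"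
  "skew (- x) y = - skew x y" "skew x (- y) = - skew x y" "skew x x = 0"
  by (simp_all add: skew_def euler_add euler_scale euler_neg algebra_simps)

lemma skew_anti: "skew y x = - skew x y" by (simp add: skew_def)

text \<open>The entry of the exchange matrix in row \<open>k\<close> and column \<open>l\<close> for the roots at positions \<open>k\<close> and \<open>l\<close>.\<close>

definition xe :: "nat set \<Rightarrow> nat \<Rightarrow> nat \<Rightarrow> real" where
  "xe F k l = skew (r F l) (r F k) / hsq (q k)"

lemma rt_norm: "rt S t \<bullet> rt S t = 2 * hsq (q t)" by (simp add: rt_def simple_self)

lemma xe_eq: assumes F: "facet F" and "k \<in> F" "l \<in> F" "k \<noteq> l"
  shows "xe F k l = (if k < l then - 1 else 1) * (r F k \<bullet> r F l) / hsq (q k)"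
proof (cases "k < l")
  case True
  then show ?thesis using euler_r_0[OF F assms(3,2)] euler_r[OF F assms(2,3)] by (simp add: xe_def skew_def)
next
  case False
  then have "l < k" using assms(4) by simp
  then show ?thesis using euler_r_0[OF F assms(2,3)] euler_r[OF F assms(3,2)] False
    by (simp add: xe_def skew_def inner_commute)
qed

text \<open>The tropical sign of the c-vector at \<open>a\<close>.\<close>

definition sg :: "nat set \<Rightarrow> nat \<Rightarrow> real" where "sg F a = (if r F a \<in> pos then 1 else - 1)"

text \<open>Mutation of c-vectors. Between \<open>a\<close> and \<open>star F a\<close> the flip
  reflects the root, elsewhere it does nothing; \<open>facet_sign\<close> and \<open>xe_eq\<close>
  show that the positive part is the reflection coefficient in the first case and 0 in the
  second.\<close>

lemma r_flip_other:
  assumes F: "facet F" and a: "a \<in> F" and l: "l \<in> F" "l \<noteq> a"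
  shows "r (flip F a) l = r F l + pos_part (sg F a * xe F a l) *\<^sub>R r F a"
proof -
  let ?p = "star F a" and ?d = "hsq (q a)"
  have d: "0 < ?d" by (rule hsq_pos)
  have lp: "l \<noteq> ?p" using star_neq[OF F a] l by auto
  have refl: "reflection (r F a) (r F l) = r F l - ((r F a \<bullet> r F l) / ?d) *\<^sub>R r F a"
    by (simp add: reflection_def rt_norm inner_commute)
  have x: "xe F a l = (if a < l then - 1 else 1) * (r F a \<bullet> r F l) / ?d" using xe_eq[OF F a l(1)] l(2) by simp
  note sign = facet_sign[OF F a l]
  show ?thesis
  proof (cases "r F a \<in> pos")
    case True
    then have ap: "a < ?p" using less_star_iff[OF F a] by simp
    have ab: "absr F a = r F a" using True by (simp add: absr_def)
    consider "l < a" | "a < l" "l < ?p" | "?p < l" using l(2) lp by linarith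
    then show ?thesis
    proof cases
      case 1
      then have "xe F a l \<le> 0" using sign(1) ap ab x d by (simp add: divide_nonpos_pos)
      then show ?thesis using 1 ap True by (simp add: r_flip[OF F a] sg_def max_def)
    next
      case 2
      then have "0 \<le> xe F a l" using sign(1) ab x d by (simp add: divide_nonpos_pos)
      then show ?thesis using 2 ap True x by (simp add: r_flip[OF F a] sg_def refl max_def)
    next
      case 3
      then have "xe F a l \<le> 0" using sign(2) ap ab x d by simp
      then show ?thesis using 3 ap True by (simp add: r_flip[OF F a] sg_def max_def)
    qed
  next
    case False
    then have ap: "?p < a" using less_star_iff[OF F a] star_neq[OF F a] by auto
    have ab: "absr F a = - r F a" using False by (simp add: absr_def)
    consider "l < ?p" | "?p < l" "l < a" | "a < l" using l(2) lp by linarith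
    then show ?thesis
    proof cases
      case 1
      then have "0 \<le> xe F a l" using sign(1) ap ab x d by simp
      then show ?thesis using 1 ap False by (simp add: r_flip[OF F a] sg_def max_def)
    next
      case 2
      then have "xe F a l \<le> 0" using sign(2) ab x d by (simp add: divide_nonpos_pos)
      then show ?thesis using 2 ap False x by (simp add: r_flip[OF F a] sg_def refl max_def)
    next
      case 3
      then have "0 \<le> xe F a l" using sign(2) ap ab x d by (simp add: divide_nonpos_pos)
      then show ?thesis using 3 ap False by (simp add: r_flip[OF F a] sg_def max_def)
    qed
  qed
qed

text \<open>Coordinates in the basis of fundamental weights, which are the initial
  g-vectors.\<close>

definition gco :: "real^'n \<Rightarrow> real^'n" where "gco x = (\<chi> i. \<alpha> i \<bullet> x / hsq i)"

text \<open>
  A skew-symmetrizer is determined only up to a factor on each connected component. The functions that are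
  constant on components account for this freedom.
\<close>

definition blockwise :: "('n \<Rightarrow> real) \<Rightarrow> bool" where
  "blockwise \<rho> \<longleftrightarrow> (\<forall>i j. \<alpha> i \<bullet> \<alpha> j \<noteq> 0 \<longrightarrow> \<rho> i = \<rho> j)"

definition scl :: "('n \<Rightarrow> real) \<Rightarrow> real^'n \<Rightarrow> real^'n" where
  "scl \<rho> x = (\<Sum>i\<in>UNIV. (\<rho> i * (weight i \<bullet> x) / hsq i) *\<^sub>R \<alpha> i)"

lemma scl_simple: "scl \<rho> (\<alpha> i) = \<rho> i *\<^sub>R \<alpha> i"
  by (simp add: scl_def weight_simple if_distrib if_distribR cong: if_cong)

lemma weight_scl: "weight i \<bullet> scl \<rho> x = \<rho> i * (weight i \<bullet> x)"
  by (simp add: scl_def inner_sum_right weight_simple if_distrib cong: if_cong)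

lemma scl_srefl: assumes "blockwise \<rho>" shows "scl \<rho> (srefl i x) = srefl i (scl \<rho> x)"
proof (rule eq_weight)
  fix k
  show "weight k \<bullet> scl \<rho> (srefl i x) = weight k \<bullet> srefl i (scl \<rho> x)"
  proof (cases "k = i")
    case False then show ?thesis by (simp add: weight_scl weight_refl)
  next
    case True
    have "\<alpha> i \<bullet> scl \<rho> x = (\<Sum>j\<in>UNIV. \<rho> j * (weight j \<bullet> x) / hsq j * (\<alpha> i \<bullet> \<alpha> j))"
      by (simp add: scl_def inner_sum_right)
    also have "\<dots> = (\<Sum>j\<in>UNIV. \<rho> i * ((weight j \<bullet> x) / hsq j * (\<alpha> i \<bullet> \<alpha> j)))"
    proof (rule sum.cong)
      fix j
      have "\<alpha> i \<bullet> \<alpha> j \<noteq> 0 \<Longrightarrow> \<rho> i = \<rho> j" using assms unfolding blockwise_def by blast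
      then show "\<rho> j * (weight j \<bullet> x) / hsq j * (\<alpha> i \<bullet> \<alpha> j) = \<rho> i * ((weight j \<bullet> x) / hsq j * (\<alpha> i \<bullet> \<alpha> j))"
        by (cases "\<alpha> i \<bullet> \<alpha> j = 0") auto
    qed simp
    also have "\<dots> = \<rho> i * (\<alpha> i \<bullet> (\<Sum>j\<in>UNIV. ((weight j \<bullet> x) / hsq j) *\<^sub>R \<alpha> j))"
      by (simp add: inner_sum_right sum_distrib_left)
    also have "\<dots> = \<rho> i * (\<alpha> i \<bullet> x)" using simple_expand[of x] by simp
    finally show ?thesis using True by (simp add: weight_scl weight_refl_self algebra_simps)
  qed
qed

lemma scl_wd: assumes "blockwise \<rho>" shows "scl \<rho> (wd S t x) = wd S t (scl \<rho> x)"
  by (induction t arbitrary: x) (auto simp: scl_srefl[OF assms])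

lemma scl_rt: assumes "blockwise \<rho>" shows "scl \<rho> (rt S t) = \<rho> (q t) *\<^sub>R rt S t"
  by (simp add: rt_def scl_wd[OF assms] scl_simple linear_scale[OF linear_wd])

lemma blockwise_star: assumes F: "facet F" and a: "a \<in> F" and "blockwise \<rho>" shows "\<rho> (q (star F a)) = \<rho> (q a)"
proof -
  have e: "r F (star F a) = r F a \<or> r F (star F a) = - r F a" using r_star[OF F] by (auto simp: absr_def)
  have "scl \<rho> (- r F a) = - scl \<rho> (r F a)" by (simp add: scl_def sum_negf)
  then have "scl \<rho> (r F (star F a)) = \<rho> (q a) *\<^sub>R r F (star F a)"
    using e scl_rt[OF assms(3), of "Ob - F" a] by auto
  then have "\<rho> (q (star F a)) *\<^sub>R r F (star F a) = \<rho> (q a) *\<^sub>R r F (star F a)"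
    using scl_rt[OF assms(3), of "Ob - F" "star F a"] by simp
  moreover have "r F (star F a) \<noteq> 0" using rt_root zero_not_root by metis
  ultimately show ?thesis by simp
qed

text \<open>The labelling \<open>\<kappa>\<close> tells which column of the seed belongs to which
  position. The letter at \<open>\<kappa> j\<close> need not be \<open>j\<close>; the last two
  clauses keep what is needed of that identity, namely root length and component.\<close>

definition seed_data :: "nat set \<Rightarrow> ('n \<Rightarrow> nat) \<Rightarrow> real^'n^'n \<Rightarrow> real^'n^'n \<Rightarrow> bool" where
  "seed_data F \<kappa> X C \<longleftrightarrow> facet F \<and> bij_betw \<kappa> UNIV F \<and>
     (\<forall>i j. C $ i $ j = weight i \<bullet> r F (\<kappa> j) / hsq i) \<and>
     (\<forall>k j. X $ k $ j = xe F (\<kappa> k) (\<kappa> j)) \<and>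
     (\<forall>j. hsq (q (\<kappa> j)) = hsq j) \<and>
     (\<forall>j \<rho>. blockwise \<rho> \<longrightarrow> \<rho> (q (\<kappa> j)) = \<rho> j)"

lemma seed_data_mutate:
  assumes sd: "seed_data F \<kappa> X C"
  shows "seed_data (flip F (\<kappa> k)) (\<kappa>(k := star F (\<kappa> k))) (mutate k X) (mutate_coeff k X C)"
proof -
  let ?a = "\<kappa> k" and ?F = "flip F (\<kappa> k)" and ?\<kappa> = "\<kappa>(k := star F (\<kappa> k))"
  have F: "facet F" and bij: "bij_betw \<kappa> UNIV F" and C: "\<And>i j. C $ i $ j = weight i \<bullet> r F (\<kappa> j) / hsq i"
    and X: "\<And>k j. X $ k $ j = xe F (\<kappa> k) (\<kappa> j)" and hq: "\<And>j. hsq (q (\<kappa> j)) = hsq j"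
    and bl: "\<And>j \<rho>. blockwise \<rho> \<Longrightarrow> \<rho> (q (\<kappa> j)) = \<rho> j"
    using sd by (auto simp: seed_data_def)
  have \<kappa>F: "\<kappa> j \<in> F" for j using bij bij_betwE by blast
  have inj: "\<kappa> i = \<kappa> j \<longleftrightarrow> i = j" for i j using bij unfolding bij_betw_def inj_def by auto
  note a = \<kappa>F[of k]
  have bij': "bij_betw ?\<kappa> UNIV ?F"
    unfolding bij_betw_def
  proof
    have "\<kappa> j \<noteq> star F ?a" "star F ?a \<noteq> \<kappa> j" for j using star_neq(2)[OF F a] \<kappa>F[of j] by metis+
    then show "inj ?\<kappa>" by (simp add: inj_def inj)
    have "\<kappa> ` (UNIV - {k}) = F - {\<kappa> k}" using bij inj unfolding bij_betw_def by auto
    moreover have "?\<kappa> ` UNIV = insert (star F ?a) (\<kappa> ` (UNIV - {k}))" by auto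
    ultimately show "range ?\<kappa> = ?F" by (simp add: flip_def)
  qed
  have rk: "r ?F (?\<kappa> k) = - r F ?a" using r_flip_star[OF F a] by simp
  have rj: "r ?F (?\<kappa> j) = r F (\<kappa> j) + pos_part (sg F ?a * X $ k $ j) *\<^sub>R r F ?a" if "j \<noteq> k" for j
    using r_flip_other[OF F a \<kappa>F[of j]] that by (simp add: X inj)
  have hq': "hsq (q (?\<kappa> j)) = hsq j" for j using hq hsq_star[OF F a] by simp
  have Xs: "X $ i $ j = skew (r F (\<kappa> j)) (r F (\<kappa> i)) / hsq i" for i j by (simp add: X xe_def hq)
  have Cc: "mutate_coeff k X C $ i $ j = weight i \<bullet> r ?F (?\<kappa> j) / hsq i" for i j
  proof (cases "j = k")
    case True then show ?thesis by (simp add: mutate_coeff_def C rk del: fun_upd_apply)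
  next
    case False
    show ?thesis
    proof (cases "r F ?a \<in> pos")
      case True
      \<comment> \<open>Sign coherence: column \<open>k\<close> of \<open>C\<close> consists of the
        coefficients of a single root, so only one of the two correction terms of
        \<open>mutate_coeff\<close> survives.\<close>
      then have "0 \<le> C $ i $ k" using pos_weight[OF True, of i] hsq_pos[of i] by (simp add: C)
      then have "mutate_coeff k X C $ i $ j = C $ i $ j + C $ i $ k * pos_part (X $ k $ j)"
        using False by (simp add: mutate_coeff_def max_def)
      then show ?thesis using False True
        by (simp add: rj sg_def inner_add_right add_divide_distrib C mult.commute del: fun_upd_apply)
    next
      case n: False
      then have "- r F ?a \<in> pos" using not_pos_iff by simp
      from pos_weight[OF this, of i] have "C $ i $ k \<le> 0" using hsq_pos[of i] by (simp add: C divide_nonpos_pos)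
      then have "mutate_coeff k X C $ i $ j = C $ i $ j + C $ i $ k * pos_part (- X $ k $ j)"
        using False by (simp add: mutate_coeff_def max_def)
      then show ?thesis using False n
        by (simp add: rj sg_def inner_add_right add_divide_distrib C mult.commute del: fun_upd_apply)
    qed
  qed
  have Xc: "mutate k X $ i $ j = xe ?F (?\<kappa> i) (?\<kappa> j)" for i j
  proof -
    have x: "xe ?F (?\<kappa> i) (?\<kappa> j) = skew (r ?F (?\<kappa> j)) (r ?F (?\<kappa> i)) / hsq i" by (simp only: xe_def hq')
    consider "i = k" "j = k" | "i = k" "j \<noteq> k" | "i \<noteq> k" "j = k" | "i \<noteq> k" "j \<noteq> k" by blast
    then show ?thesis
    proof cases
      case 1 then show ?thesis unfolding x by (simp add: mutate_def Xs skew_simps)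
    next
      case 2
      then show ?thesis unfolding x
        by (simp add: rj rk mutate_def Xs skew_simps del: fun_upd_apply)
    next
      case 3
      then show ?thesis unfolding x
        by (simp add: rj rk mutate_def Xs skew_simps del: fun_upd_apply)
    next
      case 4
      let ?e = "sg F ?a"
      have skjk: "skew (r F (\<kappa> i)) (r F ?a) = - hsq i * X $ i $ k" by (simp add: Xs skew_anti[of "r F ?a"])
      have e: "?e = 1 \<or> ?e = - 1" by (simp add: sg_def)
      have "xe ?F (?\<kappa> i) (?\<kappa> j) = X $ i $ j + X $ i $ k * pos_part (?e * X $ k $ j) +
          pos_part (?e * X $ k $ i) * hsq k / hsq i * X $ k $ j"
        unfolding x using 4
        by (simp add: rj skew_simps Xs add_divide_distrib del: fun_upd_apply)
      also have "pos_part (?e * X $ k $ i) * hsq k / hsq i = pos_part (- ?e * X $ i $ k)"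
      proof -
        have h: "X $ k $ i * hsq k / hsq i = - X $ i $ k" by (simp add: Xs skew_anti[of "r F ?a"])
        have "?e * X $ k $ i * (hsq k / hsq i) = ?e * (X $ k $ i * hsq k / hsq i)" by simp
        then have "?e * X $ k $ i * (hsq k / hsq i) = - ?e * X $ i $ k" unfolding h by simp
        moreover have "pos_part (?e * X $ k $ i) * (hsq k / hsq i) = pos_part (?e * X $ k $ i * (hsq k / hsq i))"
          using hsq_pos[of k] hsq_pos[of i]
          by (simp add: max_def zero_le_mult_iff mult_le_0_iff zero_le_divide_iff divide_le_0_iff)
        ultimately show ?thesis by simp
      qed
      \<comment> \<open>Matrix mutation can be written in this form with either sign
        \<open>?e\<close>; the sign that arises here is that of the c-vector.\<close>
      also have "X $ i $ j + X $ i $ k * pos_part (?e * X $ k $ j) + pos_part (- ?e * X $ i $ k) * X $ k $ j =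
          mutate k X $ i $ j"
        using 4 e by (auto simp: mutate_def max_def algebra_simps)
      finally show ?thesis by simp
    qed
  qed
  have bl': "\<rho> (q (?\<kappa> j)) = \<rho> j" if "blockwise \<rho>" for \<rho> j
    using bl[OF that, of j] blockwise_star[OF F a that] by (cases "j = k") auto
  show ?thesis
    unfolding seed_data_def
    using facet_flip[OF F a] bij' Cc Xc hq' bl' by (intro conjI allI impI)
qed

section \<open>Seeds of the quiver and its g-vector fan\<close>

context
  fixes B :: "real^'n^'n"
  assumes B: "\<And>i j. B $ i $ j = skew (\<alpha> j) (\<alpha> i) / hsq i"
begin

lemma r_init: "t < CARD('n) \<Longrightarrow> r {..<CARD('n)} t = \<alpha> (q t)"
  by (simp add: rt_def U_F0_init)

lemma seed_data_initial: "seed_data {..<CARD('n)} ps B (mat 1)"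
proof -
  have "bij_betw ps UNIV {..<CARD('n)}" unfolding ps_def using bij_betw_the_inv_into[OF q_bij] .
  then show ?thesis
    unfolding seed_data_def using ps_less
    by (auto simp: facet_F0 r_init mat_def weight_simple xe_def B)
qed

lemma seeds_data: assumes "(X, C) \<in> seeds B" shows "\<exists>F \<kappa>. seed_data F \<kappa> X C"
  using assms
proof (induction X C rule: seeds.induct)
  case initial then show ?case using seed_data_initial by blast
next
  case (mutation X C k) then show ?case using seed_data_mutate by blast
qed

lemma facet_seed: assumes "facet F" shows "\<exists>\<kappa> X C. (X, C) \<in> seeds B \<and> seed_data F \<kappa> X C"
  using assms
proof (induction rule: facet_induct)
  case initial then show ?case using seed_data_initial seeds.initial by blast
next
  case (flip F a)
  then obtain \<kappa> X C where s: "(X, C) \<in> seeds B" "seed_data F \<kappa> X C" by blast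
  then have "a \<in> range \<kappa>" using flip by (auto simp: seed_data_def bij_betw_def)
  then obtain k where "a = \<kappa> k" by blast
  then show ?case using seed_data_mutate[OF s(2), of k] seeds.mutation[OF s(1)] by blast
qed

lemma skew_simple: assumes "\<alpha> i \<bullet> \<alpha> j \<noteq> 0" "i \<noteq> j" shows "skew (\<alpha> i) (\<alpha> j) \<noteq> 0"
proof -
  have e: "euler \<eta> (\<alpha> i) (\<alpha> j) = (if \<eta> i < \<eta> j then \<alpha> i \<bullet> \<alpha> j else 0)" if "i \<noteq> j" for i j
    using that by (simp add: euler_simple weight_simple cf_def if_distrib sum.delta cong: if_cong)
  have "\<eta> i < \<eta> j \<or> \<eta> j < \<eta> i" using height_eq[OF height, of i j] assms by (metis linorder_neqE_nat)
  then show ?thesis using assms e[of i j] e[of j i] by (auto simp: skew_def inner_commute)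
qed

text \<open>Along an edge the ratio of two symmetrizers is preserved, since the entry of the
  exchange matrix there is nonzero.\<close>

lemma blockwise_symmetrizer: assumes "skew_symmetrizer B d" shows "blockwise (\<lambda>i. d i / hsq i)"
  unfolding blockwise_def
proof (intro allI impI)
  fix i j assume a: "\<alpha> i \<bullet> \<alpha> j \<noteq> 0"
  show "d i / hsq i = d j / hsq j"
  proof (cases "i = j")
    case False
    have "d i * B $ i $ j = - (d j * B $ j $ i)" using assms unfolding skew_symmetrizer_def by blast
    then have "d i / hsq i * skew (\<alpha> j) (\<alpha> i) = d j / hsq j * skew (\<alpha> j) (\<alpha> i)"
      by (simp add: B skew_anti[of "\<alpha> i"])
    moreover have "skew (\<alpha> j) (\<alpha> i) \<noteq> 0" using skew_simple[of j i] a False by (simp add: inner_commute)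
    ultimately show ?thesis by (simp only: mult_cancel_right) simp
  qed simp
qed

lemma symmetrizer_hsq: "skew_symmetrizer B hsq"
  unfolding skew_symmetrizer_def
proof (intro conjI allI hsq_pos)
  fix i j show "hsq i * B $ i $ j = - (hsq j * B $ j $ i)"
    using skew_anti[of "\<alpha> j" "\<alpha> i"] by (simp add: B)
qed

lemma diag_matrix_mult: "(M ** diag_matrix d) $ i $ j = M $ i $ j * d j"
  by (simp add: matrix_matrix_mult_def diag_matrix_def if_distrib cong: if_cong)

text \<open>The vectors \<open>gv\<close> of a facet are dual to its roots with respect to
  \<open>hsq\<close>. An arbitrary \<open>d\<close> differs from \<open>hsq\<close> by a factor
  constant on components, and a facet root lives on one component, so the duality persists.\<close>

lemma g_matrix_seed:
  assumes sd: "seed_data F \<kappa> X C" and d: "skew_symmetrizer B d"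
  shows "transpose G ** diag_matrix d ** C = diag_matrix d \<longleftrightarrow> (\<forall>j. column j G = gco (gv (\<kappa> j)))"
proof -
  have F: "facet F" and bij: "bij_betw \<kappa> UNIV F" and C: "\<And>i j. C $ i $ j = weight i \<bullet> r F (\<kappa> j) / hsq i"
    and hq: "\<And>j. hsq (q (\<kappa> j)) = hsq j" and bl: "\<And>j \<rho>. blockwise \<rho> \<Longrightarrow> \<rho> (q (\<kappa> j)) = \<rho> j"
    using sd by (auto simp: seed_data_def)
  have \<kappa>F: "\<kappa> j \<in> F" for j using bij bij_betwE by blast
  have inj: "\<kappa> i = \<kappa> j \<longleftrightarrow> i = j" for i j using bij unfolding bij_betw_def inj_def by auto
  have dp: "0 < d i" for i using d by (simp add: skew_symmetrizer_def)
  define G0 :: "real^'n^'n" where "G0 = (\<chi> i j. \<alpha> i \<bullet> gv (\<kappa> j) / hsq i)"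
  let ?\<rho> = "\<lambda>i. d i / hsq i"
  have \<rho>: "blockwise ?\<rho>" by (rule blockwise_symmetrizer[OF d])
  have G0: "transpose G0 ** diag_matrix d ** C = diag_matrix d"
  proof (simp add: vec_eq_iff, intro allI)
    fix j l
    have "(transpose G0 ** diag_matrix d ** C) $ j $ l = (\<Sum>i\<in>UNIV. (\<alpha> i \<bullet> gv (\<kappa> j) / hsq i) * d i * (weight i \<bullet> r F (\<kappa> l) / hsq i))"
      by (simp add: matrix_matrix_mult_def[of _ C] diag_matrix_mult transpose_def G0_def C)
    also have "\<dots> = (\<Sum>i\<in>UNIV. (\<alpha> i \<bullet> gv (\<kappa> j)) * (weight i \<bullet> scl ?\<rho> (r F (\<kappa> l))) / hsq i)"
      by (rule sum.cong) (simp_all add: weight_scl mult_ac)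
    also have "\<dots> = gv (\<kappa> j) \<bullet> scl ?\<rho> (r F (\<kappa> l))" by (rule inner_expand[symmetric])
    also have "\<dots> = ?\<rho> l * (gv (\<kappa> j) \<bullet> r F (\<kappa> l))" using bl[OF \<rho>, of l] by (simp add: scl_rt[OF \<rho>])
    also have "\<dots> = diag_matrix d $ j $ l"
      using gv_r[OF F \<kappa>F \<kappa>F] by (auto simp: inj hq diag_matrix_def)
    finally show "(transpose G0 ** diag_matrix d ** C) $ j $ l = diag_matrix d $ j $ l" .
  qed
  have uniq: "G = G0" if G: "transpose G ** diag_matrix d ** C = diag_matrix d" for G
  proof -
    let ?e = "diag_matrix (\<lambda>i. 1 / d i)"
    have ee: "?e ** diag_matrix d = mat 1"
      by (simp add: vec_eq_iff diag_matrix_mult) (use dp in \<open>auto simp: diag_matrix_def mat_def less_imp_neq[symmetric]\<close>)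
    \<comment> \<open>\<open>?M\<close> is a left, hence also a right inverse of \<open>C\<close>,
      so \<open>C\<close> can be cancelled from the duality equation.\<close>
    let ?M = "?e ** (transpose G0 ** diag_matrix d)"
    have "?M ** C = mat 1" using G0 ee by (simp add: matrix_mul_assoc[symmetric])
    then have CM: "C ** ?M = mat 1" using matrix_left_right_inverse by blast
    have "transpose G ** diag_matrix d = (transpose G ** diag_matrix d ** C) ** ?M"
      using CM by (metis matrix_mul_assoc matrix_mul_rid)
    also have "\<dots> = (transpose G0 ** diag_matrix d ** C) ** ?M" using G G0 by simp
    also have "\<dots> = transpose G0 ** diag_matrix d" using CM by (metis matrix_mul_assoc matrix_mul_rid)
    finally have "(transpose G ** diag_matrix d) $ j $ i = (transpose G0 ** diag_matrix d) $ j $ i" for i j by simp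
    then have "G $ i $ j = G0 $ i $ j" for i j
      using dp[of i] by (simp add: diag_matrix_mult transpose_def) (metis less_irrefl)
    then show ?thesis by (simp add: vec_eq_iff)
  qed
  have "(\<forall>j. column j G = gco (gv (\<kappa> j))) \<longleftrightarrow> G = G0"
    by (auto simp: vec_eq_iff column_def gco_def G0_def)
  then show ?thesis using G0 uniq by blast
qed

lemma g_vector_fan_eq: "g_vector_fan B = {convex_cone hull ((\<lambda>k. gco (gv k)) ` Y) | Y F. facet F \<and> Y \<subseteq> F}"
proof (intro set_eqI iffI)
  fix K assume "K \<in> g_vector_fan B"
  then obtain G J d X C where K: "K = convex_cone hull ((\<lambda>i. column i G) ` J)" and
    g: "skew_symmetrizer B d" "(X, C) \<in> seeds B" "transpose G ** diag_matrix d ** C = diag_matrix d"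
    unfolding g_vector_fan_def g_matrices_def by blast
  obtain F \<kappa> where sd: "seed_data F \<kappa> X C" using seeds_data[OF g(2)] by blast
  have "\<forall>j. column j G = gco (gv (\<kappa> j))" using g_matrix_seed[OF sd g(1)] g(3) by blast
  then have "(\<lambda>i. column i G) ` J = (\<lambda>k. gco (gv k)) ` (\<kappa> ` J)" by (simp add: image_image)
  moreover have "facet F" "\<kappa> ` J \<subseteq> F" using sd by (auto simp: seed_data_def bij_betw_def)
  ultimately show "K \<in> {convex_cone hull ((\<lambda>k. gco (gv k)) ` Y) | Y F. facet F \<and> Y \<subseteq> F}" using K by auto
next
  fix K assume "K \<in> {convex_cone hull ((\<lambda>k. gco (gv k)) ` Y) | Y F. facet F \<and> Y \<subseteq> F}"
  then obtain Y F where K: "K = convex_cone hull ((\<lambda>k. gco (gv k)) ` Y)" "facet F" "Y \<subseteq> F" by blast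
  obtain \<kappa> X C where s: "(X, C) \<in> seeds B" "seed_data F \<kappa> X C" using facet_seed[OF K(2)] by blast
  define G :: "real^'n^'n" where "G = (\<chi> i j. gco (gv (\<kappa> j)) $ i)"
  have cG: "column j G = gco (gv (\<kappa> j))" for j by (simp add: vec_eq_iff column_def G_def)
  then have G: "G \<in> g_matrices B"
    unfolding g_matrices_def using g_matrix_seed[OF s(2) symmetrizer_hsq, of G] s(1) symmetrizer_hsq by blast
  have Y: "\<kappa> ` (\<kappa> -` Y) = Y"
    using s(2) K(3) by (auto simp: seed_data_def bij_betw_def)
  have "(\<lambda>i. column i G) ` (\<kappa> -` Y) = (\<lambda>k. gco (gv k)) ` (\<kappa> ` (\<kappa> -` Y))" by (simp only: cG image_image)
  then have "K = convex_cone hull ((\<lambda>i. column i G) ` (\<kappa> -` Y))" by (simp only: Y K(1))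
  then show "K \<in> g_vector_fan B" unfolding g_vector_fan_def using G by blast
qed

end

end

context root_basis
begin

subsection \<open>The compatibility relation on almost positive roots\<close>

abbreviation "apr \<equiv> almost_positive_roots \<Phi> \<alpha>"

lemma apr_eq: "apr = pos \<union> range (\<lambda>i. - \<alpha> i)"
proof -
  have "(\<exists>x. \<beta> = (\<Sum>i\<in>UNIV. x i *\<^sub>R \<alpha> i) \<and> (\<forall>i. 0 \<le> x i)) \<longleftrightarrow> (\<forall>i. 0 \<le> weight i \<bullet> \<beta>)" for \<beta>
  proof
    assume "\<exists>x. \<beta> = (\<Sum>i\<in>UNIV. x i *\<^sub>R \<alpha> i) \<and> (\<forall>i. 0 \<le> x i)"
    then obtain x where x: "\<beta> = (\<Sum>i\<in>UNIV. x i *\<^sub>R \<alpha> i)" "\<forall>i. 0 \<le> x i" by blast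
    have "weight i \<bullet> \<beta> = x i * hsq i" for i
      by (simp add: x(1) inner_sum_right weight_simple if_distrib cong: if_cong)
    then show "\<forall>i. 0 \<le> weight i \<bullet> \<beta>" using x(2) hsq_pos by (simp add: less_imp_le)
  next
    assume "\<forall>i. 0 \<le> weight i \<bullet> \<beta>"
    then have "\<forall>i. 0 \<le> weight i \<bullet> \<beta> / hsq i" using hsq_pos by (simp add: less_imp_le)
    then show "\<exists>x. \<beta> = (\<Sum>i\<in>UNIV. x i *\<^sub>R \<alpha> i) \<and> (\<forall>i. 0 \<le> x i)"
      using simple_expand[of \<beta>] by (intro exI[of _ "\<lambda>i. weight i \<bullet> \<beta> / hsq i"]) simp
  qed
  then show ?thesis by (auto simp: almost_positive_roots_def pos_def)
qed

lemma neg_simple_not_pos [simp]: "- \<alpha> i \<notin> pos" using simple_pos pos_not_neg by metis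

lemma apr_cases [consumes 1, case_names neg pos]:
  assumes "\<beta> \<in> apr" obtains j where "\<beta> = - \<alpha> j" | "\<beta> \<in> pos"
  using assms by (auto simp: apr_eq)

lemma apr_neg [simp]: "- \<alpha> i \<in> apr" and apr_pos: "\<gamma> \<in> pos \<Longrightarrow> \<gamma> \<in> apr" by (auto simp: apr_eq)

text \<open>
  Compatibility in terms of a quiver: for two representations both Ext-groups vanish, and since at most
  one of Hom and Ext is nonzero this is a condition on the signs of the Euler form.
\<close>

definition cmp :: "('n \<Rightarrow> nat) \<Rightarrow> real^'n \<Rightarrow> real^'n \<Rightarrow> bool" where
  "cmp \<eta> \<beta> \<gamma> \<longleftrightarrow> (\<forall>j. \<beta> = - \<alpha> j \<longrightarrow> weight j \<bullet> \<gamma> = 0) \<and> (\<forall>j. \<gamma> = - \<alpha> j \<longrightarrow> weight j \<bullet> \<beta> = 0) \<and>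
     (\<beta> \<in> pos \<and> \<gamma> \<in> pos \<longrightarrow> 0 \<le> euler \<eta> \<beta> \<gamma> \<and> 0 \<le> euler \<eta> \<gamma> \<beta>)"

lemma cmp_sym: "cmp \<eta> \<beta> \<gamma> \<longleftrightarrow> cmp \<eta> \<gamma> \<beta>" by (auto simp: cmp_def)

lemma cmp_neg_neg: "j \<noteq> k \<Longrightarrow> cmp \<eta> (- \<alpha> j) (- \<alpha> k)" by (auto simp: cmp_def weight_simple)

lemma cmp_neg_pos: "\<gamma> \<in> pos \<Longrightarrow> cmp \<eta> (- \<alpha> j) \<gamma> \<longleftrightarrow> weight j \<bullet> \<gamma> = 0" by (auto simp: cmp_def)

lemma cmp_pos_pos: "\<beta> \<in> pos \<Longrightarrow> \<gamma> \<in> pos \<Longrightarrow> cmp \<eta> \<beta> \<gamma> \<longleftrightarrow> 0 \<le> euler \<eta> \<beta> \<gamma> \<and> 0 \<le> euler \<eta> \<gamma> \<beta>"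
  by (auto simp: cmp_def)

text \<open>The truncated simple reflection: the effect of a reflection functor at \<open>i\<close>
  on almost positive roots, where the shifted projectives at other vertices stay in place.\<close>

definition sig :: "'n \<Rightarrow> real^'n \<Rightarrow> real^'n" where
  "sig i \<beta> = (if \<exists>j. j \<noteq> i \<and> \<beta> = - \<alpha> j then \<beta> else srefl i \<beta>)"

lemma sig_neg: "j \<noteq> i \<Longrightarrow> sig i (- \<alpha> j) = - \<alpha> j" by (auto simp: sig_def)
lemma sig_neg_self: "sig i (- \<alpha> i) = \<alpha> i" by (auto simp: sig_def)
lemma sig_pos: "\<gamma> \<in> pos \<Longrightarrow> sig i \<gamma> = srefl i \<gamma>" by (auto simp: sig_def)

lemma sig_cases [consumes 1, case_names neg neg_self pos_self pos]:
  assumes "\<beta> \<in> apr"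
  obtains j where "j \<noteq> i" "\<beta> = - \<alpha> j" "sig i \<beta> = - \<alpha> j" | "\<beta> = - \<alpha> i" "sig i \<beta> = \<alpha> i"
    | "\<beta> = \<alpha> i" "sig i \<beta> = - \<alpha> i" | "\<beta> \<in> pos" "\<beta> \<noteq> \<alpha> i" "sig i \<beta> = srefl i \<beta>" "srefl i \<beta> \<in> pos" "srefl i \<beta> \<noteq> \<alpha> i"
  using assms
proof (cases rule: apr_cases)
  case (neg j) then show thesis using that(1,2) sig_neg sig_neg_self by (cases "j = i") auto
next
  case pos
  show thesis
  proof (cases "\<beta> = \<alpha> i")
    case True then show thesis using that(3) sig_pos[OF simple_pos] by simp
  next
    case False
    have "srefl i \<beta> \<noteq> \<alpha> i"
    proof
      assume "srefl i \<beta> = \<alpha> i"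
      then have "\<beta> = - \<alpha> i" by (metis refl_refl refl_simple_self)
      then show False using pos by simp
    qed
    then show thesis using that(4) False pos sig_pos refl_pos by blast
  qed
qed

lemma sig_apr: assumes "\<beta> \<in> apr" shows "sig i \<beta> \<in> apr" and sig_sig: "sig i (sig i \<beta>) = \<beta>"
  using assms by (cases rule: sig_cases[where i = i]; auto simp: apr_pos simple_pos sig_neg sig_neg_self sig_pos)+

lemma sig_bij: "bij_betw (sig i) apr apr"
  by (rule bij_betw_byWitness[where f' = "sig i"]) (auto simp: sig_sig sig_apr)

text \<open>Two ordinary positive roots are handled by \<open>euler_raise\<close>. When
  \<open>\<alpha> i\<close> or \<open>- \<alpha> i\<close> is involved, one Euler value is a
  coefficient and another the negative of a coefficient of a positive root, so nonnegativity amounts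
  to the vanishing of the coefficient at \<open>i\<close>.\<close>

lemma cmp_sig:
  assumes h: "height \<eta>" "sink \<eta> i" and "\<beta> \<in> apr" "\<gamma> \<in> apr" "\<beta> \<noteq> \<gamma>"
  shows "cmp (raise i \<eta>) (sig i \<beta>) (sig i \<gamma>) \<longleftrightarrow> cmp \<eta> \<beta> \<gamma>"
proof -
  let ?e = "euler \<eta>" and ?e' = "euler (raise i \<eta>)"
  have ei: "?e y (\<alpha> i) = weight i \<bullet> y" for y using euler_proj[of \<eta> y i] proj_sink[OF h(2)] by simp
  have ei2: "?e (\<alpha> i) y = - (weight i \<bullet> srefl i y)" for y
    using euler_sym[OF h(1), of "\<alpha> i" y] by (simp add: ei weight_refl_self)
  have e': "?e' (srefl i x) (srefl i y) = ?e x y" for x y by (rule euler_raise[OF h])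
  have e1: "?e' (\<alpha> i) (srefl i y) = weight i \<bullet> srefl i y" "?e' (srefl i y) (\<alpha> i) = - (weight i \<bullet> y)" for y
    using e'[of "- \<alpha> i" y] e'[of y "- \<alpha> i"] by (simp_all add: euler_neg ei ei2)
  have ni: "cmp (raise i \<eta>) (\<alpha> i) (srefl i \<delta>) \<longleftrightarrow> cmp \<eta> (- \<alpha> i) \<delta>" if "\<delta> \<in> pos" "srefl i \<delta> \<in> pos" for \<delta>
    using that pos_weight[OF that(1), of i] pos_weight[OF that(2), of i]
    by (auto simp: cmp_pos_pos simple_pos cmp_neg_pos e1)
  have pi: "cmp (raise i \<eta>) (- \<alpha> i) (srefl i \<delta>) \<longleftrightarrow> cmp \<eta> (\<alpha> i) \<delta>" if "\<delta> \<in> pos" "srefl i \<delta> \<in> pos" for \<delta>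
    using that pos_weight[OF that(1), of i] pos_weight[OF that(2), of i]
    by (auto simp: cmp_pos_pos simple_pos cmp_neg_pos ei ei2)
  have nj: "cmp (raise i \<eta>) (- \<alpha> j) (srefl i \<delta>) \<longleftrightarrow> cmp \<eta> (- \<alpha> j) \<delta>" if "\<delta> \<in> pos" "srefl i \<delta> \<in> pos" "j \<noteq> i" for \<delta> j
    using that by (simp add: cmp_neg_pos weight_refl)
  have njp: "cmp \<eta>' (- \<alpha> j) (\<alpha> i)" if "j \<noteq> i" for \<eta>' j using that by (simp add: cmp_neg_pos simple_pos weight_simple)
  have nn: "\<not> cmp \<eta>' (- \<alpha> i) (\<alpha> i)" for \<eta>' by (simp add: cmp_neg_pos simple_pos weight_simple)
  have sy: "cmp \<eta>' (\<alpha> i) (- \<alpha> j) \<longleftrightarrow> cmp \<eta>' (- \<alpha> j) (\<alpha> i)" "cmp \<eta>' \<delta> (- \<alpha> j) \<longleftrightarrow> cmp \<eta>' (- \<alpha> j) \<delta>"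
    "cmp \<eta>' \<delta> (\<alpha> i) \<longleftrightarrow> cmp \<eta>' (\<alpha> i) \<delta>" for \<eta>' j \<delta>
    using cmp_sym by blast+
  show ?thesis
    using assms(3)
  proof (cases rule: sig_cases[where i = i])
    case b: (neg j)
    show ?thesis using assms(4)
      by (cases rule: sig_cases[where i = i]) (use b assms(5) in \<open>auto simp: cmp_neg_neg njp nj\<close>)
  next
    case b: neg_self
    show ?thesis using assms(4)
    proof (cases rule: sig_cases[where i = i])
      case (neg j) then show ?thesis using b sy(1)[of _ j] njp[of j] by (simp add: cmp_neg_neg)
    next
      case neg_self then show ?thesis using b assms(5) by simp
    next
      case pos_self then show ?thesis using b nn sy(1)[of _ i] by simp
    next
      case pos then show ?thesis using b ni by simp
    qed
  next
    case b: pos_self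
    show ?thesis using assms(4)
    proof (cases rule: sig_cases[where i = i])
      case (neg j) then show ?thesis using b sy(1)[of _ j] njp[of j] by (simp add: cmp_neg_neg)
    next
      case neg_self then show ?thesis using b nn sy(1)[of _ i] by simp
    next
      case pos_self then show ?thesis using b assms(5) by simp
    next
      case pos then show ?thesis using b pi by simp
    qed
  next
    case b: pos
    show ?thesis using assms(4)
    proof (cases rule: sig_cases[where i = i])
      case (neg j) then show ?thesis using b nj[of \<beta> j] by (simp add: sy(2))
    next
      case neg_self then show ?thesis using b ni[of \<beta>] by (simp add: sy(2,3))
    next
      case pos_self then show ?thesis using b pi[of \<beta>] by (simp add: sy(2,3))
    next
      case pos then show ?thesis using b by (simp add: cmp_pos_pos e')
    qed
  qed
qed

section \<open>Bipartite orientations and the two rotations\<close>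

lemma euler_alt:
  "euler \<eta> x y = (\<Sum>i\<in>UNIV. (weight i \<bullet> x) * (weight i \<bullet> y) / hsq i) +
     (\<Sum>j\<in>UNIV. \<Sum>i\<in>UNIV. if \<eta> i < \<eta> j then (\<alpha> i \<bullet> \<alpha> j) * (weight i \<bullet> x / hsq i) * (weight j \<bullet> y / hsq j) else 0)"
  unfolding euler_def sum_Collect_if ..

lemma euler_cong:
  assumes "\<And>i j. \<alpha> i \<bullet> \<alpha> j \<noteq> 0 \<Longrightarrow> weight i \<bullet> x \<noteq> 0 \<Longrightarrow> weight j \<bullet> y \<noteq> 0 \<Longrightarrow> \<eta> i < \<eta> j \<longleftrightarrow> \<eta>' i < \<eta>' j"
  shows "euler \<eta> x y = euler \<eta>' x y"
  unfolding euler_alt using assms by (intro arg_cong2[where f = "(+)"] sum.cong) auto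

lemma euler_transpose:
  assumes "\<And>i j. \<alpha> i \<bullet> \<alpha> j \<noteq> 0 \<Longrightarrow> weight i \<bullet> x \<noteq> 0 \<Longrightarrow> weight j \<bullet> y \<noteq> 0 \<Longrightarrow> \<eta> i < \<eta> j \<longleftrightarrow> \<eta>' j < \<eta>' i"
  shows "euler \<eta> x y = euler \<eta>' y x"
proof -
  have "euler \<eta>' y x = (\<Sum>i\<in>UNIV. (weight i \<bullet> y) * (weight i \<bullet> x) / hsq i) +
     (\<Sum>i\<in>UNIV. \<Sum>j\<in>UNIV. if \<eta>' i < \<eta>' j then (\<alpha> i \<bullet> \<alpha> j) * (weight i \<bullet> y / hsq i) * (weight j \<bullet> x / hsq j) else 0)"
    unfolding euler_alt by (subst (2) sum.swap) (rule refl)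
  also have "\<dots> = euler \<eta> x y"
  proof -
    have "(if \<eta>' i < \<eta>' j then (\<alpha> i \<bullet> \<alpha> j) * (weight i \<bullet> y / hsq i) * (weight j \<bullet> x / hsq j) else 0) =
      (if \<eta> j < \<eta> i then (\<alpha> j \<bullet> \<alpha> i) * (weight j \<bullet> x / hsq j) * (weight i \<bullet> y / hsq i) else 0)" for i j
      using assms[of j i] inner_commute[of "\<alpha> i" "\<alpha> j"]
      by (cases "\<alpha> j \<bullet> \<alpha> i = 0"; cases "weight j \<bullet> x = 0"; cases "weight i \<bullet> y = 0") (auto simp: mult_ac)
    moreover have "(weight i \<bullet> y) * (weight i \<bullet> x) / hsq i = (weight i \<bullet> x) * (weight i \<bullet> y) / hsq i" for i by simp
    ultimately show ?thesis unfolding euler_alt[of \<eta>] by presburger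
  qed
  finally show ?thesis by simp
qed

definition bip :: "'n set \<Rightarrow> 'n \<Rightarrow> nat" where "bip J j = (if j \<in> J then 0 else 1)"

lemma colour_class_Compl: "colour_class \<alpha> J \<Longrightarrow> colour_class \<alpha> (- J)"
  by (auto simp: colour_class_def)

lemma colour_class_orth: "colour_class \<alpha> J \<Longrightarrow> i \<noteq> j \<Longrightarrow> i \<in> J \<Longrightarrow> j \<in> J \<Longrightarrow> \<alpha> i \<bullet> \<alpha> j = 0"
  by (simp add: colour_class_def)

lemma colour_class_adj: "colour_class \<alpha> J \<Longrightarrow> i \<noteq> j \<Longrightarrow> \<alpha> i \<bullet> \<alpha> j \<noteq> 0 \<Longrightarrow> i \<in> J \<longleftrightarrow> j \<notin> J"
  by (auto simp: colour_class_def)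

text \<open>Complementing the colour class reverses all arrows and so transposes the Euler form,
  while \<open>cmp\<close> is symmetric.\<close>

lemma cmp_bip_Compl: assumes "colour_class \<alpha> J" shows "cmp (bip (- J)) \<beta> \<gamma> \<longleftrightarrow> cmp (bip J) \<beta> \<gamma>"
proof -
  have "euler (bip (- J)) x y = euler (bip J) y x" for x y
    by (rule euler_transpose) (auto simp: bip_def)
  then show ?thesis by (auto simp: cmp_def)
qed

text \<open>A vertex of minimal height is a sink. Reflecting there, as long as some height is at
  least two below the fixed maximum \<open>M\<close>, ends with all heights in {M - 1, M}, which is
  a bipartite orientation; \<open>cmp_sig\<close> is applied at each reflection.\<close>

lemma exists_bipartite:
  assumes "height \<eta>"
  shows "\<exists>J \<Xi>. colour_class \<alpha> J \<and> bij_betw \<Xi> apr apr \<and>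
    (\<forall>\<beta>\<in>apr. \<forall>\<gamma>\<in>apr. \<beta> \<noteq> \<gamma> \<longrightarrow> (cmp \<eta> \<beta> \<gamma> \<longleftrightarrow> cmp (bip J) (\<Xi> \<beta>) (\<Xi> \<gamma>)))"
proof -
  define M where "M = Max (range \<eta>)"
  have "\<eta> j \<le> M" for j unfolding M_def by simp
  then show ?thesis using assms
  proof (induction "\<Sum>j\<in>UNIV. M - \<eta> j" arbitrary: \<eta> rule: less_induct)
    case less
    show ?case
    proof (cases "\<exists>i. \<eta> i + 2 \<le> M")
      case False
      define J where "J = {j. \<eta> j < M}"
      have v: "\<eta> j = M \<or> Suc (\<eta> j) = M" for j
      proof -
        have "\<not> \<eta> j + 2 \<le> M" using False by blast
        then show ?thesis using less.prems(1)[of j] by linarith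
      qed
      have cc: "colour_class \<alpha> J"
        unfolding colour_class_def J_def
      proof (intro allI impI)
        fix i j assume a: "i \<noteq> j \<and> ((i \<in> {j. \<eta> j < M}) = (j \<in> {j. \<eta> j < M}))"
        then have "\<eta> i = \<eta> j" using v[of i] v[of j] by auto
        then show "\<alpha> i \<bullet> \<alpha> j = 0" using height_eq[OF less.prems(2)] a by blast
      qed
      have "euler \<eta> x y = euler (bip J) x y" for x y
      proof (rule euler_cong)
        fix i j show "\<eta> i < \<eta> j \<longleftrightarrow> bip J i < bip J j" using v[of i] v[of j] by (auto simp: bip_def J_def)
      qed
      then have "cmp \<eta> = cmp (bip J)" by (auto simp: cmp_def fun_eq_iff)
      then show ?thesis using cc by (intro exI[of _ J] exI[of _ id]) auto
    next
      case True
      then obtain i0 where i0: "\<eta> i0 + 2 \<le> M" by blast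
      obtain i where i: "\<And>j. \<eta> i \<le> \<eta> j"
        using ex_min_if_finite[of "range \<eta>"] by (metis (mono_tags) UNIV_I finite_class.finite_UNIV finite_imageI image_iff image_is_empty UNIV_not_empty linorder_not_less)
      have iM: "\<eta> i + 2 \<le> M" using i[of i0] i0 by linarith
      have s: "sink \<eta> i"
        unfolding sink_def using i height_eq[OF less.prems(2)] by (metis le_neq_implies_less)
      let ?\<eta> = "raise i \<eta>"
      have lt: "(\<Sum>j\<in>UNIV. M - ?\<eta> j) < (\<Sum>j\<in>UNIV. M - \<eta> j)"
        by (rule sum_strict_mono_ex1) (use iM in \<open>auto simp: raise_def intro!: exI[of _ i]\<close>)
      have le: "?\<eta> j \<le> M" for j using less.prems(1)[of j] iM by (simp add: raise_def)
      from less.hyps[OF lt le height_raise[OF less.prems(2) s]]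
      obtain J \<Xi> where J: "colour_class \<alpha> J" "bij_betw \<Xi> apr apr"
        "\<And>\<beta> \<gamma>. \<beta> \<in> apr \<Longrightarrow> \<gamma> \<in> apr \<Longrightarrow> \<beta> \<noteq> \<gamma> \<Longrightarrow> cmp ?\<eta> \<beta> \<gamma> \<longleftrightarrow> cmp (bip J) (\<Xi> \<beta>) (\<Xi> \<gamma>)"
        by blast
      have "cmp \<eta> \<beta> \<gamma> \<longleftrightarrow> cmp (bip J) ((\<Xi> \<circ> sig i) \<beta>) ((\<Xi> \<circ> sig i) \<gamma>)" if bg: "\<beta> \<in> apr" "\<gamma> \<in> apr" "\<beta> \<noteq> \<gamma>" for \<beta> \<gamma>
      proof -
        have "sig i \<beta> \<noteq> sig i \<gamma>" using sig_sig bg by metis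
        then show ?thesis using cmp_sig[OF less.prems(2) s bg] J(3)[of "sig i \<beta>" "sig i \<gamma>"] sig_apr bg by simp
      qed
      then show ?thesis using J(1) bij_betw_trans[OF sig_bij J(2)] by blast
    qed
  qed
qed

definition brefl :: "'n set \<Rightarrow> real^'n \<Rightarrow> real^'n" where
  "brefl K x = x - (\<Sum>i\<in>K. ((x \<bullet> \<alpha> i) / hsq i) *\<^sub>R \<alpha> i)"

lemma rotation_eq: "rotation \<alpha> K \<beta> = (if \<exists>i. i \<notin> K \<and> \<beta> = - \<alpha> i then \<beta> else brefl K \<beta>)"
  by (auto simp: rotation_def brefl_def hsq_def mult.commute)

lemma linear_brefl: "linear (brefl K)"
  by (rule linearI)
     (simp_all add: brefl_def inner_add_left add_divide_distrib scaleR_left_distrib sum.distrib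
       scaleR_right_diff_distrib scaleR_sum_right)

lemma weight_brefl: "j \<notin> K \<Longrightarrow> weight j \<bullet> brefl K x = weight j \<bullet> x"
  by (simp add: brefl_def inner_diff_right inner_sum_right weight_simple) (rule sum.neutral, auto)

lemma simple_brefl:
  assumes "\<And>i. i \<in> K \<Longrightarrow> \<alpha> i \<bullet> \<alpha> j = 0" shows "brefl K x \<bullet> \<alpha> j = x \<bullet> \<alpha> j"
  using assms by (simp add: brefl_def inner_diff_left inner_sum_left)

lemma brefl_insert:
  assumes "i \<notin> K" "\<And>k. k \<in> K \<Longrightarrow> \<alpha> k \<bullet> \<alpha> i = 0"
  shows "brefl (insert i K) x = srefl i (brefl K x)"
proof -
  have "brefl (insert i K) x = brefl K x - ((x \<bullet> \<alpha> i) / hsq i) *\<^sub>R \<alpha> i"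
    using assms(1) by (simp add: brefl_def)
  then show ?thesis using simple_brefl[of K i x] assms(2) by (simp add: srefl_def)
qed

text \<open>The delicate case is a positive root that \<open>brefl K\<close> turns into a negative
  simple root: its index lies in \<open>K\<close>, so \<open>srefl i\<close> fixes it by
  orthogonality, just as \<open>sig i\<close> leaves it alone.\<close>

lemma rotation_insert:
  assumes "i \<notin> K" and orth: "\<And>k j. k \<in> insert i K \<Longrightarrow> j \<in> insert i K \<Longrightarrow> k \<noteq> j \<Longrightarrow> \<alpha> k \<bullet> \<alpha> j = 0" and "\<beta> \<in> apr"
  shows "rotation \<alpha> (insert i K) \<beta> = sig i (rotation \<alpha> K \<beta>)"
proof -
  have o: "\<alpha> k \<bullet> \<alpha> i = 0" if "k \<in> K" for k using orth[of k i] that assms(1) by auto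
  note bi = brefl_insert[OF assms(1) o]
  have srf: "srefl i (\<alpha> k) = \<alpha> k" if "k \<in> K" for k using o[OF that] by (simp add: srefl_def)
  have bn: "brefl K (- \<alpha> k) = (if k \<in> K then \<alpha> k else - \<alpha> k)" if "k \<in> insert i K" for k
  proof -
    have "(\<Sum>j\<in>K. ((- \<alpha> k \<bullet> \<alpha> j) / hsq j) *\<^sub>R \<alpha> j) = (\<Sum>j\<in>K. if j = k then - (2 *\<^sub>R \<alpha> k) else 0)"
      by (rule sum.cong) (use orth[OF that] in \<open>auto simp: simple_self\<close>)
    also have "\<dots> = (if k \<in> K then - (2 *\<^sub>R \<alpha> k) else 0)" by simp
    finally have "brefl K (- \<alpha> k) = - \<alpha> k - (if k \<in> K then - (2 *\<^sub>R \<alpha> k) else 0)" by (simp add: brefl_def)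
    then show ?thesis by (simp add: scaleR_2)
  qed
  show ?thesis using assms(3)
  proof (cases rule: apr_cases)
    case (neg j)
    consider "j \<notin> insert i K" | "j = i" | "j \<in> K" by blast
    then show ?thesis
    proof cases
      case 1 then show ?thesis using neg by (auto simp: rotation_eq sig_neg)
    next
      case 2
      then show ?thesis using neg assms(1) bi[of "- \<alpha> i"] bn[of i] by (auto simp: rotation_eq sig_neg_self)
    next
      case 3
      then have "j \<noteq> i" using assms(1) by auto
      then show ?thesis using neg 3 bi[of "- \<alpha> j"] bn[of j] srf[OF 3] sig_pos[OF simple_pos, of i j] by (auto simp: rotation_eq)
    qed
  next
    case pos
    then have rot: "rotation \<alpha> (insert i K) \<beta> = srefl i (brefl K \<beta>)" "rotation \<alpha> K \<beta> = brefl K \<beta>"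
      using bi by (auto simp: rotation_eq)
    show ?thesis
    proof (cases "\<exists>j. j \<noteq> i \<and> brefl K \<beta> = - \<alpha> j")
      case False then show ?thesis unfolding rot sig_def by (simp only: if_False)
    next
      case True
      then obtain j where j: "j \<noteq> i" "brefl K \<beta> = - \<alpha> j" by blast
      have "j \<in> K"
      proof (rule ccontr)
        assume "j \<notin> K"
        then have "weight j \<bullet> \<beta> = - hsq j" using weight_brefl[of j K \<beta>] j by (simp add: weight_simple)
        then show False using pos_weight[OF pos, of j] hsq_pos[of j] by simp
      qed
      then show ?thesis using j srf by (simp add: rot sig_neg)
    qed
  qed
qed

text \<open>
  Interpolates between the two bipartite orientations, reflecting at the sinks in \<open>J\<close> one at a time.
\<close>

definition hgt :: "'n set \<Rightarrow> 'n set \<Rightarrow> 'n \<Rightarrow> nat" where "hgt J K j = (if j \<in> K then 2 else bip J j)"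

lemma rotation_partial:
  assumes J: "colour_class \<alpha> J" and "K \<subseteq> J"
  shows "height (hgt J K) \<and> bij_betw (rotation \<alpha> K) apr apr \<and> (\<forall>x\<in>\<Phi>. brefl K x \<in> \<Phi>) \<and>
    (\<forall>\<beta>\<in>apr. \<forall>\<gamma>\<in>apr. \<beta> \<noteq> \<gamma> \<longrightarrow> (cmp (hgt J K) (rotation \<alpha> K \<beta>) (rotation \<alpha> K \<gamma>) \<longleftrightarrow> cmp (bip J) \<beta> \<gamma>))"
  using finite[of K] assms(2)
proof (induction K rule: finite_induct)
  case empty
  have "rotation \<alpha> {} = id" by (auto simp: rotation_def fun_eq_iff)
  moreover have "hgt J {} = bip J" by (auto simp: hgt_def)
  moreover have "height (bip J)"
    unfolding height_def bip_def using colour_class_adj[OF J] by (auto simp: inner_commute)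
  ultimately show ?case by (simp add: brefl_def bij_betw_def inj_on_def)
next
  case (insert i K)
  then have IH: "height (hgt J K)" "bij_betw (rotation \<alpha> K) apr apr" "\<And>x. x \<in> \<Phi> \<Longrightarrow> brefl K x \<in> \<Phi>"
    "\<And>\<beta> \<gamma>. \<beta> \<in> apr \<Longrightarrow> \<gamma> \<in> apr \<Longrightarrow> \<beta> \<noteq> \<gamma> \<Longrightarrow> cmp (hgt J K) (rotation \<alpha> K \<beta>) (rotation \<alpha> K \<gamma>) \<longleftrightarrow> cmp (bip J) \<beta> \<gamma>"
    by auto
  have iJ: "i \<in> J" using insert by auto
  have orth: "\<alpha> k \<bullet> \<alpha> j = 0" if "k \<in> insert i K" "j \<in> insert i K" "k \<noteq> j" for k j
    using colour_class_orth[OF J that(3)] that insert.prems by blast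
  have sk: "sink (hgt J K) i"
    unfolding sink_def
  proof (intro allI impI)
    fix j assume "j \<noteq> i \<and> \<alpha> i \<bullet> \<alpha> j \<noteq> 0"
    then have "j \<notin> J" using colour_class_adj[OF J, of i j] iJ by auto
    then show "hgt J K i < hgt J K j" using insert iJ by (auto simp: hgt_def bip_def)
  qed
  have hK: "raise i (hgt J K) = hgt J (insert i K)"
    using insert.hyps iJ by (auto simp: hgt_def raise_def fun_eq_iff bip_def)
  note rot = rotation_insert[OF insert.hyps(2) orth]
  have apr1: "rotation \<alpha> K \<beta> \<in> apr" if "\<beta> \<in> apr" for \<beta> using IH(2) that bij_betwE by blast
  have "bij_betw (rotation \<alpha> (insert i K)) apr apr"
    using bij_betw_trans[OF IH(2) sig_bij[of i]] rot bij_betw_cong[of apr "rotation \<alpha> (insert i K)" "sig i \<circ> rotation \<alpha> K" apr]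
    by auto
  moreover have "brefl (insert i K) x \<in> \<Phi>" if "x \<in> \<Phi>" for x
    using brefl_insert[OF insert.hyps(2), of x] orth insert.hyps(2) IH(3)[OF that] by fastforce
  moreover have "cmp (hgt J (insert i K)) (rotation \<alpha> (insert i K) \<beta>) (rotation \<alpha> (insert i K) \<gamma>) \<longleftrightarrow> cmp (bip J) \<beta> \<gamma>"
    if bg: "\<beta> \<in> apr" "\<gamma> \<in> apr" "\<beta> \<noteq> \<gamma>" for \<beta> \<gamma>
  proof -
    have "rotation \<alpha> K \<beta> \<noteq> rotation \<alpha> K \<gamma>" using IH(2) bg unfolding bij_betw_def inj_on_def by blast
    then show ?thesis
      using cmp_sig[OF IH(1) sk apr1[OF bg(1)] apr1[OF bg(2)]] IH(4)[OF bg] rot bg by (simp add: hK)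
  qed
  moreover have "height (hgt J (insert i K))" using height_raise[OF IH(1) sk] hK by simp
  ultimately show ?case by blast
qed

lemma rotation_bij: "colour_class \<alpha> J \<Longrightarrow> bij_betw (rotation \<alpha> J) apr apr"
  and brefl_root: "colour_class \<alpha> J \<Longrightarrow> x \<in> \<Phi> \<Longrightarrow> brefl J x \<in> \<Phi>"
  using rotation_partial[of J J] by blast+

text \<open>Once all of \<open>J\<close> has been raised, \<open>hgt J J\<close> orients every edge
  as \<open>bip (- J)\<close> does, and \<open>cmp_bip_Compl\<close> leads back to
  \<open>bip J\<close>.\<close>

lemma cmp_rotation:
  assumes J: "colour_class \<alpha> J" and bg: "\<beta> \<in> apr" "\<gamma> \<in> apr" "\<beta> \<noteq> \<gamma>"
  shows "cmp (bip J) (rotation \<alpha> J \<beta>) (rotation \<alpha> J \<gamma>) \<longleftrightarrow> cmp (bip J) \<beta> \<gamma>"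
proof -
  let ?h = "hgt J J"
  have "euler ?h x y = euler (bip (- J)) x y" for x y
    by (rule euler_cong) (auto simp: hgt_def bip_def)
  then have "cmp ?h = cmp (bip (- J))" by (auto simp: cmp_def fun_eq_iff)
  then show ?thesis using rotation_partial[OF J, of J] bg cmp_bip_Compl[OF J] by auto
qed

lemma brefl_brefl: assumes "colour_class \<alpha> J" shows "brefl J (brefl J x) = x"
proof (rule eq_weight)
  fix j
  have o: "brefl J x \<bullet> \<alpha> i = - (x \<bullet> \<alpha> i)" if "i \<in> J" for i
  proof -
    have "(\<Sum>k\<in>J. (x \<bullet> \<alpha> k) / hsq k * (\<alpha> k \<bullet> \<alpha> i)) = (\<Sum>k\<in>J. if k = i then 2 * (x \<bullet> \<alpha> i) else 0)"
      by (rule sum.cong) (use colour_class_orth[OF assms] that in \<open>auto simp: simple_self\<close>)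
    then show ?thesis using that by (simp add: brefl_def inner_diff_left inner_sum_left)
  qed
  have "brefl J (brefl J x) = brefl J x + (\<Sum>i\<in>J. ((x \<bullet> \<alpha> i) / hsq i) *\<^sub>R \<alpha> i)"
    by (subst brefl_def) (simp add: o sum_negf)
  also have "\<dots> = x" by (simp add: brefl_def)
  finally show "weight j \<bullet> brefl J (brefl J x) = weight j \<bullet> x" by simp
qed

fun alt :: "nat \<Rightarrow> 'n set \<Rightarrow> real^'n \<Rightarrow> real^'n" where
  "alt 0 J \<beta> = \<beta>"
| "alt (Suc n) J \<beta> = alt n (- J) (rotation \<alpha> J \<beta>)"

text \<open>If all alternating rotations stayed positive, their truncation would never act and the
  linear map \<open>g\<close> would keep the orbit positive. A fixed vector of \<open>g\<close> has
  equal projections to the spans of the two colour classes, so it is zero, and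
  \<open>exists_not_pos\<close> gives a contradiction.\<close>

lemma exists_alt_neg:
  assumes J: "colour_class \<alpha> J" and "\<beta> \<in> apr" shows "\<exists>n i. alt n J \<beta> = - \<alpha> i"
proof (rule ccontr)
  assume no: "\<not> ?thesis"
  have apr: "alt n J \<beta> \<in> apr" if "colour_class \<alpha> J" "\<beta> \<in> apr" for n J \<beta>
    using that
  proof (induction n arbitrary: J \<beta>)
    case (Suc n) then show ?case using rotation_bij[of J] colour_class_Compl[of J] bij_betwE by fastforce
  qed simp
  have p: "alt n J \<beta> \<in> pos" for n using apr[OF J assms(2), of n] no by (auto simp: apr_eq)
  define g where "g = brefl (- J) \<circ> brefl J"
  have rp: "rotation \<alpha> K \<gamma> = brefl K \<gamma>" if "\<gamma> \<in> pos" for K \<gamma> using that by (auto simp: rotation_eq)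
  have "alt (2 * k) J \<beta> = (g ^^ k) \<beta>" if "\<And>n. alt n J \<beta> \<in> pos" for k \<beta>
    using that
  proof (induction k arbitrary: \<beta>)
    case (Suc k)
    have b: "\<beta> \<in> pos" using Suc.prems[of 0] by simp
    have "rotation \<alpha> J \<beta> \<in> pos" using Suc.prems[of 1] by simp
    then have st: "alt (Suc (Suc n)) J \<beta> = alt n J (g \<beta>)" for n by (simp add: rp b g_def)
    then have "alt n J (g \<beta>) \<in> pos" for n using Suc.prems by metis
    from Suc.IH[OF this] have "alt (2 * k) J (g \<beta>) = (g ^^ Suc k) \<beta>" by (simp only: funpow_Suc_right o_apply)
    moreover have "alt (2 * Suc k) J \<beta> = alt (2 * k) J (g \<beta>)" using st[of "2 * k"] by simp
    ultimately show ?case by simp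
  qed simp
  from this[OF p] have gp: "(g ^^ k) \<beta> \<in> pos" for k using p by metis
  have "\<exists>n. (g ^^ n) \<beta> \<notin> pos"
  proof (rule exists_not_pos)
    show "linear g" unfolding g_def by (rule linear_compose[OF linear_brefl linear_brefl])
    show "\<And>x. x \<in> \<Phi> \<Longrightarrow> g x \<in> \<Phi>" using brefl_root[OF J] brefl_root[OF colour_class_Compl[OF J]] by (simp add: g_def)
    show "\<beta> \<in> \<Phi>" using p[of 0] pos_root by simp
    fix x assume "g x = x"
    then have "brefl J x = brefl (- J) x" using brefl_brefl[OF colour_class_Compl[OF J], of "brefl J x"] by (simp add: g_def)
    then have e: "(\<Sum>i\<in>J. ((x \<bullet> \<alpha> i) / hsq i) *\<^sub>R \<alpha> i) = (\<Sum>i\<in>- J. ((x \<bullet> \<alpha> i) / hsq i) *\<^sub>R \<alpha> i)"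
      by (simp add: brefl_def)
    have "\<alpha> j \<bullet> x = 0" for j
    proof -
      have w: "weight j \<bullet> (\<Sum>i\<in>K. ((x \<bullet> \<alpha> i) / hsq i) *\<^sub>R \<alpha> i) = (if j \<in> K then x \<bullet> \<alpha> j else 0)" for K
        by (simp add: inner_sum_right weight_simple if_distrib cong: if_cong)
      from arg_cong[OF e, of "\<lambda>z. weight j \<bullet> z"] show ?thesis unfolding w by (auto simp: inner_commute split: if_splits)
    qed
    then show "x = 0" by (rule eq_0_simple)
  qed
  then show False using gp by blast
qed

lemma span_Compl_iff: "\<beta> \<in> span (\<alpha> ` (- {i})) \<longleftrightarrow> weight i \<bullet> \<beta> = 0"
proof
  assume "\<beta> \<in> span (\<alpha> ` (- {i}))"
  then have "orthogonal (weight i) \<beta>"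
    by (rule orthogonal_to_span) (auto simp: orthogonal_def weight_simple split: if_splits)
  then show "weight i \<bullet> \<beta> = 0" by (simp add: orthogonal_def)
next
  assume w: "weight i \<bullet> \<beta> = 0"
  have "\<beta> = (\<Sum>j\<in>UNIV. ((weight j \<bullet> \<beta>) / hsq j) *\<^sub>R \<alpha> j)" by (rule simple_expand)
  also have "\<dots> = (\<Sum>j\<in>-{i}. ((weight j \<bullet> \<beta>) / hsq j) *\<^sub>R \<alpha> j)"
    by (rule sum.mono_neutral_right) (auto simp: w)
  also have "\<dots> \<in> span (\<alpha> ` (- {i}))" by (intro span_sum span_scale span_base) auto
  finally show "\<beta> \<in> span (\<alpha> ` (- {i}))" .
qed

text \<open>Rotate until the first root is negative simple, where \<open>cmp\<close> is the base
  rule of \<open>compatible\<close>, and rotate back; the colour class alternates on the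
  way.\<close>

lemma compatible_if_cmp:
  assumes J: "colour_class \<alpha> J" and "\<beta> \<in> apr" "\<gamma> \<in> apr" "\<beta> \<noteq> \<gamma>" "cmp (bip J) \<beta> \<gamma>"
  shows "compatible \<Phi> \<alpha> \<beta> \<gamma>"
proof -
  obtain n i where "alt n J \<beta> = - \<alpha> i" using exists_alt_neg[OF J assms(2)] by blast
  then show ?thesis using assms
  proof (induction n arbitrary: J \<beta> \<gamma>)
    case 0
    then have "weight i \<bullet> \<gamma> = 0" by (simp add: cmp_def)
    then show ?case using compatible.negative_simple[of \<gamma> \<Phi> \<alpha> i] 0 by (simp add: span_Compl_iff)
  next
    case (Suc n)
    let ?r = "rotation \<alpha> J"
    have b: "bij_betw ?r apr apr" by (rule rotation_bij[OF Suc.prems(2)])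
    have ne: "?r \<beta> \<noteq> ?r \<gamma>" using b Suc.prems unfolding bij_betw_def inj_on_def by blast
    have "cmp (bip (- J)) (?r \<beta>) (?r \<gamma>)"
      using cmp_rotation[OF Suc.prems(2-5)] cmp_bip_Compl[OF Suc.prems(2)] Suc.prems(6) by simp
    then have "compatible \<Phi> \<alpha> (?r \<beta>) (?r \<gamma>)"
      using Suc.IH[of "- J" "?r \<beta>" "?r \<gamma>"] Suc.prems ne colour_class_Compl b bij_betwE by fastforce
    then show ?case using compatible.rotate Suc.prems by blast
  qed
qed

end

section \<open>Independence of the colouring and transfer to positions\<close>

context coxeter_word
begin

lemma wd_support:
  assumes D: "\<And>i j. \<alpha> i \<bullet> \<alpha> j \<noteq> 0 \<Longrightarrow> i \<in> D \<longleftrightarrow> j \<in> D" and "\<And>j. j \<notin> D \<Longrightarrow> weight j \<bullet> x = 0" and "j \<notin> D"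
  shows "weight j \<bullet> wd S t x = 0"
  using assms(2,3)
proof (induction t arbitrary: x j)
  case (Suc t)
  have "weight k \<bullet> srefl i x = 0" if k: "k \<notin> D" for k i
  proof (cases "k = i")
    case False then show ?thesis using Suc.prems(1)[OF k] by (simp add: weight_refl)
  next
    case True
    have "\<alpha> k \<bullet> x = \<alpha> k \<bullet> (\<Sum>j\<in>UNIV. ((weight j \<bullet> x) / hsq j) *\<^sub>R \<alpha> j)" using simple_expand[of x] by simp
    also have "\<dots> = (\<Sum>j\<in>UNIV. (weight j \<bullet> x) / hsq j * (\<alpha> k \<bullet> \<alpha> j))" by (simp add: inner_sum_right)
    also have "\<dots> = 0"
    proof (rule sum.neutral, rule ballI)
      fix j show "(weight j \<bullet> x) / hsq j * (\<alpha> k \<bullet> \<alpha> j) = 0"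
        using D[of k j] k Suc.prems(1)[of j] by (cases "j \<in> D") auto
    qed
    finally show ?thesis using True Suc.prems(1)[OF k] by (simp add: weight_refl_self)
  qed
  then show ?case using Suc by simp
qed simp

text \<open>A root arises from a simple root by reflections, which do not leave a union of
  components.\<close>

lemma pos_support:
  assumes D: "\<And>i j. \<alpha> i \<bullet> \<alpha> j \<noteq> 0 \<Longrightarrow> i \<in> D \<longleftrightarrow> j \<in> D" and "\<gamma> \<in> pos"
  shows "(\<forall>j. j \<notin> D \<longrightarrow> weight j \<bullet> \<gamma> = 0) \<or> (\<forall>j. j \<in> D \<longrightarrow> weight j \<bullet> \<gamma> = 0)"
proof -
  have "\<gamma> \<in> oroot ` {t \<in> Ob. CARD('n) \<le> t}" using assms(2) by (simp only: oroot_image)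
  then obtain t where t: "t \<in> Ob" "CARD('n) \<le> t" "\<gamma> = oroot t" by auto
  have g: "\<gamma> = U {..<CARD('n)} t (\<alpha> (q t))" using r_F0[OF t(1,2)] t(3) by (simp add: rt_def)
  show ?thesis
  proof (cases "q t \<in> D")
    case True
    then have "weight j \<bullet> \<alpha> (q t) = 0" if "j \<notin> D" for j using that by (auto simp: weight_simple)
    from wd_support[OF D this] show ?thesis using g by blast
  next
    case False
    then have *: "weight j \<bullet> \<alpha> (q t) = 0" if "j \<notin> - D" for j using that by (auto simp: weight_simple)
    have D': "\<And>i j. \<alpha> i \<bullet> \<alpha> j \<noteq> 0 \<Longrightarrow> i \<in> - D \<longleftrightarrow> j \<in> - D" using D by blast
    have "weight j \<bullet> \<gamma> = 0" if "j \<notin> - D" for j unfolding g by (rule wd_support[OF D' * that])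
    then show ?thesis by blast
  qed
qed

text \<open>On a disconnected diagram two colourings may agree on some components and differ on
  others. The set \<open>D\<close> where they differ is a union of components; a root lives on one
  side of it, and there the arrows are either all kept or all reversed.\<close>

lemma cmp_colour:
  assumes J: "colour_class \<alpha> J" "colour_class \<alpha> J'" shows "cmp (bip J) \<beta> \<gamma> \<longleftrightarrow> cmp (bip J') \<beta> \<gamma>"
proof -
  define D where "D = {j. j \<in> J \<longleftrightarrow> j \<notin> J'}"
  have D: "i \<in> D \<longleftrightarrow> j \<in> D" if "\<alpha> i \<bullet> \<alpha> j \<noteq> 0" for i j
    using colour_class_adj[OF J(1), of i j] colour_class_adj[OF J(2), of i j] that by (cases "i = j") (auto simp: D_def)
  have "euler (bip J) \<beta> \<gamma> = euler (bip J') \<beta> \<gamma> \<and> euler (bip J) \<gamma> \<beta> = euler (bip J') \<gamma> \<beta> \<or>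
      euler (bip J) \<beta> \<gamma> = euler (bip J') \<gamma> \<beta> \<and> euler (bip J) \<gamma> \<beta> = euler (bip J') \<beta> \<gamma>"
    if p: "\<beta> \<in> pos" "\<gamma> \<in> pos"
  proof -
    consider (A) "\<And>j. j \<in> D \<Longrightarrow> weight j \<bullet> \<beta> = 0" | (B) "\<And>j. j \<in> D \<Longrightarrow> weight j \<bullet> \<gamma> = 0"
      | (C) "\<And>j. j \<notin> D \<Longrightarrow> weight j \<bullet> \<beta> = 0" "\<And>j. j \<notin> D \<Longrightarrow> weight j \<bullet> \<gamma> = 0"
      using pos_support[OF D p(1)] pos_support[OF D p(2)] by blast
    then show ?thesis
    proof cases
      case A
      have "bip J i < bip J j \<longleftrightarrow> bip J' i < bip J' j"
        if "\<alpha> i \<bullet> \<alpha> j \<noteq> 0" "weight i \<bullet> \<beta> \<noteq> 0 \<or> weight j \<bullet> \<beta> \<noteq> 0" for i j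
        using A[of i] A[of j] D[OF that(1)] that(2) by (auto simp: bip_def D_def)
      then show ?thesis by (intro disjI1 conjI euler_cong) auto
    next
      case B
      have "bip J i < bip J j \<longleftrightarrow> bip J' i < bip J' j"
        if "\<alpha> i \<bullet> \<alpha> j \<noteq> 0" "weight i \<bullet> \<gamma> \<noteq> 0 \<or> weight j \<bullet> \<gamma> \<noteq> 0" for i j
        using B[of i] B[of j] D[OF that(1)] that(2) by (auto simp: bip_def D_def)
      then show ?thesis by (intro disjI1 conjI euler_cong) auto
    next
      case C
      have "bip J i < bip J j \<longleftrightarrow> bip J' j < bip J' i"
        if "\<alpha> i \<bullet> \<alpha> j \<noteq> 0" "weight i \<bullet> \<gamma> \<noteq> 0 \<or> weight i \<bullet> \<beta> \<noteq> 0" for i j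
        using C(1)[of i] C(2)[of i] D[OF that(1)] that(2) by (auto simp: bip_def D_def)
      then show ?thesis by (intro disjI2 conjI euler_transpose) auto
    qed
  qed
  then show ?thesis unfolding cmp_def by metis
qed

lemma cmp_if_compatible:
  assumes J: "colour_class \<alpha> J" and "compatible \<Phi> \<alpha> \<beta> \<gamma>"
  shows "\<beta> \<in> apr \<and> \<gamma> \<in> apr \<and> \<beta> \<noteq> \<gamma> \<and> cmp (bip J) \<beta> \<gamma>"
  using assms(2)
proof (induction rule: compatible.induct)
  case (negative_simple \<beta> i)
  then have w: "weight i \<bullet> \<beta> = 0" by (simp add: span_Compl_iff)
  then have "\<beta> \<noteq> - \<alpha> i" by (auto simp: weight_simple)
  moreover have "cmp (bip J) (- \<alpha> i) \<beta>" using w by (auto simp: cmp_def weight_simple)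
  ultimately show ?case using negative_simple by auto
next
  case (rotate \<beta> \<gamma> K)
  then have ne: "\<beta> \<noteq> \<gamma>" by auto
  have "cmp (bip K) (rotation \<alpha> K \<beta>) (rotation \<alpha> K \<gamma>)" using rotate cmp_colour[OF J] by blast
  then have "cmp (bip K) \<beta> \<gamma>" using cmp_rotation[OF rotate.hyps(3)] rotate.hyps ne by blast
  then show ?case using rotate.hyps ne cmp_colour[OF J rotate.hyps(3)] by blast
qed

definition lab :: "nat \<Rightarrow> real^'n" where
  "lab t = (if t < CARD('n) then - \<alpha> (q t) else oroot t)"

lemma lab_bij: "bij_betw lab Ob apr"
proof -
  have "bij_betw lab ({..<CARD('n)} \<union> {t \<in> Ob. CARD('n) \<le> t}) (range (\<lambda>i. - \<alpha> i) \<union> pos)"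
  proof (rule bij_betw_combine)
    have "bij_betw (\<lambda>t. - \<alpha> (q t)) {..<CARD('n)} (range (\<lambda>i. - \<alpha> i))"
      using q_bij unfolding bij_betw_def by (auto simp: inj_on_def image_iff) (metis UNIV_I imageE)
    then show "bij_betw lab {..<CARD('n)} (range (\<lambda>i. - \<alpha> i))" by (subst bij_betw_cong[of _ _ "\<lambda>t. - \<alpha> (q t)"]) (auto simp: lab_def)
    show "bij_betw lab {t \<in> Ob. CARD('n) \<le> t} pos"
      using oroot_bij by (subst bij_betw_cong[of _ _ oroot]) (auto simp: lab_def)
  qed auto
  moreover have "{..<CARD('n)} \<union> {t \<in> Ob. CARD('n) \<le> t} = Ob" using initial_Ob by auto
  moreover have "range (\<lambda>i. - \<alpha> i) \<union> pos = apr" by (auto simp: apr_eq)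
  ultimately show ?thesis by simp
qed

lemma U_F0_Suc: assumes "t \<in> Ob" "CARD('n) \<le> t" shows "U {..<CARD('n)} (Suc t) (weight (q t)) = gv t"
proof -
  have "c (U {..<CARD('n)} (Suc t) (weight (q t))) = wd Ob (Suc t) (weight (q t))"
    using wd_Ob_eq[of "Suc t"] assms(2) by simp
  also have "\<dots> = wd Ob t (cox (hs Ob t) (weight (q t)))"
    using assms(1) cox_sink[OF sink_hs[OF pred_closed_Ob assms(1)]] by simp
  also have "\<dots> = c (gv t)" by (simp add: wd_cox_hs[OF pred_closed_Ob] wd_gv[OF assms(1)])
  finally show ?thesis by simp
qed

text \<open>For two representations one Euler value is nonnegative by the order of positions, and
  the other equals the pairing in \<open>compat\<close>, which is nonpositive. So \<open>cmp\<close>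
  holds exactly when that pairing is zero.\<close>

lemma compat_cmp_less:
  assumes "s \<in> Ob" "t \<in> Ob" "s < t" shows "compat s t \<longleftrightarrow> cmp \<eta> (lab s) (lab t)"
proof -
  have cp: "compat s t \<longleftrightarrow> gv t \<bullet> rt Ob s = 0" using assms(3) by (simp add: compat_def)
  consider "t < CARD('n)" | "s < CARD('n)" "CARD('n) \<le> t" | "CARD('n) \<le> s" using assms by linarith
  then show ?thesis
  proof cases
    case 1
    have F: "s \<in> {..<CARD('n)}" "t \<in> {..<CARD('n)}" using 1 assms by auto
    have "compat s t" by (rule facet_compat[OF facet_F0 F]) (use assms in auto)
    moreover have "q s \<noteq> q t" using ps_q[of s] ps_q[of t] 1 assms by auto
    ultimately show ?thesis using 1 assms by (simp add: lab_def cmp_neg_neg)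
  next
    case 2
    have "rt Ob s = pr (q s)" using rt_Ob[OF assms(1)] less_rank_iff[of s] 2 by simp
    also have "\<dots> = weight (q s) - c (weight (q s))" by (simp add: cox_weight)
    finally have "gv t \<bullet> rt Ob s = - (weight (q s) \<bullet> oroot t)"
      by (simp add: oroot_gv[OF 2(2)] inner_diff_right c_adjoint inner_commute[of "gv t"])
    then show ?thesis using 2 cp by (simp add: lab_def cmp_neg_pos oroot_pos[OF assms(2)])
  next
    case 3
    then have t: "CARD('n) \<le> t" using assms(3) by simp
    have ps: "oroot s \<in> pos" "oroot t \<in> pos" using oroot_pos assms(1,2) 3 t by auto
    have "c (oroot t) = gv t - c (gv t)" by (simp add: c_oroot[OF assms(2) t] rt_gv[OF assms(2)])
    then have "euler \<eta> (c (oroot s)) (c (oroot t)) = gv t \<bullet> c (oroot s)" by (simp add: euler_cox_diff)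
    then have "euler \<eta> (oroot s) (oroot t) = gv t \<bullet> c (oroot s)" by (simp only: euler_cox[OF height])
    then have e: "euler \<eta> (oroot s) (oroot t) = gv t \<bullet> rt Ob s" by (simp only: c_oroot[OF assms(1) 3])
    have "euler \<eta> (oroot t) (oroot s) = oroot s \<bullet> oroot t - gv t \<bullet> c (oroot s)"
      using euler_sym[OF height, of "oroot s" "oroot t"] e by (simp add: c_oroot[OF assms(1) 3])
    also have "\<dots> = - (gv t \<bullet> oroot s)"
      by (simp add: oroot_gv[OF t] inner_diff_right inner_commute[of "gv t"] c_adjoint)
    also have "gv t \<bullet> oroot s = weight (q t) \<bullet> Ui {..<CARD('n)} (Suc t) (oroot s)"
      using U_F0_Suc[OF assms(2) t] by (metis wd_adjoint)
    finally have "0 \<le> euler \<eta> (oroot t) (oroot s)"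
      using pos_weight[OF Ui_F0_neg[OF assms(1) 3, of "Suc t"], of "q t"] assms(3) by simp
    then show ?thesis using cp e gv_rt_nonpos[OF assms] 3 t by (auto simp: lab_def cmp_pos_pos[OF ps])
  qed
qed

lemma compat_cmp: assumes "s \<in> Ob" "t \<in> Ob" "s \<noteq> t" shows "compat s t \<longleftrightarrow> cmp \<eta> (lab s) (lab t)"
proof (cases "s < t")
  case True then show ?thesis using compat_cmp_less assms by blast
next
  case False
  then have "t < s" using assms(3) by simp
  then show ?thesis using compat_cmp_less[OF assms(2,1)] compat_sym[OF assms(3)] cmp_sym by blast
qed

lemma compatible_positions:
  obtains \<Theta> where "bij_betw \<Theta> apr Ob"
    "\<And>\<beta> \<gamma>. \<beta> \<in> apr \<Longrightarrow> \<gamma> \<in> apr \<Longrightarrow> \<beta> \<noteq> \<gamma> \<Longrightarrow> compatible \<Phi> \<alpha> \<beta> \<gamma> \<longleftrightarrow> compat (\<Theta> \<beta>) (\<Theta> \<gamma>)"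
proof -
  obtain J \<Xi> where J: "colour_class \<alpha> J" and \<Xi>: "bij_betw \<Xi> apr apr"
    and c: "\<And>\<beta> \<gamma>. \<beta> \<in> apr \<Longrightarrow> \<gamma> \<in> apr \<Longrightarrow> \<beta> \<noteq> \<gamma> \<Longrightarrow> cmp \<eta> \<beta> \<gamma> \<longleftrightarrow> cmp (bip J) (\<Xi> \<beta>) (\<Xi> \<gamma>)"
    using exists_bipartite[OF height] by blast
  let ?\<Psi> = "\<Xi> \<circ> lab"
  have b: "bij_betw ?\<Psi> Ob apr" by (rule bij_betw_trans[OF lab_bij \<Xi>])
  have key: "compatible \<Phi> \<alpha> (?\<Psi> s) (?\<Psi> t) \<longleftrightarrow> compat s t" if st: "s \<in> Ob" "t \<in> Ob" "s \<noteq> t" for s t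
  proof -
    have l: "lab s \<in> apr" "lab t \<in> apr" using lab_bij st bij_betwE by blast+
    have ln: "lab s \<noteq> lab t" using lab_bij st unfolding bij_betw_def inj_on_def by blast
    have P: "?\<Psi> s \<in> apr" "?\<Psi> t \<in> apr" "?\<Psi> s \<noteq> ?\<Psi> t" using b st unfolding bij_betw_def inj_on_def by blast+
    have "compatible \<Phi> \<alpha> (?\<Psi> s) (?\<Psi> t) \<longleftrightarrow> cmp (bip J) (?\<Psi> s) (?\<Psi> t)"
      using cmp_if_compatible[OF J] compatible_if_cmp[OF J P] by blast
    also have "\<dots> \<longleftrightarrow> compat s t" using c[OF l ln] compat_cmp[OF st] by simp
    finally show ?thesis .
  qed
  let ?\<Theta> = "inv_into Ob ?\<Psi>"
  have bt: "bij_betw ?\<Theta> apr Ob" by (rule bij_betw_inv_into[OF b])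
  show thesis
  proof (rule that[OF bt])
    fix \<beta> \<gamma> assume bg: "\<beta> \<in> apr" "\<gamma> \<in> apr" "\<beta> \<noteq> \<gamma>"
    have i: "?\<Psi> (?\<Theta> \<beta>) = \<beta>" "?\<Psi> (?\<Theta> \<gamma>) = \<gamma>" using bij_betw_inv_into_right[OF b] bg by blast+
    have "?\<Theta> \<beta> \<in> Ob" "?\<Theta> \<gamma> \<in> Ob" using bt bg bij_betwE by blast+
    moreover have "?\<Theta> \<beta> \<noteq> ?\<Theta> \<gamma>" using i bg(3) by metis
    ultimately show "compatible \<Phi> \<alpha> \<beta> \<gamma> \<longleftrightarrow> compat (?\<Theta> \<beta>) (?\<Theta> \<gamma>)" using key[of "?\<Theta> \<beta>" "?\<Theta> \<gamma>"] unfolding i by blast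
  qed
qed

end

subsection \<open>Simple polytopes from complete fans\<close>

lemma sum_in_convex_cone_hull:
  assumes "finite Y" "\<And>k. k \<in> Y \<Longrightarrow> 0 \<le> u k"
  shows "(\<Sum>k\<in>Y. u k *\<^sub>R g k) \<in> convex_cone hull (g ` Y)"
proof -
  have "(\<Sum>k\<in>K. u k *\<^sub>R g k) \<in> convex_cone hull (g ` Y)" if "K \<subseteq> Y" for K
    using finite_subset[OF that assms(1)] that
  proof (induction K rule: finite_induct)
    case empty then show ?case by (simp add: convex_cone_hull_contains_0)
  next
    case (insert k K)
    then show ?case using assms(2) by (simp add: convex_cone_hull_add convex_cone_hull_mul hull_inc)
  qed
  then show ?thesis by blast
qed

text \<open>The assumptions describe candidates for the vertices by their tight inequalities.
  \<open>cover\<close> is completeness of the fan, and \<open>exchange\<close> lets distinct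
  simplices be told apart by a vertex.\<close>

locale fan_polytope =
  fixes I :: "'i set" and g :: "'i \<Rightarrow> 'a::euclidean_space" and h :: "'i \<Rightarrow> real"
    and facets :: "'i set set" and vx :: "'i set \<Rightarrow> 'a"
  assumes finite_index: "finite I" and facets_subset: "F \<in> facets \<Longrightarrow> F \<subseteq> I"
    and vx_eq: "F \<in> facets \<Longrightarrow> t \<in> F \<Longrightarrow> g t \<bullet> vx F + h t = 0"
    and vx_gt: "F \<in> facets \<Longrightarrow> t \<in> I \<Longrightarrow> t \<notin> F \<Longrightarrow> 0 < g t \<bullet> vx F + h t"
    and cover: "\<exists>F\<in>facets. \<exists>u. (\<forall>k\<in>F. 0 \<le> u k) \<and> f = (\<Sum>k\<in>F. u k *\<^sub>R g k)"
    and exchange: "F \<in> facets \<Longrightarrow> a \<in> F \<Longrightarrow> \<exists>F'\<in>facets. F - {a} \<subseteq> F' \<and> a \<notin> F'"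
begin

definition ptope :: "'a set" where "ptope = {x. \<forall>t\<in>I. 0 \<le> g t \<bullet> x + h t}"

definition fc :: "'i set \<Rightarrow> 'a set" where "fc Y = {x \<in> ptope. \<forall>t\<in>Y. g t \<bullet> x + h t = 0}"

definition simplices :: "'i set set" where "simplices = {Y. \<exists>F\<in>facets. Y \<subseteq> F}"

lemma vx_poly: assumes "F \<in> facets" shows "vx F \<in> ptope"
proof -
  have "0 \<le> g t \<bullet> vx F + h t" if "t \<in> I" for t
    using vx_eq[OF assms, of t] vx_gt[OF assms that] by (cases "t \<in> F") auto
  then show ?thesis by (simp add: ptope_def)
qed

lemma vx_fc: "F \<in> facets \<Longrightarrow> Y \<subseteq> F \<Longrightarrow> vx F \<in> fc Y"
  using vx_poly vx_eq by (auto simp: fc_def)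

text \<open>The face on which a linear function is minimal is read off from the cone containing the function.\<close>

lemma minimizers:
  obtains F Y where "F \<in> facets" "Y \<subseteq> F" "f \<in> convex_cone hull (g ` Y)" "\<And>x. x \<in> ptope \<Longrightarrow> f \<bullet> vx F \<le> f \<bullet> x"
    "\<And>x. x \<in> ptope \<Longrightarrow> f \<bullet> x = f \<bullet> vx F \<longleftrightarrow> x \<in> fc Y"
proof -
  obtain F u where F: "F \<in> facets" "\<And>k. k \<in> F \<Longrightarrow> 0 \<le> u k" "f = (\<Sum>k\<in>F. u k *\<^sub>R g k)"
    using cover by blast
  have fin: "finite F" using finite_index facets_subset[OF F(1)] finite_subset by blast
  define Y where "Y = {k \<in> F. 0 < u k}"
  have "f = (\<Sum>k\<in>Y. u k *\<^sub>R g k)"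
    unfolding F(3) by (rule sum.mono_neutral_right) (use fin F(2) in \<open>auto simp: Y_def order_le_less\<close>)
  moreover have "finite Y" "\<And>k. k \<in> Y \<Longrightarrow> 0 \<le> u k" using fin by (auto simp: Y_def)
  ultimately have hull: "f \<in> convex_cone hull (g ` Y)" using sum_in_convex_cone_hull by metis
  have diff: "f \<bullet> x - f \<bullet> vx F = (\<Sum>k\<in>F. u k * (g k \<bullet> x + h k))" for x
  proof -
    have "f \<bullet> x - f \<bullet> vx F = (\<Sum>k\<in>F. u k * (g k \<bullet> x) - u k * (g k \<bullet> vx F))"
      by (simp add: F(3) inner_sum_left sum_subtractf)
    also have "\<dots> = (\<Sum>k\<in>F. u k * (g k \<bullet> x + h k))"
    proof (rule sum.cong)
      fix k assume "k \<in> F"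
      then have "g k \<bullet> vx F = - h k" using vx_eq[OF F(1)] by (simp add: add_eq_0_iff)
      then show "u k * (g k \<bullet> x) - u k * (g k \<bullet> vx F) = u k * (g k \<bullet> x + h k)" by (simp add: algebra_simps)
    qed simp
    finally show ?thesis .
  qed
  have nn: "0 \<le> u k * (g k \<bullet> x + h k)" if "x \<in> ptope" "k \<in> F" for x k
    using that F(2) facets_subset[OF F(1)] by (auto simp: ptope_def)
  have "f \<bullet> vx F \<le> f \<bullet> x" if "x \<in> ptope" for x
    using diff[of x] sum_nonneg[of F "\<lambda>k. u k * (g k \<bullet> x + h k)"] nn[OF that] by simp
  moreover have "f \<bullet> x = f \<bullet> vx F \<longleftrightarrow> x \<in> fc Y" if "x \<in> ptope" for x
  proof -
    have "f \<bullet> x = f \<bullet> vx F \<longleftrightarrow> (\<Sum>k\<in>F. u k * (g k \<bullet> x + h k)) = 0" using diff[of x] by auto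
    also have "\<dots> \<longleftrightarrow> (\<forall>k\<in>F. u k * (g k \<bullet> x + h k) = 0)"
      by (rule sum_nonneg_eq_0_iff[OF fin nn[OF that]])
    also have "\<dots> \<longleftrightarrow> x \<in> fc Y" using that F(2) by (auto simp: fc_def Y_def order_le_less)
    finally show ?thesis .
  qed
  moreover have "Y \<subseteq> F" by (auto simp: Y_def)
  ultimately show thesis using that[OF F(1) _ hull] by blast
qed

text \<open>Every linear function attains a minimum by \<open>minimizers\<close>; boundedness
  follows from the functions given by the basis vectors and their negatives.\<close>

lemma bounded_poly: "bounded ptope"
proof -
  have "\<exists>B. \<forall>x\<in>ptope. B \<le> f \<bullet> x" for f by (rule minimizers[of f]) blast
  then obtain B where B: "\<And>f x. x \<in> ptope \<Longrightarrow> B f \<le> f \<bullet> x" by metis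
  have "norm x \<le> (\<Sum>b\<in>Basis. \<bar>B b\<bar> + \<bar>B (- b)\<bar>)" if x: "x \<in> ptope" for x
  proof -
    have "norm x \<le> (\<Sum>b\<in>Basis. \<bar>x \<bullet> b\<bar>)" by (rule norm_le_l1)
    also have "\<dots> \<le> (\<Sum>b\<in>Basis. \<bar>B b\<bar> + \<bar>B (- b)\<bar>)"
    proof (rule sum_mono)
      fix b
      have "B b \<le> b \<bullet> x" "B (- b) \<le> - (b \<bullet> x)" using B[OF x, of b] B[OF x, of "- b"] by auto
      then show "\<bar>x \<bullet> b\<bar> \<le> \<bar>B b\<bar> + \<bar>B (- b)\<bar>" by (simp add: inner_commute)
    qed
    finally show ?thesis .
  qed
  then show ?thesis unfolding bounded_iff by blast
qed

lemma polyhedron_poly: "polyhedron ptope"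
proof -
  have "ptope = \<Inter>((\<lambda>t. {x. - h t \<le> g t \<bullet> x}) ` I)" by (force simp: ptope_def)
  then show ?thesis using finite_index by (auto intro!: polyhedron_Inter simp: polyhedron_halfspace_ge)
qed

lemma polytope_poly: "polytope ptope"
  using polyhedron_poly bounded_poly by (simp add: polytope_eq_bounded_polyhedron)

lemma fc_face: assumes "Y \<subseteq> I" shows "fc Y face_of ptope"
proof (cases "Y = {}")
  case True
  then have "fc Y = ptope" by (auto simp: fc_def)
  then show ?thesis using polyhedron_poly by (simp add: face_of_refl polyhedron_imp_convex)
next
  case False
  have "fc Y = \<Inter>((\<lambda>t. ptope \<inter> {x. g t \<bullet> x = - h t}) ` Y)"
    using False by (auto simp: fc_def add_eq_0_iff)
  moreover have "ptope \<inter> {x. g t \<bullet> x = - h t} face_of ptope" if "t \<in> Y" for t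
  proof (rule face_of_Int_supporting_hyperplane_ge)
    show "convex ptope" using polyhedron_poly by (rule polyhedron_imp_convex)
    fix x assume "x \<in> ptope"
    then have "0 \<le> g t \<bullet> x + h t" using that assms by (auto simp: ptope_def)
    then show "g t \<bullet> x \<ge> - h t" by simp
  qed
  ultimately show ?thesis using face_of_Inter[of "(\<lambda>t. ptope \<inter> {x. g t \<bullet> x = - h t}) ` Y" ptope] False by auto
qed

text \<open>For \<open>k\<close> in \<open>Z\<close> but not in \<open>Y\<close>,
  \<open>exchange\<close> supplies a facet that contains \<open>Y\<close> and avoids
  \<open>k\<close>; its vertex lies on \<open>fc Y\<close> and off \<open>fc Z\<close>.\<close>

lemma fc_subset_iff: assumes "Y \<in> simplices" "Z \<in> simplices" shows "fc Y \<subseteq> fc Z \<longleftrightarrow> Z \<subseteq> Y"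
proof
  assume sub: "fc Y \<subseteq> fc Z"
  show "Z \<subseteq> Y"
  proof
    fix k assume k: "k \<in> Z"
    show "k \<in> Y"
    proof (rule ccontr)
      assume kY: "k \<notin> Y"
      obtain F where F: "F \<in> facets" "Y \<subseteq> F" using assms by (auto simp: simplices_def)
      have "\<exists>F'\<in>facets. Y \<subseteq> F' \<and> k \<notin> F'"
      proof (cases "k \<in> F")
        case True
        then obtain F' where "F' \<in> facets" "F - {k} \<subseteq> F'" "k \<notin> F'" using exchange[OF F(1)] by blast
        then show ?thesis using F(2) kY by blast
      qed (use F in blast)
      then obtain F' where F': "F' \<in> facets" "Y \<subseteq> F'" "k \<notin> F'" by blast
      have "k \<in> I" using assms k facets_subset by (auto simp: simplices_def)
      then have "0 < g k \<bullet> vx F' + h k" using vx_gt[OF F'(1)] F'(3) by blast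
      moreover have "vx F' \<in> fc Z" using vx_fc[OF F'(1,2)] sub by blast
      ultimately show False using k by (auto simp: fc_def)
    qed
  qed
qed (auto simp: fc_def)

lemma face_is_fc: assumes "T face_of ptope" "T \<noteq> {}" shows "\<exists>Y\<in>simplices. T = fc Y"
proof -
  have "T exposed_face_of ptope" using assms exposed_face_of_polyhedron[OF polyhedron_poly] by blast
  then obtain a b where ab: "ptope \<subseteq> {x. a \<bullet> x \<le> b}" "T = ptope \<inter> {x. a \<bullet> x = b}"
    unfolding exposed_face_of_def by blast
  \<comment> \<open>An exposed face is given by maximizing \<open>a\<close>, whereas
    \<open>minimizers\<close> speaks of minima, hence the sign.\<close>
  obtain F Y where FY: "F \<in> facets" "Y \<subseteq> F" "- a \<in> convex_cone hull (g ` Y)" "\<And>x. x \<in> ptope \<Longrightarrow> (- a) \<bullet> vx F \<le> (- a) \<bullet> x"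
    "\<And>x. x \<in> ptope \<Longrightarrow> (- a) \<bullet> x = (- a) \<bullet> vx F \<longleftrightarrow> x \<in> fc Y"
    by (rule minimizers[of "- a"], rule that)
  obtain z where z: "z \<in> T" using assms by blast
  have "a \<bullet> vx F \<le> b" using ab(1) vx_poly[OF FY(1)] by blast
  moreover have "b \<le> a \<bullet> vx F" using FY(4)[of z] z ab(2) by auto
  ultimately have b: "b = a \<bullet> vx F" by simp
  have "T = fc Y"
  proof (intro set_eqI iffI)
    fix x assume "x \<in> T"
    then show "x \<in> fc Y" using FY(5)[of x] ab(2) b by auto
  next
    fix x assume x: "x \<in> fc Y"
    then have "x \<in> ptope" by (simp add: fc_def)
    then show "x \<in> T" using FY(5)[of x] x ab(2) b by auto
  qed
  then show ?thesis using FY by (auto simp: simplices_def)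
qed

lemma faces_eq: "{T. T face_of ptope \<and> T \<noteq> {}} = fc ` simplices"
proof (intro set_eqI iffI)
  fix T assume "T \<in> fc ` simplices"
  then obtain Y F where "T = fc Y" "F \<in> facets" "Y \<subseteq> F" by (auto simp: simplices_def)
  then show "T \<in> {T. T face_of ptope \<and> T \<noteq> {}}" using fc_face facets_subset vx_fc by blast
qed (use face_is_fc in blast)

lemma bij_faces: "bij_betw fc simplices {T. T face_of ptope \<and> T \<noteq> {}}"
  unfolding bij_betw_def faces_eq inj_on_def using fc_subset_iff by (metis order_antisym order_refl)

text \<open>A normal \<open>f\<close> lies in the cone of some \<open>Z\<close> whose face is the
  set of all minimizers of \<open>f\<close>. That face contains \<open>fc Y\<close>, so
  \<open>Z\<close> is contained in \<open>Y\<close>.\<close>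

lemma normal_cone_fc: assumes "Y \<in> simplices" shows "normal_cone UNIV ptope (fc Y) = convex_cone hull (g ` Y)"
proof
  obtain F where F: "F \<in> facets" "Y \<subseteq> F" using assms by (auto simp: simplices_def)
  have "g t \<in> normal_cone UNIV ptope (fc Y)" if "t \<in> Y" for t
  proof -
    have "t \<in> I" using that F facets_subset by blast
    have "g t \<bullet> x \<le> g t \<bullet> y" if "x \<in> fc Y" "y \<in> ptope" for x y
    proof -
      have "g t \<bullet> x + h t = 0" "0 \<le> g t \<bullet> y + h t"
        using that \<open>t \<in> I\<close> \<open>t \<in> Y\<close> by (auto simp: fc_def ptope_def)
      then show ?thesis by simp
    qed
    then show ?thesis by (simp add: normal_cone_def)
  qed
  moreover have "convex_cone (normal_cone UNIV ptope (fc Y))"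
    unfolding convex_cone_iff by (auto simp: normal_cone_def inner_add_left add_mono mult_left_mono)
  ultimately show "convex_cone hull (g ` Y) \<subseteq> normal_cone UNIV ptope (fc Y)" by (intro hull_minimal) auto
  show "normal_cone UNIV ptope (fc Y) \<subseteq> convex_cone hull (g ` Y)"
  proof
    fix f assume f: "f \<in> normal_cone UNIV ptope (fc Y)"
    obtain G Z where G: "G \<in> facets" "Z \<subseteq> G" "f \<in> convex_cone hull (g ` Z)" "\<And>x. x \<in> ptope \<Longrightarrow> f \<bullet> vx G \<le> f \<bullet> x"
      "\<And>x. x \<in> ptope \<Longrightarrow> f \<bullet> x = f \<bullet> vx G \<longleftrightarrow> x \<in> fc Z"
      by (rule minimizers[of f], rule that)
    have "fc Y \<subseteq> fc Z"
    proof
      fix x assume x: "x \<in> fc Y"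
      then have xp: "x \<in> ptope" by (simp add: fc_def)
      have "f \<bullet> x \<le> f \<bullet> vx G" using f x vx_poly[OF G(1)] by (auto simp: normal_cone_def)
      then show "x \<in> fc Z" using G(4,5)[OF xp] by simp
    qed
    then have "Z \<subseteq> Y" using fc_subset_iff[OF assms] G(1,2) by (auto simp: simplices_def)
    then show "f \<in> convex_cone hull (g ` Y)" using G(3) hull_mono[of "g ` Z" "g ` Y"] by blast
  qed
qed

lemma normal_fan_poly: "normal_fan UNIV ptope = (\<lambda>Y. convex_cone hull (g ` Y)) ` simplices"
proof -
  have "normal_fan UNIV ptope = normal_cone UNIV ptope ` {T. T face_of ptope \<and> T \<noteq> {}}"
    by (auto simp: normal_fan_def)
  also have "\<dots> = (\<lambda>Y. convex_cone hull (g ` Y)) ` simplices"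
    unfolding faces_eq image_image by (rule image_cong) (auto simp: normal_cone_fc)
  finally show ?thesis .
qed

end

context root_basis
begin

lemma exists_word: assumes "height \<eta>" obtains q where "coxeter_word \<Phi> \<alpha> \<eta> q"
proof -
  obtain l :: "'n list" where l: "set l = UNIV" "distinct l" using finite_distinct_list[OF finite] by blast
  define xs where "xs = sort_key \<eta> l"
  have xs: "set xs = UNIV" "distinct xs" "sorted (map \<eta> xs)" using l by (simp_all add: xs_def)
  have len: "length xs = CARD('n)" using distinct_card[OF xs(2)] xs(1) by simp
  define q where "q t = xs ! (t mod CARD('n))" for t
  have "coxeter_word \<Phi> \<alpha> \<eta> q"
  proof
    show "height \<eta>" by fact
    have "bij_betw ((!) xs) {..<CARD('n)} UNIV" using bij_betw_nth[OF xs(2), of "{..<CARD('n)}" UNIV] len xs(1) by simp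
    then show "bij_betw q {..<CARD('n)} UNIV" by (subst bij_betw_cong[of _ _ "(!) xs"]) (auto simp: q_def)
    show "q (t mod CARD('n)) = q t" for t by (simp add: q_def)
    fix a b assume ab: "a < CARD('n)" "b < CARD('n)" "\<eta> (q a) < \<eta> (q b)"
    show "a < b"
    proof (rule ccontr)
      assume "\<not> a < b"
      then have "\<eta> (xs ! b) \<le> \<eta> (xs ! a)" using sorted_nth_mono[OF xs(3), of b a] ab len by simp
      then show False using ab by (simp add: q_def)
    qed
  qed
  then show thesis by (rule that)
qed

end

section \<open>Mesh coordinates as affine functions of the initial coordinates\<close>

context coxeter_word
begin

definition offset :: "(nat \<Rightarrow> real) \<Rightarrow> nat \<Rightarrow> real" where
  "offset b N = - (\<Sum>k | k \<in> Ob \<and> CARD('n) \<le> k \<and> k \<le> N. b k * (gv N \<bullet> oroot k))"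

text \<open>The function \<open>ell\<close> expressed in the initial coordinates
  \<open>x $ i = weight i \<bullet> \<xi>\<close>; its linear part is the g-vector in the basis of
  the weights.\<close>

definition ev :: "(nat \<Rightarrow> real) \<Rightarrow> real^'n \<Rightarrow> nat \<Rightarrow> real" where
  "ev b x t = gco (gv t) \<bullet> x + offset b t"

lemma gco_inner_sum: "gco v \<bullet> x = (\<Sum>i\<in>UNIV. (\<alpha> i \<bullet> v) * x $ i / hsq i)"
proof -
  have "gco v \<bullet> x = (\<Sum>i\<in>UNIV. gco v $ i \<bullet> x $ i)" by (rule inner_vec_def)
  then show ?thesis by (simp add: gco_def)
qed

lemma gco_inner: "gco v \<bullet> (\<chi> i. weight i \<bullet> \<xi>) = v \<bullet> \<xi>"
  by (simp add: gco_inner_sum inner_expand[of v \<xi>])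

lemma linear_gco: "linear gco"
  by (rule linearI) (simp_all add: gco_def vec_eq_iff inner_add_right add_divide_distrib)

lemma fan_polytope:
  assumes b: "\<And>k. k \<in> Ob \<Longrightarrow> CARD('n) \<le> k \<Longrightarrow> 0 < b k"
  shows "fan_polytope Ob (\<lambda>t. gco (gv t)) (offset b) {F. facet F} (\<lambda>F. \<chi> i. weight i \<bullet> vert b F)"
proof
  show "finite Ob" by (rule finite_Ob)
  show "F \<subseteq> Ob" if "F \<in> {F. facet F}" for F using that facet_Ob by simp
  have e: "gco (gv t) \<bullet> (\<chi> i. weight i \<bullet> vert b F) + offset b t = ell b t (vert b F)" for t F
    by (simp add: gco_inner ell_def offset_def)
  show "gco (gv t) \<bullet> (\<chi> i. weight i \<bullet> vert b F) + offset b t = 0" if "F \<in> {F. facet F}" "t \<in> F" for F t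
    using ell_vert[of F t b] that by (simp only: e mem_Collect_eq)
  show "0 < gco (gv t) \<bullet> (\<chi> i. weight i \<bullet> vert b F) + offset b t"
    if "F \<in> {F. facet F}" "t \<in> Ob" "t \<notin> F" for F t
    unfolding e using ell_vert_nonneg[where b = b and F = F and N = t, OF b] that
    by (metis mem_Collect_eq order_le_less)
  show "\<exists>F\<in>{F. facet F}. \<exists>u. (\<forall>k\<in>F. 0 \<le> u k) \<and> f = (\<Sum>k\<in>F. u k *\<^sub>R gco (gv k))" for f
  proof -
    define v where "v = (\<Sum>i\<in>UNIV. f $ i *\<^sub>R weight i)"
    have f: "gco v = f"
      by (simp add: v_def gco_def vec_eq_iff inner_sum_right simple_weight if_distrib cong: if_cong)
    show ?thesis
    proof (rule cone_cover[of v])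
      fix F u assume F: "facet F" "\<And>k. k \<in> F \<Longrightarrow> (0::real) \<le> u k" "v = (\<Sum>k\<in>F. u k *\<^sub>R gv k)"
      have "f = (\<Sum>k\<in>F. u k *\<^sub>R gco (gv k))"
        by (simp add: f[symmetric] F(3) linear_sum[OF linear_gco] linear_scale[OF linear_gco])
      then show ?thesis using F by blast
    qed
  qed
  show "\<exists>F'\<in>{F. facet F}. F - {a} \<subseteq> F' \<and> a \<notin> F'" if "F \<in> {F. facet F}" "a \<in> F" for F a
    using that facet_flip[of F a] star_neq[of F a] by (intro bexI[of _ "flip F a"]) (auto simp: flip_def)
qed

lemma ev_init: "ev b x (pt 0 i) = x $ i"
proof -
  have lt: "pt 0 i < CARD('n)" using less_rank_iff[of "pt 0 i"] by simp
  then have "offset b (pt 0 i) = 0" unfolding offset_def by (auto intro!: sum.neutral)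
  moreover have "gco (weight i) \<bullet> x = x $ i"
    by (simp add: gco_inner_sum simple_weight if_distrib if_distribR cong: if_cong)
  ultimately show ?thesis using gv_init[OF lt] by (simp add: ev_def)
qed

lemma U_stable:
  assumes "s \<le> t" "\<And>k. k \<in> S \<Longrightarrow> s \<le> k \<Longrightarrow> k < t \<Longrightarrow> q k \<noteq> i"
  shows "wd S t (weight i) = wd S s (weight i)"
  using assms by (induction t rule: dec_induct) (auto simp: refl_weight)

text \<open>As long as the letter \<open>q p\<close> is not read again, the prefix product keeps the
  image of its weight. So both vectors are images under the same isometry, of a weight and of a
  different simple root.\<close>

lemma gv_oroot_0:
  assumes "p \<in> Ob" "k \<in> Ob" "p < k" "CARD('n) \<le> k" "\<And>t. t \<in> Ob \<Longrightarrow> p < t \<Longrightarrow> t \<le> k \<Longrightarrow> q t \<noteq> q p"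
  shows "gv p \<bullet> oroot k = 0"
proof -
  have "U {..<CARD('n)} k (weight (q p)) = gv p"
  proof (cases "CARD('n) \<le> p")
    case True
    have "U {..<CARD('n)} k (weight (q p)) = U {..<CARD('n)} (Suc p) (weight (q p))"
      by (rule U_stable) (use assms in auto)
    then show ?thesis using U_F0_Suc[OF assms(1) True] by simp
  next
    case False
    have "U {..<CARD('n)} k (weight (q p)) = U {..<CARD('n)} CARD('n) (weight (q p))"
      by (rule U_stable) (use assms False in auto)
    then show ?thesis using False gv_init[of p] by (simp add: U_F0_init)
  qed
  moreover have "oroot k = U {..<CARD('n)} k (\<alpha> (q k))" using r_F0[OF assms(2,4)] by (simp add: rt_def)
  ultimately have "gv p \<bullet> oroot k = weight (q p) \<bullet> \<alpha> (q k)" by (metis wd_inner)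
  then show ?thesis using assms(5)[OF assms(2,3)] by (simp add: weight_simple)
qed

lemma gv_oroot_self: assumes "N \<in> Ob" "CARD('n) \<le> N" shows "gv N \<bullet> oroot N = - hsq (q N)"
proof -
  have "gv N = U {..<CARD('n)} N (srefl (q N) (weight (q N)))" using U_F0_Suc[OF assms] assms by simp
  moreover have "oroot N = U {..<CARD('n)} N (\<alpha> (q N))" using r_F0[OF assms] by (simp add: rt_def)
  ultimately have "gv N \<bullet> oroot N = srefl (q N) (weight (q N)) \<bullet> \<alpha> (q N)" by simp
  then show ?thesis by (simp add: refl_adjoint weight_simple)
qed

lemma gv_mesh:
  "gv (pt k i) + gv (pt (Suc k) i) =
    (\<Sum>j | \<eta> j < \<eta> i. cf j i *\<^sub>R gv (pt (Suc k) j)) + (\<Sum>j | \<eta> i < \<eta> j. cf j i *\<^sub>R gv (pt k j))"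
proof -
  have g: "gv (pt l j) = (c ^^ l) (weight j)" for l j by (simp add: gv_def)
  have "gv (pt k i) + gv (pt (Suc k) i) = (c ^^ k) (weight i + c (weight i))"
    unfolding g by (simp add: linear_add[OF linear_cpow] funpow_swap1)
  also have "\<dots> = (\<Sum>j | \<eta> j < \<eta> i. cf j i *\<^sub>R (c ^^ k) (c (weight j))) + (\<Sum>j | \<eta> i < \<eta> j. cf j i *\<^sub>R (c ^^ k) (weight j))"
    unfolding cox_mesh[OF height]
    by (simp add: linear_add[OF linear_cpow] linear_sum[OF linear_cpow] linear_scale[OF linear_cpow])
  finally show ?thesis unfolding g by (simp add: funpow_swap1)
qed

text \<open>All other positions of the mesh are followed by no further occurrence of their letter
  before \<open>?N\<close>. By \<open>gv_oroot_0\<close> their offsets are then values of one linear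
  map \<open>- H\<close> at their g-vectors, so the relation follows from \<open>gv_mesh\<close>;
  the inhomogeneous term is the one extra summand of the offset at \<open>?N\<close> itself.\<close>

lemma ev_mesh:
  assumes N: "pt (Suc k) i \<in> Ob"
  shows "ev b x (pt k i) + ev b x (pt (Suc k) i) =
    (\<Sum>j | \<eta> j < \<eta> i. cf j i * ev b x (pt (Suc k) j)) + (\<Sum>j | \<eta> i < \<eta> j. cf j i * ev b x (pt k j)) +
    b (pt (Suc k) i) * hsq i"
proof -
  let ?N = "pt (Suc k) i"
  let ?K = "{l. l \<in> Ob \<and> CARD('n) \<le> l \<and> l < ?N}"
  have fin: "finite ?K" using finite_Ob by simp
  have NC: "CARD('n) \<le> ?N" using less_rank_iff[of ?N] by (metis linorder_not_less nat.distinct(1) pt_div)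
  define H where "H v = (\<Sum>l\<in>?K. b l * (v \<bullet> oroot l))" for v
  have H_lin: "linear H"
    by (rule linearI) (simp_all add: H_def inner_add_left distrib_left sum.distrib sum_distrib_left mult_ac)
  have off: "offset b p = - H (gv p)"
    if p: "p \<in> Ob" "p < ?N" "\<And>t. t \<in> Ob \<Longrightarrow> p < t \<Longrightarrow> t < ?N \<Longrightarrow> q t \<noteq> q p" for p
  proof -
    have "(\<Sum>l | l \<in> Ob \<and> CARD('n) \<le> l \<and> l \<le> p. b l * (gv p \<bullet> oroot l)) = H (gv p)"
      unfolding H_def
    proof (rule sum.mono_neutral_left)
      show "\<forall>l\<in>?K - {l. l \<in> Ob \<and> CARD('n) \<le> l \<and> l \<le> p}. b l * (gv p \<bullet> oroot l) = 0"
      proof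
        fix l assume l: "l \<in> ?K - {l. l \<in> Ob \<and> CARD('n) \<le> l \<and> l \<le> p}"
        then have "gv p \<bullet> oroot l = 0" by (intro gv_oroot_0) (use p in auto)
        then show "b l * (gv p \<bullet> oroot l) = 0" by simp
      qed
    qed (use fin p(2) in auto)
    then show ?thesis by (simp add: offset_def)
  qed
  have offN: "offset b ?N = - H (gv ?N) + b ?N * hsq i"
  proof -
    have "{l. l \<in> Ob \<and> CARD('n) \<le> l \<and> l \<le> ?N} = insert ?N ?K" using N NC by auto
    then have "(\<Sum>l | l \<in> Ob \<and> CARD('n) \<le> l \<and> l \<le> ?N. b l * (gv ?N \<bullet> oroot l)) = b ?N * (gv ?N \<bullet> oroot ?N) + H (gv ?N)"
      using fin by (simp add: H_def)
    then show ?thesis using gv_oroot_self[OF N NC] by (simp add: offset_def)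
  qed
  have next_occ: "q t \<noteq> j" if "pt l j < t" "t < ?N" "?N \<le> pt (Suc l) j" for t l j
  proof
    assume "q t = j"
    then have t: "t = pt (t div CARD('n)) j" using pt_q[of t] by simp
    have "l < t div CARD('n)" using that(1) t by (metis less_irrefl pt_less)
    moreover have "t div CARD('n) < Suc l" using that(2,3) t by (metis less_irrefl less_le_trans pt_less)
    ultimately show False by simp
  qed
  have cl: "pred_closed Ob" by (rule pred_closed_Ob)
  have o1: "offset b (pt k i) = - H (gv (pt k i))"
  proof (rule off)
    show "pt k i \<in> Ob" using pred_closed_row[OF cl N, of k] by simp
    show "pt k i < ?N" by (simp add: pt_less)
    show "\<And>t. t \<in> Ob \<Longrightarrow> pt k i < t \<Longrightarrow> t < ?N \<Longrightarrow> q t \<noteq> q (pt k i)" using next_occ[of k i] by auto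
  qed
  have o2: "cf j i * offset b (pt (Suc k) j) = - cf j i * H (gv (pt (Suc k) j))" if j: "\<eta> j < \<eta> i" for j
  proof (cases "cf j i = 0")
    case False
    then have a: "\<alpha> i \<bullet> \<alpha> j \<noteq> 0" by (simp add: cf_eq_0_iff inner_commute)
    have "offset b (pt (Suc k) j) = - H (gv (pt (Suc k) j))"
    proof (rule off)
      show "pt (Suc k) j \<in> Ob" using cl N a j unfolding pred_closed_def by blast
      show "pt (Suc k) j < ?N" using ps_mono[OF j] by (simp add: pt_less)
      have "?N < pt (Suc (Suc k)) j" by (simp add: pt_less)
      then show "\<And>t. t \<in> Ob \<Longrightarrow> pt (Suc k) j < t \<Longrightarrow> t < ?N \<Longrightarrow> q t \<noteq> q (pt (Suc k) j)"
        using next_occ[of "Suc k" j] by simp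
    qed
    then show ?thesis by simp
  qed simp
  have o3: "cf j i * offset b (pt k j) = - cf j i * H (gv (pt k j))" if j: "\<eta> i < \<eta> j" for j
  proof (cases "cf j i = 0")
    case False
    then have a: "\<alpha> i \<bullet> \<alpha> j \<noteq> 0" by (simp add: cf_eq_0_iff inner_commute)
    have "offset b (pt k j) = - H (gv (pt k j))"
    proof (rule off)
      have "pt (Suc k - 1) j \<in> Ob" using cl N a j unfolding pred_closed_def by (metis zero_less_Suc)
      then show "pt k j \<in> Ob" by simp
      show "pt k j < ?N" by (simp add: pt_less)
      have "?N < pt (Suc k) j" using ps_mono[OF j] by (simp add: pt_less)
      then show "\<And>t. t \<in> Ob \<Longrightarrow> pt k j < t \<Longrightarrow> t < ?N \<Longrightarrow> q t \<noteq> q (pt k j)" using next_occ[of k j] by simp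
    qed
    then show ?thesis by simp
  qed simp
  have G: "gco (gv (pt k i)) \<bullet> x + gco (gv ?N) \<bullet> x =
      (\<Sum>j | \<eta> j < \<eta> i. cf j i * (gco (gv (pt (Suc k) j)) \<bullet> x)) + (\<Sum>j | \<eta> i < \<eta> j. cf j i * (gco (gv (pt k j)) \<bullet> x))"
    using arg_cong[OF gv_mesh[of k i], of "\<lambda>v. gco v \<bullet> x"]
    by (simp add: linear_add[OF linear_gco] linear_sum[OF linear_gco] linear_scale[OF linear_gco] inner_add_left inner_sum_left)
  have HH: "H (gv (pt k i)) + H (gv ?N) =
      (\<Sum>j | \<eta> j < \<eta> i. cf j i * H (gv (pt (Suc k) j))) + (\<Sum>j | \<eta> i < \<eta> j. cf j i * H (gv (pt k j)))"
    using arg_cong[OF gv_mesh[of k i], of H]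
    by (simp add: linear_add[OF H_lin] linear_sum[OF H_lin] linear_scale[OF H_lin])
  have s2: "(\<Sum>j | \<eta> j < \<eta> i. cf j i * ev b x (pt (Suc k) j)) =
      (\<Sum>j | \<eta> j < \<eta> i. cf j i * (gco (gv (pt (Suc k) j)) \<bullet> x)) - (\<Sum>j | \<eta> j < \<eta> i. cf j i * H (gv (pt (Suc k) j)))"
    by (subst sum_subtractf[symmetric], rule sum.cong) (auto simp: ev_def distrib_left o2)
  have s3: "(\<Sum>j | \<eta> i < \<eta> j. cf j i * ev b x (pt k j)) =
      (\<Sum>j | \<eta> i < \<eta> j. cf j i * (gco (gv (pt k j)) \<bullet> x)) - (\<Sum>j | \<eta> i < \<eta> j. cf j i * H (gv (pt k j)))"
    by (subst sum_subtractf[symmetric], rule sum.cong) (auto simp: ev_def distrib_left o3)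
  show ?thesis unfolding s2 s3 using G HH o1 offN by (simp add: ev_def)
qed

end

context coxeter_word
begin

subsection \<open>Dimension vectors\<close>

definition rootv :: "real^'n \<Rightarrow> real^'n" where "rootv x = (\<Sum>i\<in>UNIV. x $ i *\<^sub>R \<alpha> i)"

lemma weight_rootv: "weight i \<bullet> rootv x = hsq i * x $ i"
  by (simp add: rootv_def inner_sum_right weight_simple if_distrib cong: if_cong)

lemma rootv_eq_0: "rootv x = 0 \<Longrightarrow> x = 0"
proof -
  assume "rootv x = 0"
  then have "x $ i = 0" for i using weight_rootv[of i x] by simp
  then show ?thesis by (simp add: vec_eq_iff)
qed

lemma euler_simple1:
  "euler \<eta> (\<alpha> j) y = weight j \<bullet> y + (\<Sum>k | \<eta> j < \<eta> k. (\<alpha> j \<bullet> \<alpha> k) * (weight k \<bullet> y / hsq k))"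
proof -
  have "(\<Sum>k\<in>UNIV. \<Sum>i\<in>UNIV. if \<eta> i < \<eta> k then (\<alpha> i \<bullet> \<alpha> k) * (weight i \<bullet> \<alpha> j / hsq i) * (weight k \<bullet> y / hsq k) else 0) =
      (\<Sum>k\<in>UNIV. \<Sum>i\<in>UNIV. if i = j then if \<eta> j < \<eta> k then (\<alpha> j \<bullet> \<alpha> k) * (weight k \<bullet> y / hsq k) else 0 else 0)"
    by (intro sum.cong) (auto simp: weight_simple)
  also have "\<dots> = (\<Sum>k\<in>UNIV. if \<eta> j < \<eta> k then (\<alpha> j \<bullet> \<alpha> k) * (weight k \<bullet> y / hsq k) else 0)" by simp
  finally have 1: "(\<Sum>k\<in>UNIV. \<Sum>i\<in>UNIV. if \<eta> i < \<eta> k then (\<alpha> i \<bullet> \<alpha> k) * (weight i \<bullet> \<alpha> j / hsq i) * (weight k \<bullet> y / hsq k) else 0) =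
      (\<Sum>k\<in>UNIV. if \<eta> j < \<eta> k then (\<alpha> j \<bullet> \<alpha> k) * (weight k \<bullet> y / hsq k) else 0)" .
  have 2: "(\<Sum>i\<in>UNIV. (weight i \<bullet> \<alpha> j) * (weight i \<bullet> y) / hsq i) = weight j \<bullet> y"
    by (simp add: weight_simple if_distrib if_distribR cong: if_cong)
  show ?thesis unfolding euler_alt 1 2 sum_Collect_if ..
qed

lemma euler_rootv1: "euler \<eta> (\<alpha> j) (rootv y) = hsq j * (y $ j - (\<Sum>k | \<eta> j < \<eta> k. cf j k * y $ k))"
proof -
  have "(\<alpha> j \<bullet> \<alpha> k) * (weight k \<bullet> rootv y / hsq k) = - (hsq j * (cf j k * y $ k))" for k
    by (simp add: weight_rootv cf_def)
  then show ?thesis by (simp only: euler_simple1) (simp add: weight_rootv right_diff_distrib sum_distrib_left sum_negf)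
qed

lemma cf_hsq: "cf k j * hsq k = cf j k * hsq j"
  by (simp add: cf_def inner_commute)

lemma euler_rootv2: "euler \<eta> (rootv x) (\<alpha> j) = hsq j * (x $ j - (\<Sum>k | \<eta> k < \<eta> j. cf j k * x $ k))"
proof -
  have "cf k j * (hsq k * x $ k) = hsq j * (cf j k * x $ k)" for k
    by (simp only: mult.assoc[symmetric] cf_hsq[of k j]) simp
  then show ?thesis by (simp only: euler_simple weight_rootv right_diff_distrib sum_distrib_left)
qed

lemma euler_simple_0: assumes "\<And>j. euler \<eta> (\<alpha> j) y = 0" shows "y = 0"
proof (rule euler_nondeg)
  fix x
  have "euler \<eta> x y = euler \<eta> (\<Sum>j\<in>UNIV. ((weight j \<bullet> x) / hsq j) *\<^sub>R \<alpha> j) y" using simple_expand[of x] by simp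
  also have "\<dots> = 0" by (simp add: euler_sum euler_scale assms)
  finally show "euler \<eta> x y = 0" .
qed

text \<open>The hypothesis is the adjunction \<open>cox_adj\<close> tested on simple roots, and the
  Euler form is nondegenerate.\<close>

lemma rootv_cox:
  assumes "\<And>j. y $ j - (\<Sum>k | \<eta> j < \<eta> k. cf j k * y $ k) = - (x $ j - (\<Sum>k | \<eta> k < \<eta> j. cf j k * x $ k))"
  shows "rootv y = c (rootv x)"
proof -
  have "euler \<eta> (\<alpha> j) (rootv y - c (rootv x)) = 0" for j
  proof -
    have "euler \<eta> (\<alpha> j) (c (rootv x)) = - euler \<eta> (rootv x) (\<alpha> j)" by (rule cox_adj[OF height])
    then show ?thesis by (simp only: euler_diff euler_rootv1 euler_rootv2 assms)
  qed
  then have "rootv y - c (rootv x) = 0" by (rule euler_simple_0)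
  then show ?thesis by simp
qed

context
  fixes B :: "real^'n^'n"
  assumes arr: "\<And>i j. (i, j) \<in> arrows B \<longleftrightarrow> \<alpha> i \<bullet> \<alpha> j \<noteq> 0 \<and> \<eta> j < \<eta> i"
    and laced: "\<And>i j. i \<noteq> j \<Longrightarrow> \<alpha> i \<bullet> \<alpha> j \<noteq> 0 \<Longrightarrow> cf i j = 1"
begin

lemma sum_arrows_out: "(\<Sum>j | \<eta> j < \<eta> i. cf i j * f j) = (\<Sum>j | (i, j) \<in> arrows B. f j)" (is ?A)
  and sum_arrows_out': "(\<Sum>j | \<eta> j < \<eta> i. cf j i *\<^sub>R (g j :: real^'n)) = (\<Sum>j | (i, j) \<in> arrows B. g j)" (is ?B)
  and sum_arrows_in: "(\<Sum>j | \<eta> i < \<eta> j. cf i j * f j) = (\<Sum>j | (j, i) \<in> arrows B. f j)" (is ?C)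
proof -
  have c1: "cf i j = (if \<alpha> i \<bullet> \<alpha> j \<noteq> 0 then 1 else 0)" "cf j i = (if \<alpha> i \<bullet> \<alpha> j \<noteq> 0 then 1 else 0)" if "\<eta> j < \<eta> i \<or> \<eta> i < \<eta> j" for i j
    using laced[of i j] laced[of j i] that cf_eq_0_iff by (auto simp: inner_commute)
  show ?A by (rule sum.mono_neutral_cong_right) (auto simp: arr c1)
  show ?B by (rule sum.mono_neutral_cong_right) (auto simp: arr c1(2) inner_commute split: if_splits)
  show ?C by (rule sum.mono_neutral_cong_right) (auto simp: arr c1 inner_commute)
qed

lemma euler_matrix_mult: "(euler_matrix B *v x) $ j = x $ j - (\<Sum>k | (j, k) \<in> arrows B. x $ k)"
proof -
  have "(euler_matrix B *v x) $ j = (\<Sum>k\<in>UNIV. (if k = j then x $ j else 0) - (if (j, k) \<in> arrows B then x $ k else 0))"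
    unfolding matrix_vector_mult_def euler_matrix_def by (simp, intro sum.cong) auto
  then show ?thesis by (simp add: sum_subtractf sum_Collect_if)
qed

lemma euler_matrix_transpose_mult:
  "(transpose (euler_matrix B) *v x) $ j = x $ j - (\<Sum>k | (k, j) \<in> arrows B. x $ k)"
proof -
  have "(transpose (euler_matrix B) *v x) $ j = (\<Sum>k\<in>UNIV. (if k = j then x $ j else 0) - (if (k, j) \<in> arrows B then x $ k else 0))"
    unfolding matrix_vector_mult_def euler_matrix_def transpose_def by (simp, intro sum.cong) auto
  then show ?thesis by (simp add: sum_subtractf sum_Collect_if)
qed

lemma coxeter_inv_eq:
  "transpose (euler_matrix B) *v coxeter_inv B x = - (euler_matrix B *v x)"
proof -
  let ?E = "transpose (euler_matrix B)"
  have "x = 0" if "?E *v x = 0" for x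
  proof -
    have "euler \<eta> (\<alpha> j) (rootv x) = hsq j * (?E *v x) $ j" for j
      by (simp only: euler_rootv1 euler_matrix_transpose_mult sum_arrows_in)
    then have "rootv x = 0" using that by (intro euler_simple_0) simp
    then show ?thesis by (rule rootv_eq_0)
  qed
  then have "inj ((*v) ?E)" by (simp add: matrix_left_invertible_ker matrix_left_invertible_injective[symmetric])
  then have "invertible ?E" using invertible_left_inverse matrix_left_invertible_injective by blast
  then have "?E ** matrix_inv ?E = mat 1" unfolding invertible_def matrix_inv_def by (rule someI2_ex) simp
  moreover have "?E *v coxeter_inv B x = - ((?E ** matrix_inv ?E) *v (euler_matrix B *v x))"
    by (simp add: coxeter_inv_def matrix_vector_mul_assoc matrix_mul_assoc linear_neg[OF matrix_vector_mul_linear])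
  ultimately show ?thesis by simp
qed

lemma coxeter_inv_component:
  "coxeter_inv B x $ j - (\<Sum>k | (k, j) \<in> arrows B. coxeter_inv B x $ k) = - (x $ j - (\<Sum>k | (j, k) \<in> arrows B. x $ k))"
proof -
  have "(transpose (euler_matrix B) *v coxeter_inv B x) $ j = - (euler_matrix B *v x) $ j" by (simp only: coxeter_inv_eq vector_uminus_component)
  then show ?thesis by (simp only: euler_matrix_mult euler_matrix_transpose_mult)
qed

lemma rootv_coxeter_inv: "rootv (coxeter_inv B x) = c (rootv x)"
  by (rule rootv_cox) (simp only: coxeter_inv_component sum_arrows_in sum_arrows_out)

lemma proj_norm: "pr i \<bullet> pr i = 2 * hsq i"
  using rt_init[OF ps_less[of i]] rt_norm[of "{..<CARD('n)}" "ps i"] by simp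

lemma proj_rec: "pr i = \<alpha> i + (\<Sum>j | (i, j) \<in> arrows B. pr j)"
  by (subst proj.simps) (simp only: sum_arrows_out')

lemma hsq_arrow: assumes "(i, j) \<in> arrows B" shows "hsq i = hsq j"
proof -
  have "i \<noteq> j" "\<alpha> i \<bullet> \<alpha> j \<noteq> 0" using assms by (auto simp: arr)
  then have "cf i j = 1" "cf j i = 1" using laced[of i j] laced[of j i] by (auto simp: inner_commute)
  then show ?thesis using cf_hsq[of i j] by simp
qed

text \<open>
  The number of paths from \<open>i\<close> to \<open>k\<close> is the coefficient of \<open>\<alpha> k\<close> in \<open>pr i\<close>. It is at most 1, because
  otherwise the two roots \<open>pr i\<close> and \<open>pr k\<close> of equal length would coincide.
\<close>

lemma proj_coeff: "weight k \<bullet> pr i / hsq k = (if (i, k) \<in> (arrows B)\<^sup>* then 1 else 0)"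
proof -
  define N where "N i = weight k \<bullet> pr i / hsq k" for i
  have rec: "N i = (if i = k then 1 else 0) + (\<Sum>j | (i, j) \<in> arrows B. N j)" for i
    unfolding N_def by (subst proj_rec) (simp add: inner_add_right inner_sum_right weight_simple add_divide_distrib sum_divide_distrib)
  have Nat: "N i \<in> \<nat> \<and> (0 < N i \<longleftrightarrow> (i, k) \<in> (arrows B)\<^sup>*) \<and> ((i, k) \<in> (arrows B)\<^sup>* \<longrightarrow> hsq i = hsq k \<and> \<eta> k \<le> \<eta> i)" for i
  proof (induction "\<eta> i" arbitrary: i rule: less_induct)
    case less
    have IH: "N j \<in> \<nat>" "0 < N j \<longleftrightarrow> (j, k) \<in> (arrows B)\<^sup>*" "(j, k) \<in> (arrows B)\<^sup>* \<Longrightarrow> hsq j = hsq k \<and> \<eta> k \<le> \<eta> j"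
      if "(i, j) \<in> arrows B" for j using less[of j] that by (auto simp: arr)
    have nn: "0 \<le> N j" for j
      unfolding N_def using proj_weight_nonneg[of k \<eta> j] hsq_pos[of k] by simp
    have nat: "(\<Sum>j | (i, j) \<in> arrows B. N j) \<in> \<nat>" 
    proof -
      have "sum N K \<in> \<nat>" if "finite K" "\<forall>j\<in>K. N j \<in> \<nat>" for K
        using that by (induction K rule: finite_induct) auto
      then show ?thesis using IH(1) by simp
    qed
    have reach: "(i, k) \<in> (arrows B)\<^sup>* \<longleftrightarrow> i = k \<or> (\<exists>j. (i, j) \<in> arrows B \<and> (j, k) \<in> (arrows B)\<^sup>*)"
      by (meson converse_rtranclE converse_rtrancl_into_rtrancl rtrancl.rtrancl_refl)
    have "0 < N i \<longleftrightarrow> (i, k) \<in> (arrows B)\<^sup>*"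
    proof -
      have "0 < (\<Sum>j | (i, j) \<in> arrows B. N j) \<longleftrightarrow> (\<exists>j. (i, j) \<in> arrows B \<and> 0 < N j)"
      proof -
        have "(\<Sum>j | (i, j) \<in> arrows B. N j) = 0 \<longleftrightarrow> (\<forall>j\<in>{j. (i, j) \<in> arrows B}. N j = 0)"
          by (rule sum_nonneg_eq_0_iff) (use nn in auto)
        moreover have "0 \<le> (\<Sum>j | (i, j) \<in> arrows B. N j)" by (rule sum_nonneg) (use nn in auto)
        ultimately show ?thesis using nn by (metis (mono_tags, lifting) less_eq_real_def less_irrefl mem_Collect_eq)
      qed
      moreover have "0 \<le> (\<Sum>j | (i, j) \<in> arrows B. N j)" by (rule sum_nonneg) (use nn in auto)
      ultimately show ?thesis unfolding rec[of i] reach using IH(2) by (auto intro: add_pos_nonneg)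
    qed
    moreover have "N i \<in> \<nat>" unfolding rec[of i] using nat by simp
    moreover have "hsq i = hsq k \<and> \<eta> k \<le> \<eta> i" if r: "(i, k) \<in> (arrows B)\<^sup>*"
    proof (cases "i = k")
      case False
      then obtain j where j: "(i, j) \<in> arrows B" "(j, k) \<in> (arrows B)\<^sup>*" using r reach by blast
      then show ?thesis using IH(3)[OF j] hsq_arrow[OF j(1)] arr[of i j] by auto
    qed simp
    ultimately show ?case by blast
  qed
  have "N i < 2" if r: "(i, k) \<in> (arrows B)\<^sup>*"
  proof (cases "i = k")
    case True then show ?thesis by (simp add: N_def proj_weight_self)
  next
    case False
    have h: "hsq i = hsq k" "\<eta> k \<le> \<eta> i" using Nat[of i] r by auto
    have "euler \<eta> (pr i) (pr k) = N i * hsq k" by (simp add: euler_proj N_def)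
    moreover have "euler \<eta> (pr k) (pr i) = 0" using proj_weight_0[OF h(2)] False by (simp add: euler_proj)
    ultimately have ip: "pr i \<bullet> pr k = N i * hsq k" using euler_sym[OF height, of "pr i" "pr k"] by simp
    have "0 < (pr i - pr k) \<bullet> (pr i - pr k)" using False by simp
    also have "\<dots> = 2 * hsq k * (2 - N i)"
      by (simp add: inner_diff_left inner_diff_right proj_norm ip inner_commute[of "pr k" "pr i"] h(1) algebra_simps)
    finally show ?thesis using hsq_pos[of k] by (simp add: zero_less_mult_iff)
  qed
  moreover have "N i = 1" if N1: "N i \<in> \<nat>" "0 < N i" "N i < 2"
  proof -
    obtain n where "N i = real n" using N1(1) by (auto elim: Nats_cases)
    then show ?thesis using N1(2,3) by simp
  qed
  moreover have "N i = 0" if "\<not> 0 < N i"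
    using that proj_weight_nonneg[of k \<eta> i] hsq_pos[of k] by (simp add: N_def zero_less_divide_iff)
  ultimately show ?thesis using Nat[of i] unfolding N_def[symmetric] by auto
qed

lemma dim_projective_eq: "dim_projective B i = (\<chi> k. weight k \<bullet> pr i / hsq k)"
  by (simp add: dim_projective_def proj_coeff)

lemma rootv_dim_projective: "rootv (dim_projective B i) = pr i"
  unfolding rootv_def dim_projective_eq using simple_expand[of "pr i"] by simp

lemma dim_projective_rec: "dim_projective B i = axis i 1 + (\<Sum>j | (i, j) \<in> arrows B. dim_projective B j)"
proof (simp add: vec_eq_iff, intro allI)
  fix k
  have "dim_projective B i $ k = weight k \<bullet> (\<alpha> i + (\<Sum>j | (i, j) \<in> arrows B. pr j)) / hsq k"
    by (simp add: dim_projective_eq flip: proj_rec)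
  also have "\<dots> = axis i 1 $ k + (\<Sum>j | (i, j) \<in> arrows B. dim_projective B j $ k)"
    by (simp add: dim_projective_eq inner_add_right inner_sum_right weight_simple add_divide_distrib sum_divide_distrib axis_def)
  finally show "dim_projective B i $ k = axis i 1 $ k + (\<Sum>j | (i, j) \<in> arrows B. dim_projective B j $ k)" .
qed

lemma rootv_coxeter_pow: "rootv ((coxeter_inv B ^^ l) (dim_projective B i)) = (c ^^ l) (pr i)"
  by (induction l) (simp_all add: rootv_coxeter_inv rootv_dim_projective)

text \<open>These are the coefficients of a root in the simple roots.\<close>

lemma coxeter_pow_sign:
  "(\<forall>j. 0 \<le> (coxeter_inv B ^^ l) (dim_projective B i) $ j) \<or>
   (\<forall>j. (coxeter_inv B ^^ l) (dim_projective B i) $ j \<le> 0)"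
proof -
  let ?x = "(coxeter_inv B ^^ l) (dim_projective B i)"
  have "rootv ?x \<in> \<Phi>" using proj_pos[of i] pos_root by (simp add: rootv_coxeter_pow)
  then consider "rootv ?x \<in> pos" | "- rootv ?x \<in> pos" using pos_or_neg by blast
  then show ?thesis
  proof cases
    case 1
    have "0 \<le> ?x $ j" for j using pos_weight[OF 1, of j] hsq_pos[of j] by (simp add: weight_rootv zero_le_mult_iff)
    then show ?thesis by blast
  next
    case 2
    have "?x $ j \<le> 0" for j using pos_weight[OF 2, of j] hsq_pos[of j] by (simp add: weight_rootv mult_le_0_iff)
    then show ?thesis by blast
  qed
qed

end

end

context coxeter_word
begin

text \<open>Facets are pairwise compatible, and by \<open>compat_facet\<close> pairwise compatible
  sets extend to facets, so the simplices on both sides are the cliques of the same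
  relation.\<close>

lemma bij_betw_cluster_complex:
  assumes \<Theta>: "bij_betw \<Theta> apr Ob"
    and comp: "\<And>\<beta> \<gamma>. \<beta> \<in> apr \<Longrightarrow> \<gamma> \<in> apr \<Longrightarrow> \<beta> \<noteq> \<gamma> \<Longrightarrow> compatible \<Phi> \<alpha> \<beta> \<gamma> \<longleftrightarrow> compat (\<Theta> \<beta>) (\<Theta> \<gamma>)"
  shows "bij_betw ((`) \<Theta>) (cluster_complex \<Phi> \<alpha>) {Y. \<exists>F. facet F \<and> Y \<subseteq> F}"
proof -
  have inj: "inj_on \<Theta> apr" and img: "\<Theta> ` apr = Ob" using \<Theta> by (auto simp: bij_betw_def)
  have "inj_on ((`) \<Theta>) (cluster_complex \<Phi> \<alpha>)"
    by (rule inj_on_subset[OF inj_on_image_Pow[OF inj]]) (auto simp: cluster_complex_def)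
  moreover have "(`) \<Theta> ` cluster_complex \<Phi> \<alpha> = {Y. \<exists>F. facet F \<and> Y \<subseteq> F}"
  proof (intro set_eqI iffI)
    fix Y assume "Y \<in> (`) \<Theta> ` cluster_complex \<Phi> \<alpha>"
    then obtain X where X: "Y = \<Theta> ` X" "X \<subseteq> apr" "\<And>\<beta> \<gamma>. \<beta> \<in> X \<Longrightarrow> \<gamma> \<in> X \<Longrightarrow> \<beta> \<noteq> \<gamma> \<Longrightarrow> compatible \<Phi> \<alpha> \<beta> \<gamma>"
      by (auto simp: cluster_complex_def)
    have "Y \<subseteq> Ob" using X img by blast
    moreover have "compat s t" if st: "s \<in> Y" "t \<in> Y" "s \<noteq> t" for s t
    proof -
      obtain \<beta> \<gamma> where b: "\<beta> \<in> X" "\<gamma> \<in> X" "s = \<Theta> \<beta>" "t = \<Theta> \<gamma>" using st X(1) by blast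
      then have "\<beta> \<noteq> \<gamma>" "\<beta> \<in> apr" "\<gamma> \<in> apr" using st(3) X(2) by auto
      then show ?thesis using X(3)[of \<beta> \<gamma>] comp[of \<beta> \<gamma>] b by simp
    qed
    ultimately obtain F where "facet F" "Y \<subseteq> F" by (rule compat_facet)
    then show "Y \<in> {Y. \<exists>F. facet F \<and> Y \<subseteq> F}" by blast
  next
    fix Y assume "Y \<in> {Y. \<exists>F. facet F \<and> Y \<subseteq> F}"
    then obtain F where F: "facet F" "Y \<subseteq> F" by blast
    define X where "X = {\<beta> \<in> apr. \<Theta> \<beta> \<in> Y}"
    have "Y \<subseteq> \<Theta> ` apr" using F facet_Ob[OF F(1)] img by blast
    then have "Y = \<Theta> ` X" by (auto simp: X_def)
    moreover have "compatible \<Phi> \<alpha> \<beta> \<gamma>" if "\<beta> \<in> X" "\<gamma> \<in> X" "\<beta> \<noteq> \<gamma>" for \<beta> \<gamma>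
    proof -
      have "\<Theta> \<beta> \<noteq> \<Theta> \<gamma>" using that inj by (auto simp: X_def inj_on_def)
      then have "compat (\<Theta> \<beta>) (\<Theta> \<gamma>)" using that F(2) by (intro facet_compat[OF F(1)]) (auto simp: X_def)
      then show ?thesis using comp[of \<beta> \<gamma>] that by (simp add: X_def)
    qed
    ultimately show "Y \<in> (`) \<Theta> ` cluster_complex \<Phi> \<alpha>" by (auto simp: cluster_complex_def X_def)
  qed
  ultimately show ?thesis by (simp add: bij_betw_def)
qed

lemma euler_simple_simple:
  "euler \<eta> (\<alpha> j) (\<alpha> i) = (if i = j then hsq i else 0) + (if \<eta> j < \<eta> i then \<alpha> j \<bullet> \<alpha> i else 0)"
proof -
  have "(\<Sum>k | \<eta> j < \<eta> k. (\<alpha> j \<bullet> \<alpha> k) * (weight k \<bullet> \<alpha> i / hsq k)) =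
      (\<Sum>k\<in>UNIV. if k = i then if \<eta> j < \<eta> i then \<alpha> j \<bullet> \<alpha> i else 0 else 0)"
    unfolding sum_Collect_if by (intro sum.cong) (auto simp: weight_simple)
  then show ?thesis by (simp add: euler_simple1 weight_simple)
qed

lemma skew_simple_div:
  "skew (\<alpha> j) (\<alpha> i) / hsq i = (if \<eta> i < \<eta> j then cf i j else if \<eta> j < \<eta> i then - cf i j else 0)"
  by (simp add: skew_def euler_simple_simple cf_def inner_commute)

end

subsection \<open>Folding\<close>

text \<open>\<open>block_out\<close> and \<open>block_in\<close> are the column sum conditions of
  \<open>folds_to\<close>, rewritten as weighted counts of the arrows between a vertex and a
  block.\<close>

locale folded_word = F: coxeter_word \<Phi>' \<alpha>' \<eta> q + U: coxeter_word \<Phi> \<alpha> "\<lambda>i. \<eta> (P i)" p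
  for \<Phi>' :: "(real^'m::finite) set" and \<alpha>' \<eta> q and \<Phi> :: "(real^'n::finite) set" and \<alpha> P p +
  fixes B :: "real^'n^'n" and w :: "'n \<Rightarrow> real"
  assumes arr: "\<And>i j. (i, j) \<in> arrows B \<longleftrightarrow> \<alpha> i \<bullet> \<alpha> j \<noteq> 0 \<and> \<eta> (P j) < \<eta> (P i)"
    and laced: "\<And>i j. i \<noteq> j \<Longrightarrow> \<alpha> i \<bullet> \<alpha> j \<noteq> 0 \<Longrightarrow> U.cf i j = 1"
    and surj: "surj P" and w_pos: "\<And>j. 0 < w j"
    and block_out: "\<And>i J. (\<Sum>j | P j = J \<and> (i, j) \<in> arrows B. w j) = w i * (if \<eta> J < \<eta> (P i) then F.cf J (P i) else 0)"
    and block_in: "\<And>i J. (\<Sum>j | P j = J \<and> (j, i) \<in> arrows B. w j) = w i * (if \<eta> (P i) < \<eta> J then F.cf J (P i) else 0)"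
begin

lemma sum_blocks: "(\<Sum>j\<in>K. f j :: 'v::comm_monoid_add) = (\<Sum>J\<in>UNIV. \<Sum>j | P j = J \<and> j \<in> K. f j)"
  using sum.group[of K UNIV P f] by (simp add: conj_commute Collect_conj_eq)

lemma sum_out:
  "(\<Sum>j | (i, j) \<in> arrows B. w j *\<^sub>R f (P j)) = w i *\<^sub>R (\<Sum>J | \<eta> J < \<eta> (P i). F.cf J (P i) *\<^sub>R (f J :: 'v::real_vector))"
proof -
  have "(\<Sum>j | P j = J \<and> j \<in> {j. (i, j) \<in> arrows B}. w j *\<^sub>R f (P j)) =
      (if \<eta> J < \<eta> (P i) then w i *\<^sub>R F.cf J (P i) *\<^sub>R f J else 0)" for J
  proof -
    have "(\<Sum>j | P j = J \<and> j \<in> {j. (i, j) \<in> arrows B}. w j *\<^sub>R f (P j)) = (\<Sum>j | P j = J \<and> (i, j) \<in> arrows B. w j) *\<^sub>R f J"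
      unfolding scaleR_sum_left by (rule sum.cong) auto
    then show ?thesis unfolding block_out by simp
  qed
  then show ?thesis by (subst sum_blocks) (simp add: scaleR_sum_right flip: sum.inter_filter)
qed

lemma sum_in:
  "(\<Sum>j | (j, i) \<in> arrows B. w j *\<^sub>R f (P j)) = w i *\<^sub>R (\<Sum>J | \<eta> (P i) < \<eta> J. F.cf J (P i) *\<^sub>R (f J :: 'v::real_vector))"
proof -
  have "(\<Sum>j | P j = J \<and> j \<in> {j. (j, i) \<in> arrows B}. w j *\<^sub>R f (P j)) =
      (if \<eta> (P i) < \<eta> J then w i *\<^sub>R F.cf J (P i) *\<^sub>R f J else 0)" for J
  proof -
    have "(\<Sum>j | P j = J \<and> j \<in> {j. (j, i) \<in> arrows B}. w j *\<^sub>R f (P j)) = (\<Sum>j | P j = J \<and> (j, i) \<in> arrows B. w j) *\<^sub>R f J"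
      unfolding scaleR_sum_left by (rule sum.cong) auto
    then show ?thesis unfolding block_in by simp
  qed
  then show ?thesis by (subst sum_blocks) (simp add: scaleR_sum_right flip: sum.inter_filter)
qed

definition fold_dim :: "real^'n \<Rightarrow> real^'m" where
  "fold_dim x = (\<chi> J. \<Sum>j | P j = J. w j * x $ j)"

text \<open>Exchanging the sums turns the weighted arrow counts from \<open>k\<close> into the block
  \<open>J\<close> into Cartan entries of the folded diagram. \<open>Q\<close> is the comparison of
  heights that matches the arrow set \<open>R\<close>.\<close>

lemma fold_dim_swap:
  assumes "\<And>k J. (\<Sum>j | P j = J \<and> (k, j) \<in> R. w j) = w k * (if Q J (P k) then F.cf J (P k) else 0)"
  shows "(\<Sum>j | P j = J. w j * (\<Sum>k | (k, j) \<in> R. x $ k)) = (\<Sum>K | Q J K. F.cf J K * fold_dim x $ K)"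
proof -
  have "(\<Sum>j | P j = J. w j * (\<Sum>k | (k, j) \<in> R. x $ k)) = (\<Sum>j | P j = J. \<Sum>k | (k, j) \<in> R. w j * x $ k)"
    by (simp add: sum_distrib_left)
  also have "\<dots> = (\<Sum>k\<in>UNIV. \<Sum>j | P j = J \<and> (k, j) \<in> R. w j * x $ k)"
    using sum.swap_restrict[of "{j. P j = J}" UNIV "\<lambda>j k. w j * x $ k" "\<lambda>j k. (k, j) \<in> R"] by simp
  also have "\<dots> = (\<Sum>k\<in>UNIV. w k * (if Q J (P k) then F.cf J (P k) else 0) * x $ k)"
    by (simp only: assms flip: sum_distrib_right)
  also have "\<dots> = (\<Sum>K\<in>UNIV. \<Sum>k | P k = K. w k * (if Q J (P k) then F.cf J (P k) else 0) * x $ k)"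
    by (subst sum_blocks) simp
  also have "\<dots> = (\<Sum>K\<in>UNIV. if Q J K then F.cf J K * fold_dim x $ K else 0)"
    by (intro sum.cong) (auto simp: fold_dim_def sum_distrib_left intro!: sum.cong)
  finally show ?thesis by (simp only: F.sum_Collect_if)
qed

text \<open>Summing the defining equation of \<open>coxeter_inv\<close> over a block with weights
  gives the equation that characterizes \<open>F.c\<close> in \<open>F.rootv_cox\<close>.\<close>

lemma fold_dim_coxeter_inv: "F.rootv (fold_dim (coxeter_inv B x)) = F.c (F.rootv (fold_dim x))"
proof (rule F.rootv_cox)
  fix J
  let ?y = "coxeter_inv B x"
  have eq: "?y $ j - (\<Sum>k | (k, j) \<in> arrows B. ?y $ k) = - (x $ j - (\<Sum>k | (k, j) \<in> (arrows B)\<inverse>. x $ k))" for j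
    unfolding converse_iff by (rule U.coxeter_inv_component) (auto simp: arr laced)
  have 1: "(\<Sum>j | P j = J. w j * (\<Sum>k | (k, j) \<in> arrows B. ?y $ k)) = (\<Sum>K | \<eta> J < \<eta> K. F.cf J K * fold_dim ?y $ K)"
    by (rule fold_dim_swap) (rule block_out)
  have 2: "(\<Sum>j | P j = J. w j * (\<Sum>k | (k, j) \<in> (arrows B)\<inverse>. x $ k)) = (\<Sum>K | \<eta> K < \<eta> J. F.cf J K * fold_dim x $ K)"
    by (rule fold_dim_swap) (simp only: converse_iff block_in)
  have "(\<Sum>j | P j = J. w j * (?y $ j - (\<Sum>k | (k, j) \<in> arrows B. ?y $ k))) =
      (\<Sum>j | P j = J. w j * (- (x $ j - (\<Sum>k | (k, j) \<in> (arrows B)\<inverse>. x $ k))))"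
    by (simp only: eq)
  then show "fold_dim ?y $ J - (\<Sum>K | \<eta> J < \<eta> K. F.cf J K * fold_dim ?y $ K) =
      - (fold_dim x $ J - (\<Sum>K | \<eta> K < \<eta> J. F.cf J K * fold_dim x $ K))"
    unfolding 1[symmetric] 2[symmetric]
    by (simp only: right_diff_distrib mult_minus_right sum_subtractf sum_negf) (simp add: fold_dim_def)
qed

lemma linear_fold_dim: "linear fold_dim"
  by (rule linearI) (simp_all add: fold_dim_def vec_eq_iff distrib_left sum.distrib sum_distrib_left mult.left_commute)

lemma linear_rootv': "linear F.rootv"
  by (rule linearI) (simp_all add: F.rootv_def scaleR_left_distrib sum.distrib scaleR_sum_right)

lemma fold_dim_axis: "F.rootv (fold_dim (axis i 1)) = w i *\<^sub>R \<alpha>' (P i)"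
proof -
  have "fold_dim (axis i 1) $ J = (if J = P i then w i else 0)" for J
  proof -
    have "(\<Sum>j | P j = J. w j * axis i 1 $ j) = (\<Sum>j\<in>UNIV. if j = i then if P i = J then w i else 0 else 0)"
      unfolding U.sum_Collect_if by (intro sum.cong) (auto simp: axis_def)
    then show ?thesis by (auto simp: fold_dim_def)
  qed
  then have "F.rootv (fold_dim (axis i 1)) = (\<Sum>J\<in>UNIV. if J = P i then w i *\<^sub>R \<alpha>' (P i) else 0)"
    unfolding F.rootv_def by (intro sum.cong) auto
  then show ?thesis by simp
qed

lemma fold_dim_projective: "F.rootv (fold_dim (dim_projective B i)) = w i *\<^sub>R F.pr (P i)"
proof (induction "\<eta> (P i)" arbitrary: i rule: less_induct)
  case less
  have "F.rootv (fold_dim (dim_projective B i)) =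
      w i *\<^sub>R \<alpha>' (P i) + (\<Sum>j | (i, j) \<in> arrows B. F.rootv (fold_dim (dim_projective B j)))"
    by (subst U.dim_projective_rec[of B, OF arr laced])
      (simp_all add: linear_add[OF linear_fold_dim] linear_add[OF linear_rootv'] linear_sum[OF linear_fold_dim]
        linear_sum[OF linear_rootv'] fold_dim_axis)
  also have "(\<Sum>j | (i, j) \<in> arrows B. F.rootv (fold_dim (dim_projective B j))) = (\<Sum>j | (i, j) \<in> arrows B. w j *\<^sub>R F.pr (P j))"
    by (intro sum.cong) (use less in \<open>auto simp: arr\<close>)
  also have "\<dots> = w i *\<^sub>R (\<Sum>J | \<eta> J < \<eta> (P i). F.cf J (P i) *\<^sub>R F.pr J)" by (rule sum_out)
  finally show ?case by (subst F.proj.simps) (simp only: scaleR_right_distrib)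
qed

lemma fold_dim_pow:
  "F.rootv (fold_dim ((coxeter_inv B ^^ l) (dim_projective B i))) = w i *\<^sub>R (F.c ^^ l) (F.pr (P i))"
proof (induction l)
  case (Suc l)
  then show ?case by (simp add: fold_dim_coxeter_inv linear_scale[OF F.linear_cox])
qed (simp add: fold_dim_projective)

text \<open>The unfolded vector has entries of one sign and the weights are positive, so folding
  cannot cancel and the sign is that of the folded root.\<close>

lemma coxeter_pow_nonneg_iff:
  "(\<forall>j. 0 \<le> (coxeter_inv B ^^ l) (dim_projective B i) $ j) \<longleftrightarrow> (F.c ^^ l) (F.pr (P i)) \<in> F.pos"
proof -
  let ?x = "(coxeter_inv B ^^ l) (dim_projective B i)" and ?g = "(F.c ^^ l) (F.pr (P i))"
  have root: "?g \<in> \<Phi>'" using F.pos_root[OF F.proj_pos] by simp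
  have wt: "w i * (F.weight J \<bullet> ?g) = F.hsq J * fold_dim ?x $ J" for J
    using F.weight_rootv[of J "fold_dim ?x"] by (simp add: fold_dim_pow)
  have "?g \<in> F.pos" if x: "\<forall>j. 0 \<le> ?x $ j"
  proof -
    have "0 \<le> F.weight J \<bullet> ?g" for J
    proof -
      have "0 \<le> fold_dim ?x $ J" using x w_pos by (auto simp: fold_dim_def less_imp_le intro!: sum_nonneg)
      then have "0 \<le> w i * (F.weight J \<bullet> ?g)" unfolding wt using F.hsq_pos[of J] by simp
      then show ?thesis using w_pos[of i] by (simp add: zero_le_mult_iff)
    qed
    then show ?thesis using root by (simp add: F.pos_def)
  qed
  moreover have "\<forall>j. 0 \<le> ?x $ j" if g: "?g \<in> F.pos"
  proof (rule ccontr)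
    assume "\<not> ?thesis"
    then have neg: "\<forall>j. ?x $ j \<le> 0" using U.coxeter_pow_sign[of B, OF arr laced, of l i] by blast
    have "F.weight J \<bullet> ?g \<le> 0" for J
    proof -
      have "fold_dim ?x $ J \<le> 0" using neg w_pos by (auto simp: fold_dim_def less_imp_le mult_nonneg_nonpos intro!: sum_nonpos)
      then have "w i * (F.weight J \<bullet> ?g) \<le> 0" unfolding wt using F.hsq_pos[of J] by (simp add: mult_nonneg_nonpos)
      then show ?thesis using w_pos[of i] by (simp add: mult_le_0_iff)
    qed
    moreover obtain J where "0 < F.weight J \<bullet> ?g" using F.pos_obtain_weight[OF g] .
    ultimately show False by (meson not_le)
  qed
  ultimately show ?thesis by blast
qed

lemma ar_objects_iff: "(k, i) \<in> ar_objects B \<longleftrightarrow> 1 \<le> k \<and> F.pt (k - 1) (P i) \<in> F.Ob"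
proof -
  \<comment> \<open>Objects are counted from 1 and positions from 0, and the first object of a row
    is a shifted projective, so \<open>k\<close> tests \<open>k - 1\<close> roots.\<close>
  have "(\<forall>l. l + 2 \<le> k \<longrightarrow> Q l) \<longleftrightarrow> (\<forall>l<k-1. Q l)" if "1 \<le> k" for Q using that by (auto simp: less_diff_conv)
  then show ?thesis unfolding ar_objects_def F.pt_Ob coxeter_pow_nonneg_iff by auto
qed

text \<open>The relation at \<open>(k + 1, i)\<close> expresses that coordinate through column
  \<open>k\<close> and through lower vertices of column \<open>k + 1\<close>, hence the induction on
  the column and then on the height.\<close>

lemma mesh_unique:
  assumes t: "t \<in> mesh_space B a" "t' \<in> mesh_space B a" and init: "\<And>i. t 1 i = t' 1 i"
  shows "t k i = t' k i"
proof (induction k arbitrary: i)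
  case 0
  have "(0, i) \<notin> ar_objects B" by (simp add: ar_objects_def)
  then show ?case using t by (simp add: mesh_space_def)
next
  case (Suc k)
  show ?case
  proof (induction "\<eta> (P i)" arbitrary: i rule: less_induct)
    case less
    have IH: "t (Suc k) j = t' (Suc k) j" if "(i, j) \<in> arrows B" for j using less that by (simp add: arr)
    consider "k = 0" | "(k + 1, i) \<notin> ar_objects B" | "1 \<le> k" "(k + 1, i) \<in> ar_objects B" by linarith
    then show ?case
    proof cases
      case 1 then show ?thesis using init by simp
    next
      case 2 then show ?thesis using t by (simp add: mesh_space_def)
    next
      case 3
      have "s k i + s (k + 1) i = (\<Sum>j | (i, j) \<in> arrows B. s (k + 1) j) + (\<Sum>j | (j, i) \<in> arrows B. s k j) + a (k + 1) i"
        if "s \<in> mesh_space B a" for s using that 3 by (simp add: mesh_space_def)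
      from this[OF t(1)] this[OF t(2)] show ?thesis using IH Suc by simp
    qed
  qed
qed

text \<open>Parametrizes the initial coordinates of the points of the folding space by those of the
  folded mesh relations.\<close>

definition emb :: "real^'m \<Rightarrow> real^'n" where "emb x = (\<chi> j. w j * x $ P j)"

definition rep :: "'m \<Rightarrow> 'n" where "rep I = (SOME i. P i = I)"

lemma P_rep [simp]: "P (rep I) = I"
  unfolding rep_def using surj by (metis (mono_tags) someI_ex surjD)

lemma linear_emb: "linear emb"
  by (rule linearI) (simp_all add: emb_def vec_eq_iff distrib_left)

lemma inj_emb: "inj emb"
proof (rule injI)
  fix x y assume "emb x = emb y"
  then have "w (rep I) * x $ I = w (rep I) * y $ I" for I by (simp add: emb_def vec_eq_iff) (metis P_rep)
  then show "x = y" using w_pos by (simp add: vec_eq_iff less_imp_neq[symmetric])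
qed

section \<open>The section as a linear image of a fan polytope\<close>

context
  fixes a :: "nat \<Rightarrow> 'n \<Rightarrow> real"
  assumes a_pos: "\<And>k i. (k, i) \<in> ar_objects B \<Longrightarrow> k \<ge> 2 \<Longrightarrow> a k i > 0"
    and a_block: "\<And>k i j. (k, i) \<in> ar_objects B \<Longrightarrow> (k, j) \<in> ar_objects B \<Longrightarrow> k \<ge> 2 \<Longrightarrow> P i = P j
      \<Longrightarrow> w i * a k j = w j * a k i"
begin

text \<open>
  The parameters of the folded mesh relations. They do not depend on the representatives of the blocks because
  of the hypothesis \<open>a_block\<close>.
\<close>

definition par :: "nat \<Rightarrow> real" where
  "par t = a (t div CARD('m) + 1) (rep (q t)) / (w (rep (q t)) * F.hsq (q t))"

lemma par_pos: assumes "t \<in> F.Ob" "CARD('m) \<le> t" shows "0 < par t"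
proof -
  have d: "0 < t div CARD('m)" using assms(2) by (simp add: div_greater_zero_iff)
  have "F.pt (t div CARD('m)) (q t) \<in> F.Ob" using assms(1) by (simp add: F.pt_q)
  then have "(t div CARD('m) + 1, rep (q t)) \<in> ar_objects B" by (simp add: ar_objects_iff)
  then have "0 < a (t div CARD('m) + 1) (rep (q t))" using d by (intro a_pos) auto
  then show ?thesis unfolding par_def using w_pos F.hsq_pos by simp
qed

lemma par_pt: assumes "(k + 2, i) \<in> ar_objects B" shows "w i * (par (F.pt (Suc k) (P i)) * F.hsq (P i)) = a (k + 2) i"
proof -
  have "(k + 2, rep (P i)) \<in> ar_objects B" using assms by (simp add: ar_objects_iff)
  then have "w i * a (k + 2) (rep (P i)) = w (rep (P i)) * a (k + 2) i" by (intro a_block[OF assms]) auto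
  then show ?thesis using w_pos[of "rep (P i)"] by (simp add: par_def field_simps)
qed

definition pnt :: "real^'m \<Rightarrow> nat \<Rightarrow> 'm \<Rightarrow> real" where
  "pnt x k J = (if 1 \<le> k \<and> F.pt (k - 1) J \<in> F.Ob then F.ev par x (F.pt (k - 1) J) else 0)"

lemma initial_pt: "F.pt 0 J \<in> F.Ob" by (simp add: F.pt_Ob)

lemma pnt_mesh: "(\<lambda>k i. w i * pnt x k (P i)) \<in> mesh_space B a"
proof -
  have "w i * pnt x k (P i) + w i * pnt x (k + 1) (P i) =
      (\<Sum>j | (i, j) \<in> arrows B. w j * pnt x (k + 1) (P j)) + (\<Sum>j | (j, i) \<in> arrows B. w j * pnt x k (P j)) + a (k + 1) i"
    if "1 \<le> k" and ki: "(k + 1, i) \<in> ar_objects B" for k i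
  proof -
    obtain m where k: "k = Suc m" using \<open>1 \<le> k\<close> by (cases k) auto
    have Ob: "F.pt (Suc m) (P i) \<in> F.Ob" using ki by (simp add: ar_objects_iff k)
    then have Ob0: "F.pt m (P i) \<in> F.Ob" using F.pred_closed_row[OF F.pred_closed_Ob, of "Suc m" "P i" m] by simp
    note closed = F.pred_closed_Ob[unfolded F.pred_closed_def, THEN spec, THEN spec, THEN mp, OF Ob, THEN conjunct2]
    have adj: "\<alpha>' (P i) \<bullet> \<alpha>' J \<noteq> 0" if "F.cf J (P i) \<noteq> 0" for J
      using that F.cf_eq_0_iff[of J "P i"] by (simp add: inner_commute)
    \<comment> \<open>Neighbours with a nonzero Cartan entry are objects, so the default value 0 of
      \<open>pnt\<close> never enters with a nonzero coefficient.\<close>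
    have pc: "F.pt (Suc m) J \<in> F.Ob" if "\<eta> J < \<eta> (P i)" "F.cf J (P i) \<noteq> 0" for J
      using closed[THEN conjunct1, THEN spec, of J] adj that by simp
    have pc': "F.pt m J \<in> F.Ob" if "\<eta> (P i) < \<eta> J" "F.cf J (P i) \<noteq> 0" for J
      using closed[THEN conjunct2, THEN spec, of J] adj that by simp
    have 1: "(\<Sum>j | (i, j) \<in> arrows B. w j * pnt x (k + 1) (P j)) =
        w i * (\<Sum>J | \<eta> J < \<eta> (P i). F.cf J (P i) * F.ev par x (F.pt (Suc m) J))"
    proof -
      have "(\<Sum>j | (i, j) \<in> arrows B. w j * pnt x (k + 1) (P j)) = w i * (\<Sum>J | \<eta> J < \<eta> (P i). F.cf J (P i) * pnt x (k + 1) J)"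
        using sum_out[of "pnt x (k + 1)" i] by simp
      also have "(\<Sum>J | \<eta> J < \<eta> (P i). F.cf J (P i) * pnt x (k + 1) J) = (\<Sum>J | \<eta> J < \<eta> (P i). F.cf J (P i) * F.ev par x (F.pt (Suc m) J))"
        by (intro sum.cong) (use pc in \<open>auto simp: pnt_def k\<close>)
      finally show ?thesis .
    qed
    have 2: "(\<Sum>j | (j, i) \<in> arrows B. w j * pnt x k (P j)) =
        w i * (\<Sum>J | \<eta> (P i) < \<eta> J. F.cf J (P i) * F.ev par x (F.pt m J))"
    proof -
      have "(\<Sum>j | (j, i) \<in> arrows B. w j * pnt x k (P j)) = w i * (\<Sum>J | \<eta> (P i) < \<eta> J. F.cf J (P i) * pnt x k J)"
        using sum_in[of "pnt x k" i] by simp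
      also have "(\<Sum>J | \<eta> (P i) < \<eta> J. F.cf J (P i) * pnt x k J) = (\<Sum>J | \<eta> (P i) < \<eta> J. F.cf J (P i) * F.ev par x (F.pt m J))"
        by (intro sum.cong) (use pc' in \<open>auto simp: pnt_def k\<close>)
      finally show ?thesis .
    qed
    have 3: "w i * (par (F.pt (Suc m) (P i)) * F.hsq (P i)) = a (k + 1) i" using par_pt[of m i] ki by (simp add: k)
    have "w i * pnt x k (P i) + w i * pnt x (k + 1) (P i) = w i * (F.ev par x (F.pt m (P i)) + F.ev par x (F.pt (Suc m) (P i)))"
      using Ob Ob0 by (simp add: pnt_def k distrib_left)
    then show ?thesis unfolding 1 2 3[symmetric] F.ev_mesh[OF Ob] by (simp only: distrib_left)
  qed
  then show ?thesis by (auto simp: mesh_space_def ar_objects_iff pnt_def)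
qed

lemma initial_pnt: "initial_coords (\<lambda>k i. w i * pnt x k (P i)) = emb x"
  by (simp add: initial_coords_def emb_def pnt_def initial_pt F.ev_init)

text \<open>One inclusion needs only the hyperplanes for \<open>k = 1\<close>, which all involve
  objects; the other holds because each solution \<open>pnt\<close> satisfies the equations for
  every \<open>k\<close>.\<close>

lemma folding_space_eq: "folding_space P w B a = range emb"
proof (intro set_eqI iffI)
  fix v assume "v \<in> folding_space P w B a"
  then obtain t where v: "v = initial_coords t" and
    t: "\<And>k i j. P i = P j \<Longrightarrow> (k, i) \<in> ar_objects B \<Longrightarrow> (k, j) \<in> ar_objects B \<Longrightarrow> w j * t k i = w i * t k j"
    by (auto simp: folding_space_def)
  have t1: "t 1 i = w i * (t 1 (rep (P i)) / w (rep (P i)))" for i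
    using t[of "rep (P i)" i 1] w_pos[of "rep (P i)"] by (simp add: ar_objects_iff initial_pt field_simps)
  have "v $ i = emb (\<chi> I. t 1 (rep I) / w (rep I)) $ i" for i
    unfolding v initial_coords_def emb_def vec_lambda_beta by (rule t1)
  then have "v = emb (\<chi> I. t 1 (rep I) / w (rep I))" by (simp only: vec_eq_iff simp_thms)
  then show "v \<in> range emb" by blast
next
  fix v assume "v \<in> range emb"
  then obtain x where "v = initial_coords (\<lambda>k i. w i * pnt x k (P i))" by (auto simp: initial_pnt)
  then show "v \<in> folding_space P w B a" unfolding folding_space_def using pnt_mesh[of x] by fastforce
qed

interpretation fan_polytope F.Ob "\<lambda>t. F.gco (F.gv t)" "F.offset par" "{F. F.facet F}"
    "\<lambda>F. \<chi> i. F.weight i \<bullet> F.vert par F"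
  by (rule F.fan_polytope) (rule par_pos)

lemma ptope_iff: "x \<in> ptope \<longleftrightarrow> (\<forall>t\<in>F.Ob. 0 \<le> F.ev par x t)"
  by (simp add: ptope_def F.ev_def)

lemma section_eq: "folding_space P w B a \<inter> associahedron B a = emb ` ptope"
proof (intro set_eqI iffI)
  fix v assume v: "v \<in> folding_space P w B a \<inter> associahedron B a"
  then obtain x where x: "v = emb x" by (auto simp: folding_space_eq)
  obtain t where t: "v = initial_coords t" "t \<in> mesh_space B a" "\<And>k i. 0 \<le> t k i"
    using v by (auto simp: associahedron_def)
  have "initial_coords t = initial_coords (\<lambda>k i. w i * pnt x k (P i))" unfolding initial_pnt by (simp flip: t(1) x)
  then have "t 1 i = w i * pnt x 1 (P i)" for i by (simp add: initial_coords_def vec_eq_iff)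
  \<comment> \<open>The nonnegative point and the folded point have the same initial coordinates, so
    by \<open>mesh_unique\<close> they agree everywhere and positivity passes to the folded
    coordinates.\<close>
  then have eq: "t k i = w i * pnt x k (P i)" for k i by (rule mesh_unique[OF t(2) pnt_mesh])
  have "0 \<le> F.ev par x s" if "s \<in> F.Ob" for s
  proof -
    have "0 \<le> w (rep (q s)) * pnt x (Suc (s div CARD('m))) (q s)"
      using t(3)[of "Suc (s div CARD('m))" "rep (q s)"] by (simp add: eq)
    then show ?thesis using that w_pos[of "rep (q s)"] by (simp add: pnt_def F.pt_q zero_le_mult_iff)
  qed
  then show "v \<in> emb ` ptope" using x by (simp add: ptope_iff)
next
  fix v assume "v \<in> emb ` ptope"
  then obtain x where x: "v = emb x" "x \<in> ptope" by blast
  have "0 \<le> w i * pnt x k (P i)" for k i using x(2) w_pos[of i] by (simp add: ptope_iff pnt_def)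
  then have "v \<in> associahedron B a" unfolding associahedron_def x(1) initial_pnt[symmetric] using pnt_mesh[of x] by blast
  then show "v \<in> folding_space P w B a \<inter> associahedron B a" using x(1) by (simp add: folding_space_eq)
qed

lemma faces_section: "{T. T face_of emb ` ptope \<and> T \<noteq> {}} = (`) emb ` {T. T face_of ptope \<and> T \<noteq> {}}"
  using faces_of_linear_image[OF linear_emb inj_emb, of ptope] by blast

lemma realizes_section:
  "realizes_generalized_associahedron \<Phi>' \<alpha>' (folding_space P w B a \<inter> associahedron B a)"
  unfolding realizes_generalized_associahedron_def section_eq
proof (rule F.compatible_positions)
  fix \<Theta> assume \<Theta>: "bij_betw \<Theta> (almost_positive_roots \<Phi>' \<alpha>') F.Ob"
    "\<And>\<beta> \<gamma>. \<beta> \<in> almost_positive_roots \<Phi>' \<alpha>' \<Longrightarrow> \<gamma> \<in> almost_positive_roots \<Phi>' \<alpha>' \<Longrightarrow> \<beta> \<noteq> \<gamma> \<Longrightarrow>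
      compatible \<Phi>' \<alpha>' \<beta> \<gamma> \<longleftrightarrow> F.compat (\<Theta> \<beta>) (\<Theta> \<gamma>)"
  have 1: "bij_betw ((`) \<Theta>) (cluster_complex \<Phi>' \<alpha>') simplices"
    using F.bij_betw_cluster_complex[OF \<Theta>] by (simp add: simplices_def)
  have 2: "bij_betw ((`) emb) {T. T face_of ptope \<and> T \<noteq> {}} {T. T face_of emb ` ptope \<and> T \<noteq> {}}"
    unfolding faces_section using inj_emb by (auto simp: bij_betw_def inj_on_def inj_image_eq_iff)
  have "bij_betw (\<lambda>X. emb ` fc (\<Theta> ` X)) (cluster_complex \<Phi>' \<alpha>') {T. T face_of emb ` ptope \<and> T \<noteq> {}}"
    using bij_betw_trans[OF 1 bij_betw_trans[OF bij_faces 2]] by (simp add: comp_def)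
  moreover have "X \<subseteq> Y \<longleftrightarrow> emb ` fc (\<Theta> ` Y) \<subseteq> emb ` fc (\<Theta> ` X)"
    if X: "X \<in> cluster_complex \<Phi>' \<alpha>'" and Y: "Y \<in> cluster_complex \<Phi>' \<alpha>'" for X Y
  proof -
    have "\<Theta> ` X \<in> simplices" "\<Theta> ` Y \<in> simplices" using bij_betwE[OF 1] X Y by auto
    then have "emb ` fc (\<Theta> ` Y) \<subseteq> emb ` fc (\<Theta> ` X) \<longleftrightarrow> \<Theta> ` X \<subseteq> \<Theta> ` Y"
      using inj_image_subset_iff[OF inj_emb] fc_subset_iff by simp
    also have "\<dots> \<longleftrightarrow> X \<subseteq> Y"
      using X Y \<Theta>(1) by (intro inj_on_image_subset_iff[of _ "almost_positive_roots \<Phi>' \<alpha>'"]) (auto simp: cluster_complex_def bij_betw_def)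
    finally show ?thesis by simp
  qed
  moreover have "polytope (emb ` ptope)" by (rule polytope_linear_image[OF linear_emb polytope_poly])
  ultimately show "polytope (emb ` ptope) \<and> (\<exists>f. bij_betw f (cluster_complex \<Phi>' \<alpha>') {F. F face_of emb ` ptope \<and> F \<noteq> {}} \<and>
      (\<forall>X\<in>cluster_complex \<Phi>' \<alpha>'. \<forall>Y\<in>cluster_complex \<Phi>' \<alpha>'. (X \<subseteq> Y) = (f Y \<subseteq> f X)))"
    by blast
qed

section \<open>Normal cones inside the folding space\<close>

lemma block_norm_pos: "0 < (\<Sum>j | P j = I. (w j)\<^sup>2)"
  by (rule sum_pos2[of _ "rep I"]) (use w_pos[of "rep I"] in auto)

lemma from_g_coords_emb: "from_g_coords P w g = emb (\<chi> I. g $ I / (\<Sum>j | P j = I. (w j)\<^sup>2))"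
proof -
  have "initial_g_vector P w I $ j = (if I = P j then w j / (\<Sum>j | P j = I. (w j)\<^sup>2) else 0)" for I j
  proof -
    have "(\<Sum>k | P k = I. w k * axis k 1 $ j) = (\<Sum>k\<in>UNIV. if k = j then if I = P j then w j else 0 else 0)"
      unfolding U.sum_Collect_if by (intro sum.cong) (auto simp: axis_def)
    then show ?thesis by (simp add: initial_g_vector_def)
  qed
  then have "from_g_coords P w g $ j = (\<Sum>I\<in>UNIV. if I = P j then w j * (g $ P j / (\<Sum>k | P k = P j. (w k)\<^sup>2)) else 0)" for j
    unfolding from_g_coords_def sum_component vector_scaleR_component by (intro sum.cong) auto
  then show ?thesis by (simp add: vec_eq_iff emb_def)
qed

text \<open>Division by the block norms makes \<open>from_g_coords\<close> the inverse of the
  adjoint of \<open>emb\<close> inside the folding space, which is how normal vectors transform when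
  a polytope is embedded by \<open>emb\<close>.\<close>

lemma from_g_coords_inner: "from_g_coords P w g \<bullet> emb x = g \<bullet> x"
proof -
  have "from_g_coords P w g \<bullet> emb x = (\<Sum>j\<in>UNIV. (w j * (g $ P j / (\<Sum>k | P k = P j. (w k)\<^sup>2))) * (w j * x $ P j))"
    unfolding from_g_coords_emb inner_vec_def by (simp add: emb_def)
  also have "\<dots> = (\<Sum>I\<in>UNIV. \<Sum>j | P j = I. (w j)\<^sup>2 * (g $ I * x $ I / (\<Sum>k | P k = I. (w k)\<^sup>2)))"
    by (subst sum_blocks) (auto intro!: sum.cong simp: power2_eq_square)
  also have "\<dots> = (\<Sum>I\<in>UNIV. g $ I * x $ I)"
  proof (rule sum.cong[OF refl])
    fix I
    show "(\<Sum>j | P j = I. (w j)\<^sup>2 * (g $ I * x $ I / (\<Sum>k | P k = I. (w k)\<^sup>2))) = g $ I * x $ I"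
      using block_norm_pos[of I] unfolding sum_distrib_right[symmetric] by simp
  qed
  finally show ?thesis by (simp add: inner_vec_def)
qed

lemma range_from_g_coords: "range (from_g_coords P w) = range emb"
proof
  show "range emb \<subseteq> range (from_g_coords P w)"
  proof (rule image_subsetI)
    fix x
    have "emb x = from_g_coords P w (\<chi> I. x $ I * (\<Sum>j | P j = I. (w j)\<^sup>2))"
      using block_norm_pos by (simp add: from_g_coords_emb less_imp_neq[symmetric])
    then show "emb x \<in> range (from_g_coords P w)" by blast
  qed
qed (auto simp: from_g_coords_emb)

lemma normal_cone_emb:
  "normal_cone (range emb) (emb ` S) (emb ` T) = from_g_coords P w ` normal_cone UNIV S T"
  unfolding range_from_g_coords[symmetric] normal_cone_def by (auto simp: from_g_coords_inner)

lemma normal_fan_section: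
  assumes "\<And>i j. B' $ i $ j = F.skew (\<alpha>' j) (\<alpha>' i) / F.hsq i"
  shows "normal_fan (folding_space P w B a) (folding_space P w B a \<inter> associahedron B a) =
    (\<lambda>K. from_g_coords P w ` K) ` g_vector_fan B'"
proof -
  have "normal_fan (range emb) (emb ` ptope) = normal_cone (range emb) (emb ` ptope) ` {T. T face_of emb ` ptope \<and> T \<noteq> {}}"
    by (auto simp: normal_fan_def)
  also have "\<dots> = (\<lambda>K. from_g_coords P w ` K) ` normal_cone UNIV ptope ` {T. T face_of ptope \<and> T \<noteq> {}}"
    unfolding faces_section image_image normal_cone_emb ..
  also have "normal_cone UNIV ptope ` {T. T face_of ptope \<and> T \<noteq> {}} = normal_fan UNIV ptope"
    by (auto simp: normal_fan_def)
  also have "\<dots> = g_vector_fan B'"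
    unfolding normal_fan_poly F.g_vector_fan_eq[OF assms] simplices_def by auto
  finally show ?thesis unfolding section_eq unfolding folding_space_eq .
qed

end

end

text \<open>What remains is to instantiate \<open>folded_word\<close>. A height function for
  \<open>B'\<close> pulled back along \<open>P\<close> is one for \<open>B\<close>, since arrows of
  \<open>B\<close> lie over arrows of \<open>B'\<close>, and the block sums of
  \<open>folds_to\<close> become weighted arrow counts.\<close>

theorem theorem3p4:
  fixes \<Phi>' :: "(real^'m::finite) set" and \<alpha>' :: "'m \<Rightarrow> real^'m" and B' :: "real^'m^'m"
    and \<Phi> :: "(real^'n::finite) set" and \<alpha> :: "'n \<Rightarrow> real^'n" and B :: "real^'n^'n"
    and P :: "'n \<Rightarrow> 'm" and w :: "'n \<Rightarrow> real" and c :: "nat \<Rightarrow> 'n \<Rightarrow> real"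
  assumes "root_system \<Phi>'" and "simple_system \<Phi>' \<alpha>'" and "acyclic_quiver_of_type \<alpha>' B'"
    and "root_system \<Phi>" and "simple_system \<Phi> \<alpha>" and "simply_laced \<alpha>"
    and "acyclic_quiver_of_type \<alpha> B"
    and "weighted_unfolding P w B B'"
    and "crystallographic \<alpha>' \<Longrightarrow> (\<forall>j. w j = 1)"
    and "\<And>k i. (k, i) \<in> ar_objects B \<Longrightarrow> k \<ge> 2 \<Longrightarrow> c k i > 0"
    and "\<And>k i j. (k, i) \<in> ar_objects B \<Longrightarrow> (k, j) \<in> ar_objects B \<Longrightarrow> k \<ge> 2 \<Longrightarrow> P i = P j
           \<Longrightarrow> w i * c k j = w j * c k i"
  shows "realizes_generalized_associahedron \<Phi>' \<alpha>' (folding_space P w B c \<inter> associahedron B c) \<and>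
    normal_fan (folding_space P w B c) (folding_space P w B c \<inter> associahedron B c) =
      (\<lambda>K. from_g_coords P w ` K) ` g_vector_fan B'"
proof -
  interpret F: root_basis \<Phi>' \<alpha>' by (rule root_basis.intro[OF assms(1,2)])
  interpret U: root_basis \<Phi> \<alpha> by (rule root_basis.intro[OF assms(4,5)])
  have B': "B' $ i $ i = 0" "i \<noteq> j \<Longrightarrow> \<bar>B' $ i $ j\<bar> = F.cf i j" "B' $ i $ j > 0 \<longleftrightarrow> B' $ j $ i < 0" for i j
    using assms(3) unfolding acyclic_quiver_of_type_def cartan_def F.cf_def F.hsq_def by auto
  have B: "B $ i $ i = 0" "i \<noteq> j \<Longrightarrow> \<bar>B $ i $ j\<bar> = U.cf i j" "B $ i $ j > 0 \<longleftrightarrow> B $ j $ i < 0" for i j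
    using assms(7) unfolding acyclic_quiver_of_type_def cartan_def U.cf_def U.hsq_def by auto
  have laced: "U.cf i j = 1" if "i \<noteq> j" "\<alpha> i \<bullet> \<alpha> j \<noteq> 0" for i j
    using assms(6) that unfolding simply_laced_def cartan_def U.cf_def U.hsq_def by (fastforce simp: field_simps)
  have surj: "surj P" and w: "0 < w j" and "folds_to P w B B'" for j
    using assms(8) composite_mutations.initial[of P B B'] unfolding weighted_unfolding_def by blast+
  then have block: "(\<Sum>i | P i = I. w i * B $ i $ j / w j) = B' $ I $ P j"
    and sign: "0 \<le> B' $ P i $ P j \<Longrightarrow> 0 \<le> B $ i $ j" for I i j
    unfolding folds_to_def by blast+

  have adj': "\<alpha>' i \<bullet> \<alpha>' j \<noteq> 0 \<longleftrightarrow> B' $ j $ i \<noteq> 0" if "i \<noteq> j" for i j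
    using B'(2)[of j i] that F.cf_eq_0_iff[of j i] by (auto simp: inner_commute)
  have adj: "\<alpha> i \<bullet> \<alpha> j \<noteq> 0 \<longleftrightarrow> B $ j $ i \<noteq> 0" if "i \<noteq> j" for i j
    using B(2)[of j i] that U.cf_eq_0_iff[of j i] by (auto simp: inner_commute)
  have arr0: "(0 < B' $ j $ i) \<longleftrightarrow> \<not> (0 < B' $ i $ j)" if "i \<noteq> j" "\<alpha>' i \<bullet> \<alpha>' j \<noteq> 0" for i j
    using adj'[OF that(1)] that(2) B'(3)[of i j] by auto
  obtain \<eta> where \<eta>: "F.height \<eta>" "\<And>i j. i \<noteq> j \<Longrightarrow> \<alpha>' i \<bullet> \<alpha>' j \<noteq> 0 \<Longrightarrow> 0 < B' $ j $ i \<longleftrightarrow> \<eta> j < \<eta> i"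
    by (rule F.exists_height[of "\<lambda>i j. 0 < B' $ j $ i", OF arr0], assumption, assumption, rule that, assumption, assumption)
  obtain q where "coxeter_word \<Phi>' \<alpha>' \<eta> q" using F.exists_word[OF \<eta>(1)] .
  then interpret F: coxeter_word \<Phi>' \<alpha>' \<eta> q .
  have arr': "0 < B' $ j $ i \<longleftrightarrow> \<alpha>' i \<bullet> \<alpha>' j \<noteq> 0 \<and> \<eta> j < \<eta> i" for i j
    using \<eta>(2)[of i j] adj'[of i j] B'(1)[of i] by (cases "i = j") auto

  \<comment> \<open>Otherwise \<open>B' $ P i $ P j\<close> would be nonnegative, and the sign
    clause would make \<open>B $ i $ j\<close> nonnegative, although it is negative opposite to the
    arrow.\<close>
  have down: "0 < B' $ P j $ P i" if "0 < B $ j $ i" for i j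
    using sign[of i j] B(3)[of j i] B'(3)[of "P j" "P i"] that by linarith
  have arr: "(i, j) \<in> arrows B \<longleftrightarrow> \<alpha> i \<bullet> \<alpha> j \<noteq> 0 \<and> \<eta> (P j) < \<eta> (P i)" for i j
  proof (cases "i = j")
    case True then show ?thesis using B(1)[of i] by (simp add: arrows_def)
  next
    case False
    show ?thesis using adj[OF False] down[of j i] down[of i j] B(3)[of i j] arr'[of "P j" "P i"] arr'[of "P i" "P j"]
      by (auto simp: arrows_def)
  qed
  have "U.height (\<lambda>i. \<eta> (P i))"
    unfolding U.height_def
  proof (intro allI impI)
    fix i j assume ij: "i \<noteq> j \<and> \<alpha> i \<bullet> \<alpha> j \<noteq> 0"
    have *: "\<eta> (P i) = Suc (\<eta> (P j))" if "0 < B $ j $ i" for i j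
    proof -
      have "\<alpha>' (P i) \<bullet> \<alpha>' (P j) \<noteq> 0" "\<eta> (P j) < \<eta> (P i)" using down[OF that] arr'[of "P j" "P i"] by auto
      then show ?thesis using \<eta>(1)[unfolded F.height_def, THEN spec, THEN spec, of "P i" "P j"] by auto
    qed
    show "\<eta> (P i) = Suc (\<eta> (P j)) \<or> \<eta> (P j) = Suc (\<eta> (P i))"
      using *[of i j] *[of j i] adj[of i j] ij B(3)[of i j] by linarith
  qed
  then obtain p where "coxeter_word \<Phi> \<alpha> (\<lambda>i. \<eta> (P i)) p" by (rule U.exists_word)
  then interpret U: coxeter_word \<Phi> \<alpha> "\<lambda>i. \<eta> (P i)" p .

  have one: "B $ j $ i = 1" "B $ i $ j = - 1" if "0 < B $ j $ i" for i j
  proof -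
    have "i \<noteq> j" using B(1)[of i] that by auto
    then show "B $ j $ i = 1" "B $ i $ j = - 1"
      using adj[of i j] laced[of i j] laced[of j i] B(2)[of i j] B(2)[of j i] B(3)[of j i] that by (auto simp: inner_commute)
  qed
  have wsum: "(\<Sum>j | P j = J. w j * B $ j $ i) = w i * B' $ J $ P i" for i J
    using block[where I = J and j = i] w[of i] by (simp add: field_simps flip: sum_divide_distrib)

  \<comment> \<open>Entries of one block have one sign and in the simply-laced case absolute value
    1, so the weighted column sum counts arrows.\<close>
  have out: "(\<Sum>j | P j = J \<and> (i, j) \<in> arrows B. w j) = w i * (if \<eta> J < \<eta> (P i) then F.cf J (P i) else 0)" for i J
  proof (cases "0 < B' $ J $ P i")
    case True
    then have J: "\<eta> J < \<eta> (P i)" using arr'[of J "P i"] by simp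
    have "(\<Sum>j | P j = J \<and> (i, j) \<in> arrows B. w j) = (\<Sum>j | P j = J. w j * B $ j $ i)"
    proof (rule sum.mono_neutral_cong_left)
      show "\<forall>j\<in>{j. P j = J} - {j. P j = J \<and> (i, j) \<in> arrows B}. w j * B $ j $ i = 0"
      proof
        fix j assume j: "j \<in> {j. P j = J} - {j. P j = J \<and> (i, j) \<in> arrows B}"
        then have "0 \<le> B $ j $ i" "\<not> 0 < B $ j $ i" using sign[of j i] True by (auto simp: arrows_def)
        then show "w j * B $ j $ i = 0" by simp
      qed
      show "w j = w j * B $ j $ i" if "j \<in> {j. P j = J \<and> (i, j) \<in> arrows B}" for j
        using one(1)[of j i] that by (simp add: arrows_def)
    qed auto
    also have "\<dots> = w i * \<bar>B' $ J $ P i\<bar>" using wsum True by simp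
    finally show ?thesis using J B'(2)[of J "P i"] by force
  next
    case False
    then have e: "{j. P j = J \<and> (i, j) \<in> arrows B} = {}" using down by (auto simp: arrows_def)
    have "F.cf J (P i) = 0" if "\<eta> J < \<eta> (P i)" using False that arr'[of J "P i"] by (simp add: F.cf_eq_0_iff inner_commute)
    then show ?thesis unfolding e by simp
  qed
  \<comment> \<open>The same column sum is used, now with entries -1: an arrow from \<open>j\<close>
    to \<open>i\<close> appears in column \<open>i\<close> as a negative entry.\<close>
  have inn: "(\<Sum>j | P j = J \<and> (j, i) \<in> arrows B. w j) = w i * (if \<eta> (P i) < \<eta> J then F.cf J (P i) else 0)" for i J
  proof (cases "0 < B' $ P i $ J")
    case True
    then have J: "\<eta> (P i) < \<eta> J" using arr'[of "P i" J] by simp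
    have "(\<Sum>j | P j = J \<and> (j, i) \<in> arrows B. w j) = (\<Sum>j | P j = J. - (w j * B $ j $ i))"
    proof (rule sum.mono_neutral_cong_left)
      show "\<forall>j\<in>{j. P j = J} - {j. P j = J \<and> (j, i) \<in> arrows B}. - (w j * B $ j $ i) = 0"
      proof
        fix j assume j: "j \<in> {j. P j = J} - {j. P j = J \<and> (j, i) \<in> arrows B}"
        then have "0 \<le> B $ i $ j" "\<not> 0 < B $ i $ j" using sign[of i j] True by (auto simp: arrows_def)
        then show "- (w j * B $ j $ i) = 0" using B(3)[of i j] B(3)[of j i] by simp
      qed
      show "w j = - (w j * B $ j $ i)" if "j \<in> {j. P j = J \<and> (j, i) \<in> arrows B}" for j
        using one(2)[of i j] that by (simp add: arrows_def)
    qed auto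
    also have "\<dots> = w i * \<bar>B' $ J $ P i\<bar>" using wsum[where J = J and i = i] True B'(3)[of "P i" J] by (simp add: sum_negf)
    finally show ?thesis using J B'(2)[of J "P i"] by force
  next
    case False
    then have e: "{j. P j = J \<and> (j, i) \<in> arrows B} = {}" using down by (auto simp: arrows_def)
    have "F.cf J (P i) = 0" if "\<eta> (P i) < \<eta> J" using False that arr'[of "P i" J] by (simp add: F.cf_eq_0_iff)
    then show ?thesis unfolding e by simp
  qed
  interpret folded_word \<Phi>' \<alpha>' \<eta> q \<Phi> \<alpha> P p B w
    by unfold_locales (rule arr laced surj w out inn; assumption?)+

  have skew: "B' $ i $ j = F.skew (\<alpha>' j) (\<alpha>' i) / F.hsq i" for i j
  proof (cases "i = j")
    case True then show ?thesis by (simp add: B'(1) F.skew_simple_div)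
  next
    case False
    then have "\<alpha>' i \<bullet> \<alpha>' j \<noteq> 0 \<Longrightarrow> \<eta> i \<noteq> \<eta> j" using \<eta>(1) by (force simp: F.height_def)
    then show ?thesis
      using False B'(2)[of i j] B'(3)[of i j] arr'[of i j] arr'[of j i] adj'[of j i] F.cf_eq_0_iff[of i j]
      by (auto simp: F.skew_simple_div inner_commute)
  qed
  show ?thesis
  proof
    show "realizes_generalized_associahedron \<Phi>' \<alpha>' (folding_space P w B c \<inter> associahedron B c)"
      by (rule realizes_section[OF assms(10,11)])
    show "normal_fan (folding_space P w B c) (folding_space P w B c \<inter> associahedron B c) =
        (\<lambda>K. from_g_coords P w ` K) ` g_vector_fan B'"
      by (rule normal_fan_section[OF assms(10,11) skew])
  qed
qed

end
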